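(* Let $X\subseteq\mathbb{K}^n$ be a rational trinomial hypersurface $T_0^{l_0}+T_1^{l_1}+T_2^{l_2}=0$ of type II, i.e. with $d=2$ and $d_{01}=d_{02}=d_{12}=1$, and let $S:\bar N\to N$ be any homomorphism with $S\circ F=\mathrm{id}_N$ (all notation as in the context). Let $\sigma=S(\mathbb{Q}^n_{\ge0}\cap N_{\mathbb{Q}})\subseteq N_{\mathbb{Q}}$, let $\imath\in\mathbb{K}$ satisfy $\imath^2=-1$, and put $$\Delta_0=\mathrm{conv}\Big\{S\Big(\tfrac{2}{l_{0j}}e_{j}\Big)\ \Big|\ j=1,\dots,n_0\Big\}+\sigma,$$ $$\Delta_1=\mathrm{conv}\Big\{S\Big(\tfrac{2}{l_{1j}}e_{n_0+j}\Big)\ \Big|\ j=1,\dots,n_1\Big\}+\sigma,$$ $$\Delta_2=\mathrm{conv}\Big\{S\Big(\tfrac{2}{l_{2j}}e_{n_0+n_1+j}\Big)\ \Big|\ j=1,\dots,n_2\Big\}+\sigma.$$ Then $$\mathfrak{D}=\Delta_0\cdot(\{1\}+\{-1\})+\Delta_1\cdot(\{\imath\}+\{-\imath\})+\Delta_2\cdot(\{0\}+\{\infty\})$$ is a proper $\sigma$-polyhedral divisor on $\mathbb{P}^1$ corresponding to the complexity one torus action of $T$ on $X$.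
   Context: $\mathbb{K}$ is an algebraically closed field of characteristic $0$. For a point $z\in\mathbb{P}^1=\mathbb{K}\cup\{\infty\}$, $\{z\}$ denotes the corresponding prime divisor. Trinomial hypersurfaces. Let $n_0,n_1,n_2$ be positive integers, $n=n_0+n_1+n_2$. For $i=0,1,2$ let $l_i=(l_{i1},\dots,l_{in_i})$ be a tuple of positive integers, and assume that for no $i$ one has $n_i=1$ and $l_{i1}=1$. Put $T_i^{l_i}=T_{i1}^{l_{i1}}\cdots T_{in_i}^{l_{in_i}}$. The trinomial hypersurface is $X=\{T_0^{l_0}+T_1^{l_1}+T_2^{l_2}=0\}\subseteq\mathbb{K}^n$, the coordinates being ordered $T_{01},\dots,T_{0n_0},T_{11},\dots,T_{1n_1},T_{21},\dots,T_{2n_2}$. Numbers. $d_i=\gcd(l_{i1},\dots,l_{in_i})$, $d=\gcd(d_0,d_1,d_2)$, $d_{ij}=\gcd(d_i/d,d_j/d)$. Torus action. Let $\bar T=(\mathbb{K}^\times)^n$ act diagonally on $\mathbb{K}^n$; its lattice of one-parameter subgroups is $\bar N=\mathbb{Z}^n$ with standard basis $e_1,\dots,e_n$. Let $L:\bar N\to\mathbb{Z}^2$ be given by the $2\times n$ matrix $\begin{pmatrix}-l_0&l_1&0\\-l_0&0&l_2\end{pmatrix}$, let $N=\ker L$, and let $F:N\to\bar N$ be the inclusion. The subtorus $T\subseteq\bar T$ with one-parameter subgroup lattice $N$ has dimension $n-2$ and preserves $X$; this is the complexity one torus action on $X$. Let $M=\mathrm{Hom}(N,\mathbb{Z})$,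 $N_{\mathbb{Q}}=\mathbb{Q}\otimes N$, $M_{\mathbb{Q}}=\mathbb{Q}\otimes M$. The action gives an $M$-grading on $\mathbb{K}[X]$ in which the $k$-th coordinate function has degree $e_k^*\circ F\in M$. The map $S$ is extended $\mathbb{Q}$-linearly to $\bar N_{\mathbb{Q}}=\mathbb{Q}^n\to N_{\mathbb{Q}}$. Polyhedral divisors. Let $\sigma\subseteq N_{\mathbb{Q}}$ be a polyhedral cone with dual cone $\sigma^\vee\subseteq M_{\mathbb{Q}}$. The recession cone of a polyhedron is the cone of directions of rays contained in it. On a normal variety $Y$, consider finite formal sums $\mathfrak{D}=\sum_i\Delta_i\cdot D_i$ with $D_i$ Weil divisors on $Y$ and $\Delta_i\subseteq N_{\mathbb{Q}}$ polyhedra with recession cone $\sigma$. For $u\in\sigma^\vee$ put $\mathfrak{D}(u)=\sum_i\min_{v\in\Delta_i}\langle u,v\rangle\cdot D_i$, a rational Weil divisor. For a rational Weil divisor $D$ let $\Gamma(Y,\mathcal{O}(D))=\{f\in\mathbb{K}(Y)^\times\mid (f)+D\ge 0\}\cup\{0\}$, and for $0\ne f\in\Gamma(Y,\mathcal{O}(D))$ put $Y_f=Y\setminus\mathrm{Supp}(D+(f))$. $D$ is semiample if for some $m\in\mathbb{Z}_{>0}$ the sets $Y_f$, $0\neq f\in\Gamma(Y,\mathcal{O}(mD))$, cover $Y$; $D$ is big if for some $m\in\mathbb{Z}_{>0}$ there is $0\neq f\in\Gamma(Y,\mathcal{O}(mD))$ with $Y_f$ affine. $\mathfrak{D}$ is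 a proper $\sigma$-polyhedral divisor (pp-divisor) if $\mathfrak{D}(u)$ is $\mathbb{Q}$-Cartier and semiample for all $u\in\sigma^\vee$, and big for all $u$ in the relative interior of $\sigma^\vee$. The pp-divisor $\mathfrak{D}$ on a projective normal variety $Y$ corresponds to the $T$-action on the normal affine variety $X$ if there is an isomorphism of $M$-graded algebras $\mathbb{K}[X]\cong\bigoplus_{m\in\sigma^\vee\cap M}\Gamma(Y,\mathcal{O}(\mathfrak{D}(m)))$, where multiplication on the right is that of $\mathbb{K}(Y)$. *)

theory Defs
  imports
    "HOL-Analysis.Cartesian_Space"
    "HOL-Computational_Algebra.Polynomial"
    "HOL-Computational_Algebra.Fraction_Field"
    "HOL-Library.Poly_Mapping"
    "HOL-Library.Function_Algebras"
begin

section \<open>The projective line\<close>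

datatype 'k proj_line = Pt 'k | Infty

type_synonym 'k ratfun = "'k poly fract"

fun poly_ord :: "'k::field proj_line \<Rightarrow> 'k poly \<Rightarrow> int" where
  "poly_ord (Pt a) p = int (order a p)"
| "poly_ord Infty p = - int (degree p)"

text \<open>Only meaningful for \<open>f \<noteq> 0\<close>.\<close>
definition ord_at :: "'k::field proj_line \<Rightarrow> 'k ratfun \<Rightarrow> int" where
  "ord_at z f = (THE k. \<exists>p q. p \<noteq> 0 \<and> q \<noteq> 0 \<and> f = Fract p q \<and> k = poly_ord z p - poly_ord z q)"

lemma poly_ord_mult:
  assumes "p \<noteq> 0" "q \<noteq> 0"
  shows "poly_ord z (p * q) = poly_ord z p + poly_ord z q"
  using assms by (cases z) (simp_all add: order_mult degree_mult_eq)

lemma ord_at_Fract: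
  fixes p q :: "'k::field poly"
  assumes "p \<noteq> 0" "q \<noteq> 0"
  shows "ord_at z (Fract p q) = poly_ord z p - poly_ord z q"
  unfolding ord_at_def
proof (rule the_equality)
  show "\<exists>p' q'. p' \<noteq> 0 \<and> q' \<noteq> 0 \<and> Fract p q = Fract p' q'
      \<and> poly_ord z p - poly_ord z q = poly_ord z p' - poly_ord z q'"
    using assms by blast
next
  fix k
  assume "\<exists>p' q'. p' \<noteq> 0 \<and> q' \<noteq> 0 \<and> Fract p q = Fract p' q'
      \<and> k = poly_ord z p' - poly_ord z q'"
  then obtain p' q' where h: "p' \<noteq> 0" "q' \<noteq> 0" "Fract p q = Fract p' q'"
    and k: "k = poly_ord z p' - poly_ord z q'" by blast
  have "p * q' = p' * q" using h assms by (simp add: eq_fract)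
  then have "poly_ord z p + poly_ord z q' = poly_ord z p' + poly_ord z q"
    using poly_ord_mult assms h by metis
  then show "k = poly_ord z p - poly_ord z q" using k by simp
qed

text \<open>\<open>has_value f z c\<close>: the rational function \<open>f\<close> is regular at \<open>z\<close>, with value \<open>c\<close>.\<close>
fun has_value :: "'k::field ratfun \<Rightarrow> 'k proj_line \<Rightarrow> 'k \<Rightarrow> bool" where
  "has_value f (Pt a) c \<longleftrightarrow>
     (\<exists>p q. f = Fract p q \<and> poly q a \<noteq> 0 \<and> c = poly p a / poly q a)"
| "has_value f Infty c \<longleftrightarrow>
     (\<exists>p q. f = Fract p q \<and> q \<noteq> 0 \<and> degree p \<le> degree q
        \<and> c = coeff p (degree q) / coeff q (degree q))"

definition open_P1 :: "'k proj_line set \<Rightarrow> bool" where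
  "open_P1 V \<longleftrightarrow> V = {} \<or> finite (- V)"

text \<open>Functions with values in the ground field that are regular on the open set \<open>V\<close>;
  the values outside \<open>V\<close> are ignored.\<close>
definition regular_P1 :: "'k::field proj_line set \<Rightarrow> ('k proj_line \<Rightarrow> 'k) \<Rightarrow> bool" where
  "regular_P1 V h \<longleftrightarrow> (\<exists>f. \<forall>z\<in>V. has_value f z (h z))"


section \<open>Closed subvarieties of affine space, affine open subsets of the projective line\<close>

inductive_set generated_algebra :: "('p \<Rightarrow> 'k) set \<Rightarrow> ('p \<Rightarrow> 'k::comm_ring_1) set"
  for G :: "('p \<Rightarrow> 'k) set" where
  const: "(\<lambda>x. c) \<in> generated_algebra G"
| gen: "g \<in> G \<Longrightarrow> g \<in> generated_algebra G"
| add: "f \<in> generated_algebra G \<Longrightarrow> g \<in> generated_algebra G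
          \<Longrightarrow> (\<lambda>x. f x + g x) \<in> generated_algebra G"
| mult: "f \<in> generated_algebra G \<Longrightarrow> g \<in> generated_algebra G
          \<Longrightarrow> (\<lambda>x. f x * g x) \<in> generated_algebra G"

definition affine_space :: "nat \<Rightarrow> (nat \<Rightarrow> 'k) set" where
  "affine_space m = {..<m} \<rightarrow>\<^sub>E UNIV"

definition affine_polys :: "nat \<Rightarrow> ((nat \<Rightarrow> 'k::field) \<Rightarrow> 'k) set" where
  "affine_polys m = generated_algebra {\<lambda>x. x j |j. j < m}"

definition closed_affine :: "nat \<Rightarrow> (nat \<Rightarrow> 'k::field) set \<Rightarrow> bool" where
  "closed_affine m Z \<longleftrightarrow>
     (\<exists>P \<subseteq> affine_polys m. Z = {x \<in> affine_space m. \<forall>p\<in>P. p x = 0})"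

definition open_in_affine :: "nat \<Rightarrow> (nat \<Rightarrow> 'k::field) set \<Rightarrow> (nat \<Rightarrow> 'k) set \<Rightarrow> bool" where
  "open_in_affine m Z W \<longleftrightarrow> (\<exists>C. closed_affine m C \<and> W = Z - C)"

definition regular_affine ::
    "nat \<Rightarrow> (nat \<Rightarrow> 'k::field) set \<Rightarrow> (nat \<Rightarrow> 'k) set \<Rightarrow> ((nat \<Rightarrow> 'k) \<Rightarrow> 'k) \<Rightarrow> bool" where
  "regular_affine m Z W h \<longleftrightarrow>
     (\<forall>x\<in>W. \<exists>W'. x \<in> W' \<and> W' \<subseteq> W \<and> open_in_affine m Z W' \<and>
        (\<exists>p\<in>affine_polys m. \<exists>q\<in>affine_polys m. \<forall>y\<in>W'. q y \<noteq> 0 \<and> h y = p y / q y))"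

text \<open>An open subset of the projective line is affine if, as a variety (a topological space with
  a sheaf of functions), it is isomorphic to a closed subvariety of some affine space.\<close>
definition affine_open_P1 :: "'k::field proj_line set \<Rightarrow> bool" where
  "affine_open_P1 U \<longleftrightarrow> open_P1 U \<and>
     (\<exists>m Z \<phi>. closed_affine m Z \<and> bij_betw \<phi> U Z
        \<and> (\<forall>V\<subseteq>U. open_P1 V \<longleftrightarrow> open_in_affine m Z (\<phi> ` V))
        \<and> (\<forall>V\<subseteq>U. open_P1 V \<longrightarrow>
             (\<forall>h. regular_P1 V (\<lambda>z. h (\<phi> z)) \<longleftrightarrow> regular_affine m Z (\<phi> ` V) h)))"


section \<open>Divisors on the projective line\<close>

type_synonym 'k wdiv = "'k proj_line \<Rightarrow>\<^sub>0 int"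
type_synonym 'k qdiv = "'k proj_line \<Rightarrow>\<^sub>0 rat"

definition prime_div :: "'k proj_line \<Rightarrow> 'k wdiv" where
  "prime_div z = Poly_Mapping.single z 1"

definition rat_times_wdiv :: "rat \<Rightarrow> 'k wdiv \<Rightarrow> 'k qdiv" where
  "rat_times_wdiv c D = Poly_Mapping.map (\<lambda>k. c * of_int k) D"

definition nat_times_qdiv :: "nat \<Rightarrow> 'k qdiv \<Rightarrow> 'k qdiv" where
  "nat_times_qdiv m D = Poly_Mapping.map (\<lambda>k. of_nat m * k) D"

definition div_sections :: "'k::field qdiv \<Rightarrow> 'k ratfun set" where
  "div_sections D =
     {f. f \<noteq> 0 \<and> (\<forall>z. of_int (ord_at z f) + Poly_Mapping.lookup D z \<ge> 0)} \<union> {0}"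

text \<open>The open set \<open>Y\<^sub>f\<close>, the complement of the support of \<open>D + (f)\<close>.\<close>
definition nonvanishing :: "'k::field qdiv \<Rightarrow> 'k ratfun \<Rightarrow> 'k proj_line set" where
  "nonvanishing D f = - {z. Poly_Mapping.lookup D z + of_int (ord_at z f) \<noteq> 0}"

definition semiample :: "'k::field qdiv \<Rightarrow> bool" where
  "semiample D \<longleftrightarrow> (\<exists>m>0. let D' = nat_times_qdiv m D in
     (\<Union>f \<in> div_sections D' - {0}. nonvanishing D' f) = UNIV)"

definition big :: "'k::field qdiv \<Rightarrow> bool" where
  "big D \<longleftrightarrow> (\<exists>m>0. let D' = nat_times_qdiv m D in
     \<exists>f \<in> div_sections D' - {0}. affine_open_P1 (nonvanishing D' f))"

text \<open>Locally principal; since \<open>ord_at\<close> is integral, so are the coefficients of \<open>D\<close>.\<close>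
definition cartier :: "'k::field qdiv \<Rightarrow> bool" where
  "cartier D \<longleftrightarrow> (\<forall>z. \<exists>V f. open_P1 V \<and> z \<in> V \<and> f \<noteq> 0 \<and>
     (\<forall>y\<in>V. Poly_Mapping.lookup D y = of_int (ord_at y f)))"

definition q_cartier :: "'k::field qdiv \<Rightarrow> bool" where
  "q_cartier D \<longleftrightarrow> (\<exists>m>0. cartier (nat_times_qdiv m D))"


section \<open>Lattices and rational convex geometry\<close>

text \<open>A sublattice \<open>N\<close> of the integral vectors is given as a subset of \<open>int^'n\<close>, and the
  vector space \<open>N\<^sub>\<rat>\<close> as its rational span in \<open>rat^'n\<close>. Elements of
  \<open>M\<^sub>\<rat>\<close> are represented as functions on all of \<open>rat^'n\<close> which are
  linear on \<open>N\<^sub>\<rat>\<close> and zero outside; with this normalisation addition in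
  \<open>M\<^sub>\<rat>\<close> is pointwise addition. \<open>M\<close> is identified with the set of those elements of
  \<open>M\<^sub>\<rat>\<close> which are integral on \<open>N\<close>.\<close>

definition rat_vec :: "int^'n \<Rightarrow> rat^'n" where
  "rat_vec v = (\<chi> k. of_int (v $ k))"

definition lattice_Q :: "(int^'n) set \<Rightarrow> (rat^'n) set" where
  "lattice_Q N = vec.span (rat_vec ` N)"

definition dual_Q :: "(int^'n) set \<Rightarrow> (rat^'n \<Rightarrow> rat) set" where
  "dual_Q N = {u. (\<forall>v\<in>lattice_Q N. \<forall>w\<in>lattice_Q N. u (v + w) = u v + u w)
     \<and> (\<forall>c. \<forall>v\<in>lattice_Q N. u (c *s v) = c * u v)
     \<and> (\<forall>v. v \<notin> lattice_Q N \<longrightarrow> u v = 0)}"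

definition dual_lattice :: "(int^'n) set \<Rightarrow> (rat^'n \<Rightarrow> rat) set" where
  "dual_lattice N = {u \<in> dual_Q N. \<forall>v\<in>N. u (rat_vec v) \<in> \<int>}"

definition qconvex_hull :: "(rat^'n) set \<Rightarrow> (rat^'n) set" where
  "qconvex_hull A = {(\<Sum>x\<in>F. c x *s x) |F c.
     finite F \<and> F \<subseteq> A \<and> (\<forall>x\<in>F. 0 \<le> c x) \<and> (\<Sum>x\<in>F. c x) = 1}"

definition minkowski_sum :: "(rat^'n) set \<Rightarrow> (rat^'n) set \<Rightarrow> (rat^'n) set" where
  "minkowski_sum A B = {x + y |x y. x \<in> A \<and> y \<in> B}"

definition polyhedron_in :: "(int^'n) set \<Rightarrow> (rat^'n) set \<Rightarrow> bool" where
  "polyhedron_in N \<Delta> \<longleftrightarrow> (\<exists>H. finite H \<and> H \<subseteq> dual_Q N \<times> UNIV \<and>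
     \<Delta> = {v \<in> lattice_Q N. \<forall>(u, c)\<in>H. c \<le> u v})"

definition polyhedral_cone_in :: "(int^'n) set \<Rightarrow> (rat^'n) set \<Rightarrow> bool" where
  "polyhedral_cone_in N \<sigma> \<longleftrightarrow> (\<exists>H. finite H \<and> H \<subseteq> dual_Q N \<and>
     \<sigma> = {v \<in> lattice_Q N. \<forall>u\<in>H. 0 \<le> u v})"

definition recession_cone :: "(rat^'n) set \<Rightarrow> (rat^'n) set" where
  "recession_cone \<Delta> = {w. \<exists>v\<in>\<Delta>. \<forall>t\<ge>0. v + t *s w \<in> \<Delta>}"

definition dual_cone :: "(int^'n) set \<Rightarrow> (rat^'n) set \<Rightarrow> (rat^'n \<Rightarrow> rat) set" where
  "dual_cone N \<sigma> = {u \<in> dual_Q N. \<forall>v\<in>\<sigma>. 0 \<le> u v}"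

definition qaffine_hull :: "('v \<Rightarrow> rat) set \<Rightarrow> ('v \<Rightarrow> rat) set" where
  "qaffine_hull C = {(\<lambda>v. \<Sum>x\<in>F. c x * x v) |F c. finite F \<and> F \<subseteq> C \<and> (\<Sum>x\<in>F. c x) = 1}"

text \<open>Interior relative to the affine hull. On the finite-dimensional space
  \<open>M\<^sub>\<rat>\<close> the usual topology is the one of pointwise convergence.\<close>
definition relative_interior :: "('v \<Rightarrow> rat) set \<Rightarrow> ('v \<Rightarrow> rat) set" where
  "relative_interior C = {u \<in> C. \<exists>B. finite B \<and> (\<exists>\<epsilon>>0.
     \<forall>w \<in> qaffine_hull C. (\<forall>v\<in>B. \<bar>w v - u v\<bar> < \<epsilon>) \<longrightarrow> w \<in> C)}"


section \<open>Polyhedral divisors on the projective line\<close>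

text \<open>A finite formal sum of terms \<open>\<Delta> \<cdot> D\<close> is given by the list of the pairs \<open>(\<Delta>, D)\<close>.\<close>
type_synonym ('n, 'k) pdiv = "((rat^'n) set \<times> 'k wdiv) list"

definition min_on :: "(rat^'n \<Rightarrow> rat) \<Rightarrow> (rat^'n) set \<Rightarrow> rat" where
  "min_on u \<Delta> = (LEAST q. q \<in> u ` \<Delta>)"

definition pdiv_eval :: "('n, 'k) pdiv \<Rightarrow> (rat^'n \<Rightarrow> rat) \<Rightarrow> 'k qdiv" where
  "pdiv_eval \<DD> u = (\<Sum>(\<Delta>, D)\<leftarrow>\<DD>. rat_times_wdiv (min_on u \<Delta>) D)"

definition pp_divisor :: "(int^'n) set \<Rightarrow> (rat^'n) set \<Rightarrow> ('n, 'k::field) pdiv \<Rightarrow> bool" where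
  "pp_divisor N \<sigma> \<DD> \<longleftrightarrow>
     polyhedral_cone_in N \<sigma>
   \<and> (\<forall>(\<Delta>, D) \<in> set \<DD>. \<Delta> \<noteq> {} \<and> polyhedron_in N \<Delta> \<and> recession_cone \<Delta> = \<sigma>)
   \<and> (\<forall>u \<in> dual_cone N \<sigma>. q_cartier (pdiv_eval \<DD> u) \<and> semiample (pdiv_eval \<DD> u))
   \<and> (\<forall>u \<in> relative_interior (dual_cone N \<sigma>). big (pdiv_eval \<DD> u))"

text \<open>The \<open>M\<close>-graded algebra of sections of a polyhedral divisor, as a subalgebra of the
  algebra of finitely supported families of rational functions with the convolution product.\<close>
definition section_algebra ::
    "(int^'n) set \<Rightarrow> (rat^'n) set \<Rightarrow> ('n, 'k::field) pdiv
       \<Rightarrow> ((rat^'n \<Rightarrow> rat) \<Rightarrow>\<^sub>0 'k ratfun) set" where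
  "section_algebra N \<sigma> \<DD> = {F. Poly_Mapping.keys F \<subseteq> dual_cone N \<sigma> \<inter> dual_lattice N \<and>
     (\<forall>m \<in> Poly_Mapping.keys F. Poly_Mapping.lookup F m \<in> div_sections (pdiv_eval \<DD> m))}"

definition section_component ::
    "(int^'n) set \<Rightarrow> (rat^'n) set \<Rightarrow> ('n, 'k::field) pdiv \<Rightarrow> (rat^'n \<Rightarrow> rat)
       \<Rightarrow> ((rat^'n \<Rightarrow> rat) \<Rightarrow>\<^sub>0 'k ratfun) set" where
  "section_component N \<sigma> \<DD> m = {F \<in> section_algebra N \<sigma> \<DD>. Poly_Mapping.keys F \<subseteq> {m}}"

definition const_section :: "'k::field \<Rightarrow> ((rat^'n \<Rightarrow> rat) \<Rightarrow>\<^sub>0 'k ratfun)" where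
  "const_section c = Poly_Mapping.single 0 (Fract [:c:] 1)"


section \<open>Torus actions on closed subvarieties of affine space\<close>

text \<open>Restrictions of polynomial functions to \<open>X\<close>, represented as functions that vanish
  outside \<open>X\<close>.\<close>
definition coordinate_ring :: "('k::field^'n) set \<Rightarrow> ('k^'n \<Rightarrow> 'k) set" where
  "coordinate_ring X =
     {\<lambda>x. if x \<in> X then p x else 0 |p. p \<in> generated_algebra {\<lambda>x. x $ k |k. True}}"

text \<open>Diagonal action of the value at \<open>s\<close> of the one-parameter subgroup \<open>v\<close>.\<close>
definition one_ps_act :: "int^'n \<Rightarrow> 'k::field \<Rightarrow> 'k^'n \<Rightarrow> 'k^'n" where
  "one_ps_act v s x = (\<chi> k. (s powi (v $ k)) * x $ k)"

text \<open>The functions of weight \<open>m\<close> for the diagonal torus with lattice \<open>N\<close> of one-parameter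
  subgroups. Their images generate the torus, so it suffices to test on them; the character
  \<open>m\<close> takes the value \<open>s powi m(v)\<close> on the value at \<open>s\<close> of the one-parameter subgroup \<open>v\<close>.\<close>
definition weight_space ::
    "(int^'n) set \<Rightarrow> ('k::field^'n) set \<Rightarrow> (rat^'n \<Rightarrow> rat) \<Rightarrow> ('k^'n \<Rightarrow> 'k) set" where
  "weight_space N X m = {f \<in> coordinate_ring X.
     \<forall>v\<in>N. \<forall>s. s \<noteq> 0 \<longrightarrow> (\<forall>j::int. m (rat_vec v) = of_int j \<longrightarrow>
       (\<forall>x\<in>X. f (one_ps_act v s x) = (s powi j) * f x))}"

definition corresponds ::
    "(int^'n) set \<Rightarrow> (rat^'n) set \<Rightarrow> ('n, 'k::field) pdiv \<Rightarrow> ('k^'n) set \<Rightarrow> bool" where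
  "corresponds N \<sigma> \<DD> X \<longleftrightarrow>
     (\<exists>\<phi>. bij_betw \<phi> (coordinate_ring X) (section_algebra N \<sigma> \<DD>)
        \<and> (\<forall>f\<in>coordinate_ring X. \<forall>g\<in>coordinate_ring X. \<phi> (\<lambda>x. f x + g x) = \<phi> f + \<phi> g)
        \<and> (\<forall>f\<in>coordinate_ring X. \<forall>g\<in>coordinate_ring X. \<phi> (\<lambda>x. f x * g x) = \<phi> f * \<phi> g)
        \<and> (\<forall>c. \<phi> (\<lambda>x. if x \<in> X then c else 0) = const_section c)
        \<and> (\<forall>m\<in>dual_lattice N. \<phi> ` weight_space N X m = section_component N \<sigma> \<DD> m))"


section \<open>Trinomial hypersurfaces\<close>

text \<open>The three blocks of coordinates are indexed by finite types \<open>'a\<close>, \<open>'b\<close>, \<open>'c\<close>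
  (so that \<open>n\<^sub>0\<close>, \<open>n\<^sub>1\<close>, \<open>n\<^sub>2\<close> are their cardinalities), all coordinates by \<open>'a + 'b + 'c\<close>.\<close>

definition trinomial ::
    "('a::finite \<Rightarrow> nat) \<Rightarrow> ('b::finite \<Rightarrow> nat) \<Rightarrow> ('c::finite \<Rightarrow> nat)
       \<Rightarrow> ('k::field^('a + 'b + 'c)) set" where
  "trinomial l0 l1 l2 = {x.
     (\<Prod>j\<in>UNIV. (x $ Inl j) ^ l0 j) + (\<Prod>j\<in>UNIV. (x $ Inr (Inl j)) ^ l1 j)
       + (\<Prod>j\<in>UNIV. (x $ Inr (Inr j)) ^ l2 j) = 0}"

definition trinomial_matrix ::
    "('a::finite \<Rightarrow> nat) \<Rightarrow> ('b::finite \<Rightarrow> nat) \<Rightarrow> ('c::finite \<Rightarrow> nat)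
       \<Rightarrow> int^('a + 'b + 'c)^2" where
  "trinomial_matrix l0 l1 l2 = vector
     [(\<chi> k. case k of Inl j \<Rightarrow> - int (l0 j) | Inr (Inl j) \<Rightarrow> int (l1 j) | Inr (Inr j) \<Rightarrow> 0),
      (\<chi> k. case k of Inl j \<Rightarrow> - int (l0 j) | Inr (Inl j) \<Rightarrow> 0 | Inr (Inr j) \<Rightarrow> int (l2 j))]"

definition trinomial_lattice ::
    "('a::finite \<Rightarrow> nat) \<Rightarrow> ('b::finite \<Rightarrow> nat) \<Rightarrow> ('c::finite \<Rightarrow> nat)
       \<Rightarrow> (int^('a + 'b + 'c)) set" where
  "trinomial_lattice l0 l1 l2 = {v. trinomial_matrix l0 l1 l2 *v v = 0}"

text \<open>The \<open>\<rat>\<close>-linear extension of a homomorphism of lattices.\<close>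
definition extend_Q :: "(int^'n \<Rightarrow> int^'n) \<Rightarrow> rat^'n \<Rightarrow> rat^'n" where
  "extend_Q S v = (\<Sum>k\<in>UNIV. (v $ k) *s rat_vec (S (axis k 1)))"

lemma sum_UNIV_Plus3:
  "(\<Sum>k\<in>(UNIV :: ('a::finite + 'b::finite + 'c::finite) set). g k) =
     (\<Sum>j\<in>UNIV. g (Inl j)) + (\<Sum>j\<in>UNIV. g (Inr (Inl j))) + (\<Sum>j\<in>UNIV. g (Inr (Inr j)))"
  for g :: "_ \<Rightarrow> 'z::comm_monoid_add"
  by (simp add: UNIV_Plus_UNIV[symmetric] sum.Plus add.assoc del: UNIV_Plus_UNIV)

lemma trinomial_lattice_iff:
  "v \<in> trinomial_lattice l0 l1 l2 \<longleftrightarrow>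
     (\<Sum>j\<in>UNIV. int (l0 j) * v $ Inl j) = (\<Sum>j\<in>UNIV. int (l1 j) * v $ Inr (Inl j)) \<and>
     (\<Sum>j\<in>UNIV. int (l0 j) * v $ Inl j) = (\<Sum>j\<in>UNIV. int (l2 j) * v $ Inr (Inr j))"
  by (auto simp: trinomial_lattice_def trinomial_matrix_def matrix_vector_mult_def vec_eq_iff
      forall_2 sum_UNIV_Plus3 sum_negf)

lemma one_ps_act_trinomial:
  fixes s :: "'k::field"
  assumes "v \<in> trinomial_lattice l0 l1 l2" "s \<noteq> 0" "x \<in> trinomial l0 l1 l2"
  shows "one_ps_act v s x \<in> trinomial l0 l1 l2"
proof -
  have pw: "(\<Prod>j\<in>UNIV. ((s powi w j) * y j) ^ l j)
      = (s powi (\<Sum>j\<in>UNIV. int (l j) * w j)) * (\<Prod>j\<in>UNIV. y j ^ l j)"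
    for w :: "'i::finite \<Rightarrow> int" and y :: "'i \<Rightarrow> 'k" and l :: "'i \<Rightarrow> nat"
  proof -
    have "(\<Prod>j\<in>A. (s powi w j) ^ l j) = s powi (\<Sum>j\<in>A. int (l j) * w j)" if "finite A" for A
      using that
    proof (induction A rule: finite_induct)
      case (insert a A)
      then show ?case
        using \<open>s \<noteq> 0\<close> by (simp add: power_int_add power_int_mult mult.commute[of "int (l a)"])
    qed simp
    then show ?thesis by (simp add: power_mult_distrib prod.distrib)
  qed
  show ?thesis
    using assms(1,3)
    by (auto simp: trinomial_lattice_iff trinomial_def one_ps_act_def pw distrib_left[symmetric])
qed

lemma coordinate_weight:
  fixes l0 :: "'a::finite \<Rightarrow> nat" and l1 :: "'b::finite \<Rightarrow> nat" and l2 :: "'c::finite \<Rightarrow> nat"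
    and k :: "'a + 'b + 'c"
  defines "X \<equiv> (trinomial l0 l1 l2 :: ('k::field^('a + 'b + 'c)) set)"
    and "N \<equiv> trinomial_lattice l0 l1 l2"
  shows "(\<lambda>x. if x \<in> X then x $ k else 0)
           \<in> weight_space N X (\<lambda>v. if v \<in> lattice_Q N then v $ k else 0)"
proof -
  have "(\<lambda>x. if x \<in> X then x $ k else 0) \<in> coordinate_ring X"
    unfolding coordinate_ring_def by (auto intro!: generated_algebra.gen)
  moreover have "rat_vec v \<in> lattice_Q N" if "v \<in> N" for v
    using that by (auto simp: lattice_Q_def intro!: vec.span_base)
  moreover have "one_ps_act v s x \<in> X" if "v \<in> N" "s \<noteq> 0" "x \<in> X" for v s x
    using that one_ps_act_trinomial unfolding X_def N_def by blast
  ultimately show ?thesis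
    by (auto simp: weight_space_def rat_vec_def) (auto simp: one_ps_act_def)
qed

end

theory Submission
  imports Defs
begin

text \<open>
  All exponents are even. Let \<open>A\<^sub>i\<close> be the monomial in the \<open>i\<close>-th block of variables with exponents
  \<open>l\<^sub>i / 2\<close>. The hypersurface becomes \<open>A\<^sub>0\<^sup>2 + A\<^sub>1\<^sup>2 + A\<^sub>2\<^sup>2 = 0\<close>, and \<open>(A\<^sub>0, A\<^sub>1, A\<^sub>2)\<close> maps it to a
  conic, parametrised by \<open>a\<^sub>0 = z\<^sup>2 - 1\<close>, \<open>a\<^sub>1 = \<iota> (z\<^sup>2 + 1)\<close>, \<open>a\<^sub>2 = 2 z\<close>. The zeros of these three
  quadratic forms on the projective line are the points at which the polyhedral divisor is supported.

  For \<open>u\<close> in the dual lattice let \<open>w\<^sub>k = u (S e\<^sub>k)\<close> and let \<open>\<alpha>\<^sub>i\<close> be the integral part of the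
  minimum of \<open>2 w\<^sub>k / l\<^sub>k\<close> over the \<open>i\<close>-th block. The sections of degree \<open>u\<close> are the functions
  \<open>g a\<^sub>0\<^bsup>-\<alpha>\<^sub>0\<^esup> a\<^sub>1\<^bsup>-\<alpha>\<^sub>1\<^esup> a\<^sub>2\<^bsup>-\<alpha>\<^sub>2\<^esup>\<close> with a polynomial \<open>g\<close> of degree at most \<open>2 (\<alpha>\<^sub>0 + \<alpha>\<^sub>1 + \<alpha>\<^sub>2)\<close>.
  Homogenising \<open>g\<close> gives a form of degree \<open>\<alpha>\<^sub>0 + \<alpha>\<^sub>1 + \<alpha>\<^sub>2\<close> in the \<open>A\<^sub>i\<close>; its product with the monomial
  with exponents \<open>w\<^sub>k - \<alpha>\<^sub>i l\<^sub>k / 2\<close> is the corresponding polynomial function of weight \<open>u\<close>. This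
  defines a ring homomorphism. It is injective because weights are separated by one-parameter
  subgroups and \<open>X\<close> has points with nonzero coordinates over almost every \<open>z\<close>. It is surjective
  because every coordinate function lies in its image: by the coprimality assumptions, the monomials
  that are invariant under the torus are products of powers of the quotients \<open>A\<^sub>i / A\<^sub>j\<close>.

  The degree of the divisor \<open>\<DD>(u)\<close> is twice the value of \<open>u\<close> at a nonzero vector of \<open>\<sigma>\<close>, hence
  nonnegative on the dual cone and positive on its relative interior.
\<close>


section \<open>Divisors on the projective line\<close>

lemma ord_at_mult:
  fixes f g :: "'k::field ratfun"
  assumes "f \<noteq> 0" "g \<noteq> 0"
  shows "ord_at z (f * g) = ord_at z f + ord_at z g"
proof -
  obtain a b where f: "f = Fract a b" "b \<noteq> 0" "a \<noteq> 0"
    using assms(1) by (cases f rule: Fract_cases_nonzero) auto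
  obtain c d where g: "g = Fract c d" "d \<noteq> 0" "c \<noteq> 0"
    using assms(2) by (cases g rule: Fract_cases_nonzero) auto
  show ?thesis using f g by (simp add: ord_at_Fract poly_ord_mult)
qed

lemma ord_at_1 [simp]: "ord_at z (1 :: 'k::field ratfun) = 0"
  by (simp add: One_fract_def ord_at_Fract)

lemma ord_at_inverse:
  fixes f :: "'k::field ratfun"
  assumes "f \<noteq> 0"
  shows "ord_at z (inverse f) = - ord_at z f"
proof -
  have "ord_at z (f * inverse f) = ord_at z f + ord_at z (inverse f)"
    using assms by (intro ord_at_mult) auto
  with assms show ?thesis by simp
qed

lemma ord_at_power:
  fixes f :: "'k::field ratfun"
  assumes "f \<noteq> 0"
  shows "ord_at z (f ^ n) = int n * ord_at z f"
  by (induction n) (use assms in \<open>auto simp: ord_at_mult algebra_simps\<close>)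

lemma ord_at_powi:
  fixes f :: "'k::field ratfun"
  assumes "f \<noteq> 0"
  shows "ord_at z (f powi n) = n * ord_at z f"
  using assms by (auto simp: power_int_def ord_at_power ord_at_inverse power_inverse)

lemma ord_at_prod:
  fixes f :: "'i \<Rightarrow> 'k::field ratfun"
  assumes "finite A" "\<And>i. i \<in> A \<Longrightarrow> f i \<noteq> 0"
  shows "ord_at z (\<Prod>i\<in>A. f i) = (\<Sum>i\<in>A. ord_at z (f i))"
  using assms by (induction A rule: finite_induct) (auto simp: ord_at_mult)

lemma order_linear: "order b [:-a, 1:] = (if b = a then 1 else 0)" for a :: "'k::field"
  using order_power_n_n[of a 1] by (auto intro!: order_0I)

lemma Fract_1_eq_0_iff [simp]: "Fract p 1 = 0 \<longleftrightarrow> p = 0" for p :: "'k::field poly"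
  by (simp add: Zero_fract_def eq_fract)

lemma ord_at_linear:
  "ord_at z (Fract [:-a, 1:] 1) = (if z = Pt a then 1 else if z = Infty then -1 else 0)"
  by (cases z) (simp_all add: ord_at_Fract order_linear)

text \<open>Integral powers of linear factors realise any prescribed orders at the finite points.
  Each factor \<open>z - a\<close> has a simple pole at \<open>Infty\<close>, which fixes the order
  there.\<close>

lemma exists_principal:
  fixes D :: "'k::field \<Rightarrow> int"
  assumes "finite A" "\<And>a. a \<notin> A \<Longrightarrow> D a = 0"
  shows "\<exists>f. f \<noteq> 0 \<and> (\<forall>a. ord_at (Pt a) f = D a) \<and> ord_at Infty f = - (\<Sum>a\<in>A. D a)"
proof -
  define f where "f = (\<Prod>a\<in>A. Fract [:-a, 1:] 1 powi D a)"
  have "f \<noteq> 0" unfolding f_def using assms(1) by simp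
  have o: "ord_at z f = (\<Sum>a\<in>A. D a * ord_at z (Fract [:-a, 1:] 1))" for z
    unfolding f_def using assms(1) by (subst ord_at_prod) (auto simp: ord_at_powi)
  have "ord_at (Pt b) f = D b" for b
  proof -
    have "ord_at (Pt b) f = (\<Sum>a\<in>A. if a = b then D a else 0)"
      unfolding o by (intro sum.cong) (auto simp: ord_at_linear)
    then show ?thesis using assms by simp
  qed
  moreover have "ord_at Infty f = - (\<Sum>a\<in>A. D a)"
    unfolding o by (simp add: ord_at_linear sum_negf)
  ultimately show ?thesis using \<open>f \<noteq> 0\<close> by blast
qed

section \<open>Degrees of rational divisors, semiampleness and bigness\<close>

definition qdiv_degree :: "'k qdiv \<Rightarrow> rat" where
  "qdiv_degree D = (\<Sum>z\<in>Poly_Mapping.keys D. Poly_Mapping.lookup D z)"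

lemma lookup_nat_times_qdiv [simp]:
  "Poly_Mapping.lookup (nat_times_qdiv m D) z = of_nat m * Poly_Mapping.lookup D z"
  by (simp add: nat_times_qdiv_def map.rep_eq when_def)

lemma lookup_rat_times_wdiv [simp]:
  "Poly_Mapping.lookup (rat_times_wdiv c D) z = c * of_int (Poly_Mapping.lookup D z)"
  by (simp add: rat_times_wdiv_def map.rep_eq when_def)

lemma qdiv_degree_superset:
  assumes "finite A" "Poly_Mapping.keys D \<subseteq> A"
  shows "qdiv_degree D = (\<Sum>z\<in>A. Poly_Mapping.lookup D z)"
  unfolding qdiv_degree_def using assms
  by (intro sum.mono_neutral_left) (auto simp: in_keys_iff)

lemma qdiv_degree_nat_times: "qdiv_degree (nat_times_qdiv m D) = of_nat m * qdiv_degree D"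
proof -
  have "qdiv_degree (nat_times_qdiv m D)
      = (\<Sum>z\<in>Poly_Mapping.keys D. Poly_Mapping.lookup (nat_times_qdiv m D) z)"
    by (intro qdiv_degree_superset) (auto simp: in_keys_iff)
  then show ?thesis by (simp add: qdiv_degree_def sum_distrib_left)
qed

lemma common_denominator:
  fixes f :: "'i \<Rightarrow> rat"
  assumes "finite A"
  shows "\<exists>m>0. \<forall>k\<in>A. of_nat m * f k \<in> \<int>"
  using assms
proof (induction A rule: finite_induct)
  case (insert a A)
  then obtain m where m: "m > 0" "\<forall>k\<in>A. of_nat m * f k \<in> \<int>" by blast
  obtain p q where pq: "quotient_of (f a) = (p, q)" by fastforce
  have q: "q > 0" "f a = of_int p / of_int q"
    using pq quotient_of_denom_pos quotient_of_div by blast+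
  have "of_nat (nat q * m) * f k \<in> \<int>" if "k \<in> insert a A" for k
  proof (cases "k = a")
    case True
    have "of_nat (nat q * m) * f k = of_int (int m * p)" using q True by simp
    then show ?thesis using Ints_of_int by metis
  next
    case False
    then have "of_nat m * f k \<in> \<int>" using that m by blast
    then have "of_nat (nat q) * (of_nat m * f k) \<in> \<int>" by (rule Ints_mult[OF Ints_of_nat])
    then show ?thesis by (simp only: of_nat_mult mult.assoc)
  qed
  then show ?case using q(1) m(1) by (intro exI[of _ "nat q * m"]) simp
qed auto

lemma exists_integral_multiple:
  "\<exists>m>0. \<forall>z. Poly_Mapping.lookup (nat_times_qdiv m D) z \<in> \<int>"
proof -
  obtain m where m: "m > 0" "\<forall>z\<in>Poly_Mapping.keys D. of_nat m * Poly_Mapping.lookup D z \<in> \<int>"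
    using common_denominator[of "Poly_Mapping.keys D" "Poly_Mapping.lookup D"] by auto
  have "Poly_Mapping.lookup (nat_times_qdiv m D) z \<in> \<int>" for z
    using m(2) by (cases "z \<in> Poly_Mapping.keys D") (auto simp: in_keys_iff)
  then show ?thesis using m(1) by blast
qed

text \<open>The degree classifies divisors on the projective line up to linear equivalence:
  \<open>D\<close> is equivalent to its degree times any chosen point \<open>y\<close>. Suitable
  choices of \<open>y\<close> yield the Cartier property, semiampleness and bigness.\<close>

lemma exists_section_supported_at:
  fixes D :: "'k::field qdiv"
  assumes int: "\<And>z. Poly_Mapping.lookup D z \<in> \<int>"
  shows "\<exists>f. f \<noteq> 0 \<and> (\<forall>z. Poly_Mapping.lookup D z + of_int (ord_at z f)
      = (if z = y then qdiv_degree D else 0))"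
proof -
  define E where "E z = \<lfloor>Poly_Mapping.lookup D z\<rfloor>" for z
  have E: "Poly_Mapping.lookup D z = of_int (E z)" for z
    using int[of z] by (auto simp: E_def elim: Ints_cases)
  \<comment> \<open>A finite point \<open>y\<close> is put into \<open>A\<close> even if
    \<open>D\<close> vanishes there, because \<open>g\<close> below places the extra order
    \<open>e\<close> at \<open>y\<close>, and this has to enter the sum that determines the order at
    \<open>Infty\<close>.\<close>
  define A where "A = {a. Pt a \<in> Poly_Mapping.keys D \<or> Pt a = y}"
  have "finite (Pt -` (Poly_Mapping.keys D \<union> {y}))"
    by (intro finite_vimageI injI) auto
  then have finA: "finite A" by (rule rev_finite_subset) (auto simp: A_def)
  define e where "e = E Infty + (\<Sum>a\<in>A. E (Pt a))"
  have "qdiv_degree D = (\<Sum>z\<in>insert Infty (Pt ` A). Poly_Mapping.lookup D z)"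
  proof (intro qdiv_degree_superset subsetI)
    fix z assume "z \<in> Poly_Mapping.keys D"
    then show "z \<in> insert Infty (Pt ` A)" by (cases z) (auto simp: A_def)
  qed (simp add: finA)
  also have "\<dots> = (\<Sum>z\<in>insert Infty (Pt ` A). of_int (E z))" by (simp only: E)
  also have "\<dots> = of_int (E Infty) + (\<Sum>a\<in>A. of_int (E (Pt a)))"
    using finA by (subst sum.insert) (auto simp: sum.reindex inj_on_def)
  finally have deg: "qdiv_degree D = of_int e" by (simp add: e_def)
  define g where "g a = - E (Pt a) + (if Pt a = y then e else 0)" for a
  have g0: "g a = 0" if "a \<notin> A" for a
    using that E[of "Pt a"] by (auto simp: g_def A_def in_keys_iff)
  obtain f where f: "f \<noteq> 0" "\<And>a. ord_at (Pt a) f = g a"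
    "ord_at Infty f = - (\<Sum>a\<in>A. g a)"
    using exists_principal[of A g, OF finA g0] by auto
  have sg: "(\<Sum>a\<in>A. g a) = - (\<Sum>a\<in>A. E (Pt a)) + (if y = Infty then 0 else e)"
  proof (cases y)
    case (Pt b)
    have "(\<Sum>a\<in>A. if Pt a = y then e else 0) = (\<Sum>a\<in>A. if a = b then e else 0)"
      using Pt by simp
    moreover have "b \<in> A" using Pt by (simp add: A_def)
    moreover have "(\<Sum>a\<in>A. g a) = - (\<Sum>a\<in>A. E (Pt a)) + (\<Sum>a\<in>A. if Pt a = y then e else 0)"
      by (simp only: g_def sum.distrib sum_negf)
    ultimately show ?thesis using finA Pt by simp
  qed (simp add: g_def sum_negf)
  have "Poly_Mapping.lookup D z + of_int (ord_at z f) = (if z = y then qdiv_degree D else 0)" for z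
  proof (cases z)
    case (Pt a)
    then show ?thesis by (simp add: f E deg g_def)
  next
    case Infty
    then show ?thesis by (auto simp: f E deg sg e_def)
  qed
  with f(1) show ?thesis by blast
qed

lemma cartier_if_integral:
  fixes D :: "'k::field qdiv"
  assumes int: "\<And>z. Poly_Mapping.lookup D z \<in> \<int>"
  shows "cartier D"
  unfolding cartier_def
proof
  fix z :: "'k proj_line"
  \<comment> \<open>Off \<open>y\<close> the divisor has the equation \<open>inverse f\<close>, so
    any \<open>y\<close> different from \<open>z\<close> gives a local equation near
    \<open>z\<close>.\<close>
  define y :: "'k proj_line" where "y = (if z = Infty then Pt 0 else Infty)"
  obtain f where f: "f \<noteq> 0" "\<And>z. Poly_Mapping.lookup D z + of_int (ord_at z f)
      = (if z = y then qdiv_degree D else 0)"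
    using exists_section_supported_at[OF int, of y] by auto
  have "Poly_Mapping.lookup D x = of_int (ord_at x (inverse f))" if "x \<noteq> y" for x
    using f(2)[of x] that f(1) by (simp add: ord_at_inverse)
  then show "\<exists>V f. open_P1 V \<and> z \<in> V \<and> f \<noteq> 0 \<and>
     (\<forall>y\<in>V. Poly_Mapping.lookup D y = of_int (ord_at y f))"
    using f(1) by (intro exI[of _ "- {y}"] exI[of _ "inverse f"]) (auto simp: open_P1_def y_def)
qed

lemma q_cartier_P1: "q_cartier D"
  unfolding q_cartier_def using exists_integral_multiple[of D] cartier_if_integral by blast

text \<open>After denominators are cleared, the divisor is equivalent to a nonnegative multiple of a
  point \<open>y\<close>. Choosing \<open>y\<close> different from \<open>z\<close> gives a section
  that does not vanish at \<open>z\<close>.\<close>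

lemma semiample_if_degree_nonneg:
  fixes D :: "'k::field qdiv"
  assumes "qdiv_degree D \<ge> 0"
  shows "semiample D"
proof -
  obtain m where m: "m > 0" "\<And>z. Poly_Mapping.lookup (nat_times_qdiv m D) z \<in> \<int>"
    using exists_integral_multiple by blast
  define D' where "D' = nat_times_qdiv m D"
  have deg: "qdiv_degree D' \<ge> 0" unfolding D'_def qdiv_degree_nat_times using assms by simp
  have "z \<in> (\<Union>f \<in> div_sections D' - {0}. nonvanishing D' f)" for z :: "'k proj_line"
  proof -
    define y :: "'k proj_line" where "y = (if z = Infty then Pt 0 else Infty)"
    obtain f where f: "f \<noteq> 0" "\<And>z. Poly_Mapping.lookup D' z + of_int (ord_at z f)
        = (if z = y then qdiv_degree D' else 0)"
      using exists_section_supported_at[of D' y] m(2) unfolding D'_def by auto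
    have "of_int (ord_at x f) + Poly_Mapping.lookup D' x \<ge> 0" for x
      using f(2)[of x] deg by (simp add: add.commute split: if_splits)
    then have "f \<in> div_sections D' - {0}" using f(1) by (simp add: div_sections_def)
    moreover have "z \<in> nonvanishing D' f"
      using f(2)[of z] by (auto simp: nonvanishing_def y_def)
    ultimately show ?thesis by blast
  qed
  then show ?thesis unfolding semiample_def Let_def D'_def[symmetric]
    using m(1) D'_def by blast
qed

text \<open>All zeros of a section can be moved to \<open>Infty\<close>. Strict positivity of the
  degree makes \<open>Infty\<close> a genuine zero, so the nonvanishing locus is the affine line and
  not the whole projective line.\<close>

lemma big_if_degree_pos:
  fixes D :: "'k::field qdiv"
  assumes "qdiv_degree D > 0" "affine_open_P1 (- {Infty} :: 'k proj_line set)"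
  shows "big D"
proof -
  obtain m where m: "m > 0" "\<And>z. Poly_Mapping.lookup (nat_times_qdiv m D) z \<in> \<int>"
    using exists_integral_multiple by blast
  define D' where "D' = nat_times_qdiv m D"
  have deg: "qdiv_degree D' > 0" unfolding D'_def qdiv_degree_nat_times using assms m by simp
  obtain f where f: "f \<noteq> 0" "\<And>z. Poly_Mapping.lookup D' z + of_int (ord_at z f)
      = (if z = Infty then qdiv_degree D' else 0)"
    using exists_section_supported_at[of D' Infty] m(2) unfolding D'_def by auto
  have "of_int (ord_at x f) + Poly_Mapping.lookup D' x \<ge> 0" for x
    using f(2)[of x] deg by (simp add: add.commute split: if_splits)
  then have "f \<in> div_sections D' - {0}" using f(1) by (simp add: div_sections_def)
  moreover have "nonvanishing D' f = - {Infty}"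
    using f(2) deg by (auto simp: nonvanishing_def)
  ultimately show ?thesis unfolding big_def Let_def D'_def[symmetric]
    using m(1) D'_def assms(2) by metis
qed

lemma qdiv_degree_add: "qdiv_degree (D + E) = qdiv_degree D + qdiv_degree E"
proof -
  let ?A = "Poly_Mapping.keys D \<union> Poly_Mapping.keys E"
  have "qdiv_degree (D + E) = (\<Sum>z\<in>?A. Poly_Mapping.lookup (D + E) z)"
    by (intro qdiv_degree_superset keys_add) simp
  also have "\<dots> = (\<Sum>z\<in>?A. Poly_Mapping.lookup D z) + (\<Sum>z\<in>?A. Poly_Mapping.lookup E z)"
    by (simp add: lookup_add sum.distrib)
  also have "\<dots> = qdiv_degree D + qdiv_degree E"
    by (simp add: qdiv_degree_superset[of ?A])
  finally show ?thesis .
qed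

lemma qdiv_degree_prime_divs: "qdiv_degree (rat_times_wdiv c (prime_div y + prime_div z)) = 2 * c"
proof -
  have "rat_times_wdiv c (prime_div y + prime_div z) = Poly_Mapping.single y c + Poly_Mapping.single z c"
    by (rule poly_mapping_eqI) (simp add: lookup_add prime_div_def lookup_single when_def)
  moreover have "qdiv_degree (Poly_Mapping.single x c) = c" for x :: "'a proj_line"
    using qdiv_degree_superset[of "{x}" "Poly_Mapping.single x c"] by simp
  ultimately show ?thesis by (simp add: qdiv_degree_add)
qed


section \<open>The affine line\<close>

lemma has_value_Pt_unique:
  fixes f :: "'k::field ratfun"
  assumes "has_value f (Pt a) c" "has_value f (Pt a) d"
  shows "c = d"
proof -
  obtain p q where p: "f = Fract p q" "poly q a \<noteq> 0" "c = poly p a / poly q a" using assms by auto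
  obtain p' q' where p': "f = Fract p' q'" "poly q' a \<noteq> 0" "d = poly p' a / poly q' a"
    using assms by auto
  have "q \<noteq> 0" "q' \<noteq> 0" using p p' by auto
  then have "p * q' = p' * q" using p(1) p'(1) by (simp add: eq_fract)
  then have "poly p a * poly q' a = poly p' a * poly q a" by (metis poly_mult)
  then have "poly p a / poly q a = poly p' a / poly q' a" using p(2) p'(2) by (simp add: frac_eq_eq)
  then show ?thesis using p(3) p'(3) by simp
qed

lemma affine_polys_1: "affine_polys (Suc 0) = {\<lambda>x. poly p (x 0) |p. True}"
proof (intro set_eqI iffI)
  fix f :: "(nat \<Rightarrow> 'a) \<Rightarrow> 'a"
  assume "f \<in> affine_polys (Suc 0)"
  then show "f \<in> {\<lambda>x. poly p (x 0) |p. True}"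
    unfolding affine_polys_def
  proof (induction rule: generated_algebra.induct)
    case (const c)
    show ?case by (auto intro!: exI[of _ "[:c:]"])
  next
    case (gen g)
    then have "g = (\<lambda>x. x 0)" by auto
    then show ?case by (auto intro!: exI[of _ "[:0, 1:]"])
  next
    case (add f g)
    then obtain p q where "f = (\<lambda>x. poly p (x 0))" "g = (\<lambda>x. poly q (x 0))" by auto
    then show ?case by (auto intro!: exI[of _ "p + q"])
  next
    case (mult f g)
    then obtain p q where "f = (\<lambda>x. poly p (x 0))" "g = (\<lambda>x. poly q (x 0))" by auto
    then show ?case by (auto intro!: exI[of _ "p * q"])
  qed
next
  fix f :: "(nat \<Rightarrow> 'a) \<Rightarrow> 'a"
  assume "f \<in> {\<lambda>x. poly p (x 0) |p. True}"
  then obtain p where f: "f = (\<lambda>x. poly p (x 0))" by auto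
  have "(\<lambda>x. poly p (x 0)) \<in> affine_polys (Suc 0)"
  proof (induction p)
    case 0
    then show ?case unfolding affine_polys_def using generated_algebra.const[of 0] by simp
  next
    case (pCons a p)
    have "(\<lambda>x. x 0) \<in> generated_algebra {\<lambda>x::nat \<Rightarrow> 'a. x j |j. j < Suc 0}"
      by (rule generated_algebra.gen) auto
    then have "(\<lambda>x. a + x 0 * poly p (x 0)) \<in> affine_polys (Suc 0)"
      using pCons.IH generated_algebra.const unfolding affine_polys_def
      by (intro generated_algebra.add generated_algebra.mult)
    then show ?case by simp
  qed
  then show "f \<in> affine_polys (Suc 0)" by (simp add: f)
qed

text \<open>Points of an affine space are extensional functions on the index set. The value at
  \<open>Infty\<close> is arbitrary, as the map serves only on the complement of that point.\<close>

definition line_pt :: "'k proj_line \<Rightarrow> nat \<Rightarrow> 'k" where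
  "line_pt z = (\<lambda>j\<in>{..<Suc 0}. case z of Pt a \<Rightarrow> a | Infty \<Rightarrow> undefined)"

lemma line_pt_Pt_0 [simp]: "line_pt (Pt a) 0 = a"
  by (simp add: line_pt_def)

lemma affine_space_1: "affine_space (Suc 0) = range (\<lambda>a. line_pt (Pt a))"
proof (intro set_eqI iffI)
  fix x :: "nat \<Rightarrow> 'a"
  assume "x \<in> affine_space (Suc 0)"
  then have "x = line_pt (Pt (x 0))"
    by (auto simp: affine_space_def line_pt_def PiE_def extensional_def fun_eq_iff)
  then show "x \<in> range (\<lambda>a. line_pt (Pt a))" by blast
qed (auto simp: affine_space_def line_pt_def PiE_def extensional_def)

lemma affine_space_1_cases:
  assumes "x \<in> affine_space (Suc 0)"
  obtains a where "x = line_pt (Pt a)"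
  using assms unfolding affine_space_1 by blast

text \<open>A nonzero polynomial in one variable has finitely many zeros, and a finite set is the
  zero set of a product of linear factors.\<close>

lemma closed_affine_1_iff:
  fixes C :: "(nat \<Rightarrow> 'k::field) set"
  shows "closed_affine (Suc 0) C \<longleftrightarrow> C = affine_space (Suc 0) \<or> (C \<subseteq> affine_space (Suc 0) \<and> finite C)"
proof
  assume "closed_affine (Suc 0) C"
  then obtain P where P: "P \<subseteq> affine_polys (Suc 0)" "C = {x \<in> affine_space (Suc 0). \<forall>p\<in>P. p x = 0}"
    unfolding closed_affine_def by blast
  show "C = affine_space (Suc 0) \<or> (C \<subseteq> affine_space (Suc 0) \<and> finite C)"
  proof (cases "\<exists>q. q \<noteq> 0 \<and> (\<lambda>x. poly q (x 0)) \<in> P")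
    case True
    then obtain q where q: "q \<noteq> 0" "(\<lambda>x. poly q (x 0)) \<in> P" by blast
    have "C \<subseteq> (\<lambda>a. line_pt (Pt a)) ` {a. poly q a = 0}"
    proof
      fix x assume "x \<in> C"
      then have x: "x \<in> affine_space (Suc 0)" and "\<forall>p\<in>P. p x = 0" using P(2) by auto
      from this(2) q(2) have x0: "poly q (x 0) = 0" by (rule bspec)
      obtain a where "x = line_pt (Pt a)" using x by (rule affine_space_1_cases)
      with x0 show "x \<in> (\<lambda>a. line_pt (Pt a)) ` {a. poly q a = 0}" by simp
    qed
    then have "finite C" using poly_roots_finite[OF q(1)] by (meson finite_surj)
    then show ?thesis using P by blast
  next
    case False
    have "p x = 0" if p: "p \<in> P" for p x
    proof -
      obtain q where "p = (\<lambda>x. poly q (x 0))" using P(1) p unfolding affine_polys_1 by auto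
      moreover have "\<not> (q \<noteq> 0 \<and> (\<lambda>x. poly q (x 0)) \<in> P)"
        using False by (rule contrapos_nn) (rule exI)
      ultimately show ?thesis using p by auto
    qed
    then show ?thesis using P by blast
  qed
next
  assume "C = affine_space (Suc 0) \<or> (C \<subseteq> affine_space (Suc 0) \<and> finite C)"
  then show "closed_affine (Suc 0) C"
  proof
    assume "C = affine_space (Suc 0)"
    then show ?thesis unfolding closed_affine_def by (intro exI[of _ "{}"]) simp
  next
    assume C: "C \<subseteq> affine_space (Suc 0) \<and> finite C"
    define q where "q = (\<Prod>y\<in>C. [:- y 0, 1:])"
    have "poly q (x 0) = 0 \<longleftrightarrow> x \<in> C" if x: "x \<in> affine_space (Suc 0)" for x
    proof -
      have "poly q (x 0) = 0 \<longleftrightarrow> (\<exists>y\<in>C. x 0 = y 0)"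
        using C by (auto simp: q_def poly_prod)
      also have "\<dots> \<longleftrightarrow> x \<in> C"
        using C x by (metis affine_space_1_cases line_pt_Pt_0 subsetD)
      finally show ?thesis .
    qed
    then have "C = {x \<in> affine_space (Suc 0). \<forall>p\<in>{\<lambda>x. poly q (x 0)}. p x = 0}" using C by auto
    moreover have "{\<lambda>x. poly q (x 0)} \<subseteq> affine_polys (Suc 0)" unfolding affine_polys_1 by auto
    ultimately show ?thesis unfolding closed_affine_def by blast
  qed
qed

text \<open>Both sides carry the cofinite topology. A regular function on the affine side is locally
  a quotient of polynomials, and since the field is infinite the local quotients are one and the
  same rational function.\<close>

lemma affine_open_P1_minus_Infty:
  "affine_open_P1 (- {Infty} :: 'k::field_char_0 proj_line set)"
proof -
  define U :: "'k proj_line set" where "U = - {Infty}"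
  define Z :: "(nat \<Rightarrow> 'k) set" where "Z = affine_space (Suc 0)"
  have inj: "inj_on line_pt U"
  proof (rule inj_onI)
    fix y z :: "'k proj_line" assume "y \<in> U" "z \<in> U" "line_pt y = line_pt z"
    then show "y = z" by (cases y; cases z) (auto simp: U_def dest: fun_cong[of _ _ 0])
  qed
  have U: "U = range Pt"
  proof (intro set_eqI iffI)
    fix z assume "z \<in> U" then show "z \<in> range Pt" by (cases z) (auto simp: U_def)
  qed (auto simp: U_def)
  have img: "line_pt ` U = Z" by (simp only: U Z_def affine_space_1 image_image)
  then have bij: "bij_betw line_pt U Z" using inj by (simp add: bij_betw_def)
  have closed_Z: "closed_affine (Suc 0) Z" by (simp add: Z_def closed_affine_1_iff)
  have open_iff: "open_P1 V \<longleftrightarrow> open_in_affine (Suc 0) Z (line_pt ` V)" if V: "V \<subseteq> U" for V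
  proof -
    have diff: "Z - line_pt ` V = line_pt ` (U - V)"
      using inj_on_image_set_diff[OF inj Diff_subset V] img by simp
    have "- V = insert Infty (U - V)" using V by (auto simp: U_def)
    then have "open_P1 V \<longleftrightarrow> V = {} \<or> finite (U - V)" by (simp add: open_P1_def)
    also have "\<dots> \<longleftrightarrow> line_pt ` V = {} \<or> finite (Z - line_pt ` V)"
      unfolding diff using inj by (simp add: finite_image_iff inj_on_diff)
    also have "\<dots> \<longleftrightarrow> open_in_affine (Suc 0) Z (line_pt ` V)"
    proof
      assume "line_pt ` V = {} \<or> finite (Z - line_pt ` V)"
      then have "closed_affine (Suc 0) (Z - line_pt ` V)"
        unfolding closed_affine_1_iff using Z_def by auto
      moreover have "line_pt ` V = Z - (Z - line_pt ` V)" using V img by blast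
      ultimately show "open_in_affine (Suc 0) Z (line_pt ` V)" unfolding open_in_affine_def by blast
    next
      assume "open_in_affine (Suc 0) Z (line_pt ` V)"
      then obtain C where C: "closed_affine (Suc 0) C" "line_pt ` V = Z - C"
        unfolding open_in_affine_def by blast
      then show "line_pt ` V = {} \<or> finite (Z - line_pt ` V)"
        unfolding closed_affine_1_iff Z_def by (metis Diff_cancel double_diff order_refl)
    qed
    finally show ?thesis .
  qed
  have reg_iff: "regular_P1 V (\<lambda>z. h (line_pt z)) \<longleftrightarrow> regular_affine (Suc 0) Z (line_pt ` V) h"
    if V: "V \<subseteq> U" "open_P1 V" for V h
  proof
    assume "regular_P1 V (\<lambda>z. h (line_pt z))"
    then obtain f where f: "\<And>z. z \<in> V \<Longrightarrow> has_value f z (h (line_pt z))"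
      unfolding regular_P1_def by blast
    show "regular_affine (Suc 0) Z (line_pt ` V) h"
      unfolding regular_affine_def
    proof
      fix x assume "x \<in> line_pt ` V"
      then obtain a where a: "Pt a \<in> V" "x = line_pt (Pt a)" using V(1) U by auto
      obtain p q where pq: "f = Fract p q" "poly q a \<noteq> 0" using f[OF a(1)] by auto
      \<comment> \<open>The fraction that computes the value at \<open>a\<close> also computes the
        value at every point where its denominator does not vanish.\<close>
      define V' where "V' = V - Pt ` {b. poly q b = 0}"
      have "q \<noteq> 0" using pq by auto
      then have "finite (Pt ` {b. poly q b = 0})" using poly_roots_finite by blast
      moreover have "- V' = - V \<union> Pt ` {b. poly q b = 0}"
        using V by (auto simp: V'_def)
      moreover have "finite (- V)" using V(2) a(1) by (auto simp: open_P1_def)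
      ultimately have "open_P1 V'" by (simp add: open_P1_def)
      then have "open_in_affine (Suc 0) Z (line_pt ` V')" using open_iff[of V'] V(1) V'_def by blast
      moreover have "x \<in> line_pt ` V'" using a pq(2) by (auto simp: V'_def)
      moreover have "line_pt ` V' \<subseteq> line_pt ` V" by (auto simp: V'_def)
      moreover have "poly q (y 0) \<noteq> 0 \<and> h y = poly p (y 0) / poly q (y 0)"
        if "y \<in> line_pt ` V'" for y
      proof -
        obtain b where b: "Pt b \<in> V" "poly q b \<noteq> 0" "y = line_pt (Pt b)"
          using \<open>y \<in> line_pt ` V'\<close> V(1) U unfolding V'_def by blast
        have "has_value f (Pt b) (poly p b / poly q b)" using pq(1) b(2) by auto
        then show ?thesis using has_value_Pt_unique f[OF b(1)] b by fastforce
      qed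
      moreover have "(\<lambda>x. poly p (x 0)) \<in> affine_polys (Suc 0)" "(\<lambda>x. poly q (x 0)) \<in> affine_polys (Suc 0)"
        unfolding affine_polys_1 by auto
      ultimately show "\<exists>W'. x \<in> W' \<and> W' \<subseteq> line_pt ` V \<and> open_in_affine (Suc 0) Z W' \<and>
        (\<exists>p\<in>affine_polys (Suc 0). \<exists>q\<in>affine_polys (Suc 0). \<forall>y\<in>W'. q y \<noteq> 0 \<and> h y = p y / q y)"
        by (intro exI[of _ "line_pt ` V'"] conjI bexI[of _ "\<lambda>x. poly p (x 0)"]
            bexI[of _ "\<lambda>x. poly q (x 0)"] ballI) simp_all
    qed
  next
    assume reg: "regular_affine (Suc 0) Z (line_pt ` V) h"
    \<comment> \<open>These are the finite points at which \<open>p / q\<close> does not represent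
      \<open>h\<close>. For a local representation they avoid a nonempty open set, hence are finite
      in number.\<close>
    define bad where
      "bad p q = {b. poly q b = 0 \<or> h (line_pt (Pt b)) \<noteq> poly p b / poly q b}" for p q
    have loc: "\<exists>p q. poly q a \<noteq> 0 \<and> finite (bad p q) \<and> h (line_pt (Pt a)) = poly p a / poly q a"
      if "Pt a \<in> V" for a
    proof -
      have "line_pt (Pt a) \<in> line_pt ` V" using that by simp
      from reg[unfolded regular_affine_def, rule_format, OF this]
      obtain W' p' q' where W': "line_pt (Pt a) \<in> W'" "open_in_affine (Suc 0) Z W'" and
        p': "p' \<in> affine_polys (Suc 0)" and q': "q' \<in> affine_polys (Suc 0)" and
        h: "\<And>y. y \<in> W' \<Longrightarrow> q' y \<noteq> 0 \<and> h y = p' y / q' y"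
        by (elim exE conjE bexE) simp
      obtain p where p: "p' = (\<lambda>x. poly p (x 0))" using p' unfolding affine_polys_1 by auto
      obtain q where q: "q' = (\<lambda>x. poly q (x 0))" using q' unfolding affine_polys_1 by auto
      note pq = p q
      obtain C where C: "closed_affine (Suc 0) C" "W' = Z - C" using W'(2) unfolding open_in_affine_def by blast
      have "finite C" using C W'(1) unfolding closed_affine_1_iff Z_def by auto
      have "b \<in> (\<lambda>x. x 0) ` C"
        if "b \<in> bad p q" for b
      proof -
        have "line_pt (Pt b) \<in> C" using h[of "line_pt (Pt b)"] that pq C(2) img U by (auto simp: bad_def)
        then show ?thesis by (metis imageI line_pt_Pt_0)
      qed
      then have "bad p q \<subseteq> (\<lambda>x. x 0) ` C" by blast
      then have "finite (bad p q)" using \<open>finite C\<close> finite_surj by blast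
      moreover have "poly q a \<noteq> 0" "h (line_pt (Pt a)) = poly p a / poly q a"
        using h[OF W'(1)] pq by simp_all
      ultimately show ?thesis by blast
    qed
    show "regular_P1 V (\<lambda>z. h (line_pt z))"
    proof (cases "V = {}")
      case False
      then obtain a0 where "Pt a0 \<in> V" using V(1) U by blast
      from loc[OF this] obtain p0 q0 where pq0: "poly q0 a0 \<noteq> 0"
        "finite (bad p0 q0)" by blast
      have "has_value (Fract p0 q0) z (h (line_pt z))" if zV: "z \<in> V" for z
      proof -
        obtain a where a: "z = Pt a" using zV V(1) U by auto
        from loc[of a] zV a obtain p q where pq: "poly q a \<noteq> 0"
          "finite (bad p q)"
          "h (line_pt (Pt a)) = poly p a / poly q a" by blast
        \<comment> \<open>Off two finite exceptional sets both fractions equal \<open>h\<close>, so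
          otherwise a nonzero polynomial would vanish at almost all points of an infinite
          field.\<close>
        have "p0 * q = p * q0"
        proof (rule ccontr)
          assume "p0 * q \<noteq> p * q0"
          then have "finite {b. poly (p0 * q - p * q0) b = 0}" by (intro poly_roots_finite) simp
          moreover have "b \<in> bad p0 q0 \<union> bad p q" if "poly (p0 * q - p * q0) b \<noteq> 0" for b
            using that by (auto simp: bad_def frac_eq_eq)
          then have "UNIV = {b. poly (p0 * q - p * q0) b = 0} \<union> (bad p0 q0 \<union> bad p q)" by blast
          ultimately have "finite (UNIV :: 'k set)" using pq0(2) pq(2)
            by (metis (no_types, lifting) finite_Un)
          then show False using infinite_UNIV_char_0 by blast
        qed
        moreover have "q0 \<noteq> 0" "q \<noteq> 0" using pq0 pq by auto
        ultimately have "Fract p0 q0 = Fract p q" by (simp add: eq_fract)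
        then show ?thesis using pq a by auto
      qed
      then show ?thesis unfolding regular_P1_def by blast
    qed (simp add: regular_P1_def)
  qed
  have open_U: "open_P1 U" by (simp add: open_P1_def U_def)
  show ?thesis unfolding U_def[symmetric] affine_open_P1_def
  proof (intro conjI, rule open_U, rule exI[of _ "Suc 0"], rule exI[of _ Z], rule exI[of _ line_pt],
      intro conjI allI impI)
    show "closed_affine (Suc 0) Z" "bij_betw line_pt U Z" by fact+
  qed (rule open_iff reg_iff; assumption)+
qed


section \<open>The conic and its parametrisation\<close>

datatype block = Bl0 | Bl1 | Bl2

lemma UNIV_block: "UNIV = {Bl0, Bl1, Bl2}"
  using block.exhaust by auto

instance block :: finite
  by standard (simp add: UNIV_block)

lemma sum_block: "(\<Sum>i\<in>UNIV. f i) = f Bl0 + f Bl1 + f Bl2"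
  for f :: "block \<Rightarrow> 'z::comm_monoid_add"
  by (simp add: UNIV_block add.assoc)

lemma prod_block: "(\<Prod>i\<in>UNIV. f i) = f Bl0 * f Bl1 * f Bl2"
  for f :: "block \<Rightarrow> 'z::comm_monoid_mult"
  by (simp add: UNIV_block mult.assoc)

lemma all_block: "(\<forall>i. P i) \<longleftrightarrow> P Bl0 \<and> P Bl1 \<and> P Bl2"
  using block.exhaust by metis

fun branch_poly :: "'k::field \<Rightarrow> block \<Rightarrow> 'k poly" where
  "branch_poly \<iota> Bl0 = [:-1, 0, 1:]"
| "branch_poly \<iota> Bl1 = [:\<iota>, 0, \<iota>:]"
| "branch_poly \<iota> Bl2 = [:0, 2:]"

fun branch_form :: "'k::field \<Rightarrow> block \<Rightarrow> 'k \<Rightarrow> 'k \<Rightarrow> 'k" where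
  "branch_form \<iota> Bl0 s t = s\<^sup>2 - t\<^sup>2"
| "branch_form \<iota> Bl1 s t = \<iota> * (s\<^sup>2 + t\<^sup>2)"
| "branch_form \<iota> Bl2 s t = 2 * s * t"

text \<open>For \<iota> a square root of -1, these are the zeros of \<open>branch_form\<close> in
  the coordinate \<open>s / t\<close>. The zero \<open>Infty\<close> of the form
  \<open>2 s t\<close> shows in \<open>branch_poly\<close> only as a drop of the degree.\<close>

fun branch_points :: "'k::field \<Rightarrow> block \<Rightarrow> 'k proj_line set" where
  "branch_points \<iota> Bl0 = {Pt 1, Pt (-1)}"
| "branch_points \<iota> Bl1 = {Pt \<iota>, Pt (-\<iota>)}"
| "branch_points \<iota> Bl2 = {Pt 0, Infty}"

text \<open>With \<open>p = (a Bl0 - \<iota> * a Bl1) / 2\<close>,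
  \<open>q = (- a Bl0 - \<iota> * a Bl1) / 2\<close> and \<open>r = a Bl2 / 2\<close> the conic
  reads \<open>p q = r^2\<close>. Square roots \<open>s\<close>, \<open>t\<close> of
  \<open>p\<close>, \<open>q\<close> then satisfy \<open>r = s t\<close> up to a sign, which is
  absorbed into \<open>t\<close>.\<close>

lemma conic_parametrization:
  fixes a :: "block \<Rightarrow> 'k::{alg_closed_field,field_char_0}"
  assumes conic: "(\<Sum>i\<in>UNIV. (a i)\<^sup>2) = 0" and \<iota>: "\<iota>\<^sup>2 = -1"
  shows "\<exists>s t. \<forall>i. a i = branch_form \<iota> i s t"
proof -
  obtain s where s: "s\<^sup>2 = (a Bl0 - \<iota> * a Bl1) / 2" by (metis nth_root_exists zero_less_numeral)
  obtain t where t: "t\<^sup>2 = (- a Bl0 - \<iota> * a Bl1) / 2" by (metis nth_root_exists zero_less_numeral)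
  have c: "(a Bl2)\<^sup>2 = - (a Bl0)\<^sup>2 - (a Bl1)\<^sup>2"
    using conic by (simp add: sum_block algebra_simps eq_neg_iff_add_eq_0)
  have "(2 * s * t)\<^sup>2 = 4 * s\<^sup>2 * t\<^sup>2" by (simp add: power_mult_distrib)
  also have "\<dots> = (a Bl0 - \<iota> * a Bl1) * (- a Bl0 - \<iota> * a Bl1)" unfolding s t by simp
  also have "\<dots> = - (a Bl0)\<^sup>2 + \<iota>\<^sup>2 * (a Bl1)\<^sup>2" by (simp add: algebra_simps power2_eq_square)
  also have "\<dots> = (a Bl2)\<^sup>2" by (simp add: c \<iota>)
  finally have "a Bl2 = 2 * s * t \<or> a Bl2 = 2 * s * (- t)" using power2_eq_iff by fastforce
  then obtain t' where t': "a Bl2 = 2 * s * t'" "t'\<^sup>2 = t\<^sup>2" by fastforce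
  have "a Bl0 = s\<^sup>2 - t'\<^sup>2" by (simp add: t' s t field_simps)
  moreover have "s\<^sup>2 + t'\<^sup>2 = - \<iota> * a Bl1" by (simp add: t' s t field_simps)
  then have "\<iota> * (s\<^sup>2 + t'\<^sup>2) = - \<iota>\<^sup>2 * a Bl1" by (simp add: power2_eq_square)
  ultimately show ?thesis using t' \<iota> by (intro exI[of _ s] exI[of _ t']) (auto simp: all_block)
qed

section \<open>Homogenisation of polynomials and forms on the conic\<close>

definition homogenize :: "nat \<Rightarrow> 'k::field poly \<Rightarrow> 'k \<Rightarrow> 'k \<Rightarrow> 'k" where
  "homogenize n g s t = (\<Sum>k\<le>n. coeff g k * s ^ k * t ^ (n - k))"

lemma homogenize_0 [simp]: "homogenize n 0 s t = 0"
  by (simp add: homogenize_def)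

lemma homogenize_nonzero:
  assumes "degree g \<le> n" "t \<noteq> 0"
  shows "homogenize n g s t = t ^ n * poly g (s / t)"
proof -
  have "poly g (s / t) = (\<Sum>k\<le>n. coeff g k * (s / t) ^ k)"
    unfolding poly_altdef using assms(1)
    by (intro sum.mono_neutral_left) (auto simp: coeff_eq_0)
  then show ?thesis
    using assms(2) by (auto simp: homogenize_def sum_distrib_left power_divide power_diff
        field_simps intro!: sum.cong)
qed

lemma homogenize_at_1: "degree g \<le> n \<Longrightarrow> homogenize n g s 1 = poly g s"
  by (simp add: homogenize_nonzero)

lemma homogenize_at_0: "homogenize n g s 0 = coeff g n * s ^ n"
proof -
  have "homogenize n g s 0 = (\<Sum>k\<le>n. if k = n then coeff g k * s ^ k else 0)"
    unfolding homogenize_def by (intro sum.cong) (auto simp: power_0_left)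
  then show ?thesis by simp
qed

lemma coeff_mult_bounded:
  fixes g :: "'k::field poly"
  assumes "degree g \<le> n" "degree g' \<le> m"
  shows "coeff (g * g') (n + m) = coeff g n * coeff g' m"
proof (cases "degree g = n \<and> degree g' = m")
  case True
  then show ?thesis using coeff_mult_degree_sum by blast
next
  case False
  then have "degree (g * g') < n + m"
    using assms degree_mult_le[of g g'] by linarith
  then have "coeff (g * g') (n + m) = 0" by (rule coeff_eq_0)
  moreover have "coeff g n = 0 \<or> coeff g' m = 0"
    using False assms by (metis coeff_eq_0 le_neq_implies_less)
  ultimately show ?thesis by auto
qed

text \<open>For nonzero \<open>t\<close> homogenising amounts to evaluating at \<open>s / t\<close>
  and rescaling. At \<open>t = 0\<close> only the coefficients at \<open>n\<close> and
  \<open>m\<close> survive; these may be zero, since \<open>n\<close> and \<open>m\<close> merely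
  bound the degrees.\<close>

lemma homogenize_mult:
  assumes "degree g \<le> n" "degree g' \<le> m"
  shows "homogenize (n + m) (g * g') s t = homogenize n g s t * homogenize m g' s t"
proof (cases "t = 0")
  case True
  then show ?thesis
    by (simp add: homogenize_at_0 coeff_mult_bounded[OF assms] power_add)
next
  case False
  have "degree (g * g') \<le> n + m" using assms degree_mult_le[of g g'] by linarith
  then show ?thesis using False assms by (simp add: homogenize_nonzero power_add)
qed

lemma homogenize_1 [simp]: "homogenize 0 1 s t = 1"
  by (simp add: homogenize_def)

lemma homogenize_power:
  assumes "degree g \<le> n"
  shows "homogenize (k * n) (g ^ k) s t = homogenize n g s t ^ k"
proof (induction k)
  case (Suc k)
  have "degree (g ^ k) \<le> k * n"
    using degree_power_le[of g k] assms by (metis (no_types, lifting) le_trans mult.commute mult_le_mono1)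
  then show ?case using homogenize_mult[OF assms, of "g ^ k" "k * n"] Suc by simp
qed simp

lemma degree_branch_poly: "degree (branch_poly \<iota> i) \<le> 2"
  by (cases i) auto

lemma homogenize_branch_poly:
  "homogenize 2 (branch_poly \<iota> i) s t = branch_form \<iota> i s t"
  by (cases i) (auto simp: homogenize_def numeral_2_eq_2 algebra_simps power2_eq_square)

lemma branch_form_at_1: "branch_form \<iota> i z 1 = poly (branch_poly \<iota> i) z"
  using homogenize_branch_poly[of \<iota> i z 1] degree_branch_poly[of \<iota> i] by (simp add: homogenize_at_1)

text \<open>On the conic, \<open>(a\<^sub>0 - \<iota> a\<^sub>1) / 2 = s\<^sup>2\<close>, \<open>a\<^sub>2 / 2 = s t\<close> and
  \<open>(- a\<^sub>0 - \<iota> a\<^sub>1) / 2 = t\<^sup>2\<close>. Hence \<open>s\<^sup>k t\<^bsup>2 d - k\<^esup>\<close> is a form of degree \<open>d\<close> in the \<open>a\<^sub>i\<close>.\<close>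

definition conic_monomial :: "'k::field \<Rightarrow> nat \<Rightarrow> nat \<Rightarrow> (block \<Rightarrow> 'k) \<Rightarrow> 'k" where
  "conic_monomial \<iota> d k a =
     (if even k
      then ((a Bl0 - \<iota> * a Bl1) / 2) ^ (k div 2) * ((- a Bl0 - \<iota> * a Bl1) / 2) ^ (d - k div 2)
      else ((a Bl0 - \<iota> * a Bl1) / 2) ^ (k div 2) * ((- a Bl0 - \<iota> * a Bl1) / 2) ^ (d - Suc (k div 2))
        * (a Bl2 / 2))"

lemma conic_monomial_branch_form:
  fixes \<iota> :: "'k::field_char_0"
  assumes \<iota>: "\<iota>\<^sup>2 = -1" and k: "k \<le> 2 * d"
  shows "conic_monomial \<iota> d k (\<lambda>i. branch_form \<iota> i s t) = s ^ k * t ^ (2 * d - k)"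
proof -
  have \<iota>': "\<iota> * (\<iota> * x) = - x" for x
    using \<iota> by (metis mult.assoc mult_minus1 power2_eq_square)
  have 1: "(branch_form \<iota> Bl0 s t - \<iota> * branch_form \<iota> Bl1 s t) / 2 = s\<^sup>2" by (simp add: \<iota>')
  have 2: "(- branch_form \<iota> Bl0 s t - \<iota> * branch_form \<iota> Bl1 s t) / 2 = t\<^sup>2" by (simp add: \<iota>')
  show ?thesis
  proof (cases "even k")
    case True
    then obtain q where q: "k = 2 * q" by blast
    then have "2 * d - k = 2 * (d - q)" by simp
    then show ?thesis unfolding conic_monomial_def 1 2 using q by (simp add: power_mult)
  next
    case False
    then obtain q where q: "k = 2 * q + 1" using oddE by blast
    then have "2 * d - k = 2 * (d - Suc q) + 1" using k by simp
    moreover have "branch_form \<iota> Bl2 s t / 2 = s * t" by simp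
    ultimately show ?thesis unfolding conic_monomial_def 1 2 using q
      by (simp add: power_mult[symmetric])
  qed
qed

lemma conic_monomial_scale:
  assumes k: "k \<le> 2 * d"
  shows "conic_monomial \<iota> d k (\<lambda>i. c * a i) = c ^ d * conic_monomial \<iota> d k a"
proof -
  have 1: "(c * a Bl0 - \<iota> * (c * a Bl1)) / 2 = c * ((a Bl0 - \<iota> * a Bl1) / 2)"
    and 2: "(- (c * a Bl0) - \<iota> * (c * a Bl1)) / 2 = c * ((- a Bl0 - \<iota> * a Bl1) / 2)"
    by (simp_all add: algebra_simps diff_divide_distrib add_divide_distrib)
  show ?thesis
  proof (cases "even k")
    case True
    then have "d = k div 2 + (d - k div 2)" using k by simp
    then have "c ^ d = c ^ (k div 2) * c ^ (d - k div 2)" by (metis power_add)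
    then show ?thesis unfolding conic_monomial_def 1 2 power_mult_distrib using True by simp
  next
    case False
    then have "d = k div 2 + (d - Suc (k div 2)) + 1" using k by presburger
    then have "c ^ d = c ^ (k div 2) * c ^ (d - Suc (k div 2)) * c" by (metis power_add power_one_right)
    then show ?thesis unfolding conic_monomial_def 1 2 power_mult_distrib using False by simp
  qed
qed

text \<open>A lift of the homogenised \<open>g\<close> to a form of degree \<open>d\<close> in three
  variables. It involves no choice of \<open>s\<close> and \<open>t\<close>, so substituting
  polynomials for the \<open>a i\<close> gives a polynomial function.\<close>

definition conic_form :: "'k::field \<Rightarrow> nat \<Rightarrow> 'k poly \<Rightarrow> (block \<Rightarrow> 'k) \<Rightarrow> 'k" where
  "conic_form \<iota> d g a = (\<Sum>k\<le>2 * d. coeff g k * conic_monomial \<iota> d k a)"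

lemma conic_form_branch_form:
  fixes \<iota> :: "'k::field_char_0"
  assumes "\<iota>\<^sup>2 = -1"
  shows "conic_form \<iota> d g (\<lambda>i. branch_form \<iota> i s t) = homogenize (2 * d) g s t"
  unfolding conic_form_def homogenize_def
  by (intro sum.cong) (auto simp: conic_monomial_branch_form assms mult.assoc)

lemma conic_form_scale: "conic_form \<iota> d g (\<lambda>i. c * a i) = c ^ d * conic_form \<iota> d g a"
  unfolding conic_form_def sum_distrib_left
  by (intro sum.cong) (auto simp: conic_monomial_scale)

section \<open>Divisors of the branch polynomials and the resulting section spaces\<close>

lemma branch_points_disjoint:
  fixes \<iota> :: "'k::field_char_0"
  assumes \<iota>: "\<iota>\<^sup>2 = -1" and "z \<in> branch_points \<iota> i" "z \<in> branch_points \<iota> j"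
  shows "i = j"
proof -
  have "\<iota> \<noteq> 0" "\<iota> \<noteq> 1" "\<iota> \<noteq> -1" using \<iota> by auto
  moreover from this have "- \<iota> \<noteq> 1" by (metis minus_minus)
  ultimately have "\<iota> \<noteq> 0" "\<iota> \<noteq> 1" "\<iota> \<noteq> -1" "- \<iota> \<noteq> 1" "1 \<noteq> - \<iota>" by auto
  then show ?thesis using assms(2,3)
    by (cases i; cases j) (auto simp: equation_minus_iff)
qed

lemma ord_at_branch_poly:
  fixes \<iota> :: "'k::field_char_0"
  assumes \<iota>: "\<iota>\<^sup>2 = -1"
  shows "ord_at (Pt a) (Fract (branch_poly \<iota> i) 1) = (if Pt a \<in> branch_points \<iota> i then 1 else 0)"
    and "ord_at Infty (Fract (branch_poly \<iota> i) 1) = (if i = Bl2 then -1 else -2)"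
proof -
  have "\<iota> \<noteq> 0" using \<iota> by auto
  have neq: "(1::'k) \<noteq> -1" "\<iota> \<noteq> - \<iota>" using \<open>\<iota> \<noteq> 0\<close> by simp_all
  have e: "branch_poly \<iota> Bl0 = [:- 1, 1:] * [:- (- 1), 1:]"
    "branch_poly \<iota> Bl1 = smult \<iota> ([:- \<iota>, 1:] * [:- (- \<iota>), 1:])"
    "branch_poly \<iota> Bl2 = smult 2 [:- 0, 1:]"
    using \<iota> by (simp_all add: power2_eq_square)
  have two: "order a ([:- b, 1:] * [:- c, 1:]) = (if a = b then 1 else 0) + (if a = c then 1 else 0)"
    for b c :: 'k
    by (subst order_mult) (simp_all only: order_linear mult_eq_0_iff pCons_eq_0_iff, simp)
  have "order a (branch_poly \<iota> i) = (if Pt a \<in> branch_points \<iota> i then 1 else 0)"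
  proof (cases i)
    case Bl0
    then show ?thesis using neq two[of 1 "-1"] e(1) by auto
  next
    case Bl1
    show ?thesis unfolding Bl1 e(2) order_smult[OF \<open>\<iota> \<noteq> 0\<close>] two using neq by auto
  next
    case Bl2
    then show ?thesis unfolding Bl2 e(3) by (subst order_smult) (auto simp: order_linear[of a 0, simplified])
  qed
  moreover have "branch_poly \<iota> i \<noteq> 0" using \<open>\<iota> \<noteq> 0\<close> by (cases i) auto
  ultimately show "ord_at (Pt a) (Fract (branch_poly \<iota> i) 1) = (if Pt a \<in> branch_points \<iota> i then 1 else 0)"
    by (simp add: ord_at_Fract)
  show "ord_at Infty (Fract (branch_poly \<iota> i) 1) = (if i = Bl2 then -1 else -2)"
    using \<open>branch_poly \<iota> i \<noteq> 0\<close> \<open>\<iota> \<noteq> 0\<close> by (cases i) (auto simp: ord_at_Fract)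
qed

lemma branch_poly_nonzero: "\<iota>\<^sup>2 = -1 \<Longrightarrow> branch_poly \<iota> i \<noteq> (0 :: 'k::field_char_0 poly)"
  by (cases i) auto

text \<open>A nonconstant denominator has a root. As there is no pole at it, the numerator shares
  the root, a linear factor cancels, and the degree of the denominator drops.\<close>

lemma poly_of_ord_nonneg:
  fixes f :: "'k::alg_closed_field ratfun"
  assumes "f \<noteq> 0" "\<And>a. ord_at (Pt a) f \<ge> 0"
  shows "\<exists>p. f = Fract p 1"
proof -
  obtain p q where f: "f = Fract p q" "q \<noteq> 0" "p \<noteq> 0"
    using assms(1) by (cases f rule: Fract_cases_nonzero) auto
  have le: "order a q \<le> order a p" for a
    using assms(2)[of a] f by (simp add: ord_at_Fract)
  have "\<exists>r. Fract p q = Fract r 1" using f(2,3) le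
  proof (induction "degree q" arbitrary: p q rule: less_induct)
    case less
    show ?case
    proof (cases "degree q = 0")
      case True
      then obtain c where "q = [:c:]" by (rule degree_eq_zeroE)
      then have "Fract p q = Fract (smult (inverse c) p) 1" using less by (simp add: eq_fract)
      then show ?thesis by blast
    next
      case False
      then obtain a where a: "poly q a = 0" using alg_closed_imp_poly_has_root by blast
      then have "order a q > 0" using less by (simp add: order_gt_0_iff)
      with less(4)[of a] have "order a p > 0" by linarith
      then have "poly p a = 0" using less by (simp add: order_gt_0_iff)
      with a obtain p' q' where pq: "p = [:-a, 1:] * p'" "q = [:-a, 1:] * q'"
        unfolding poly_eq_0_iff_dvd dvd_def by auto
      have nz: "q' \<noteq> 0" "p' \<noteq> 0" using pq less by auto
      have "degree q' < degree q" unfolding pq using nz by (subst degree_mult_eq) auto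
      moreover have "order b q' \<le> order b p'" for b
        using less(4)[of b] nz less(2,3) unfolding pq by (simp add: order_mult del: mult_pCons_left)
      ultimately obtain r where "Fract p' q' = Fract r 1" using less(1)[of q' p'] nz by blast
      moreover have "Fract p q = Fract p' q'" unfolding pq using nz by (intro mult_fract_cancel) simp
      ultimately show ?thesis by auto
    qed
  qed
  then show ?thesis using f by simp
qed

text \<open>On the affine part this function generates, over the polynomials, all functions whose
  pole order at the branch points of block \<open>i\<close> is at most \<open>\<alpha> i\<close> and
  which have no other poles.\<close>

definition base_section :: "'k::field \<Rightarrow> (block \<Rightarrow> int) \<Rightarrow> 'k ratfun" where
  "base_section \<iota> \<alpha> = (\<Prod>i\<in>UNIV. Fract (branch_poly \<iota> i) 1 powi (- \<alpha> i))"

lemma base_section_nonzero: "\<iota>\<^sup>2 = -1 \<Longrightarrow> base_section \<iota> \<alpha> \<noteq> (0 :: 'k::field_char_0 ratfun)"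
  unfolding base_section_def by (simp add: branch_poly_nonzero)

lemma ord_at_base_section:
  fixes \<iota> :: "'k::field_char_0"
  assumes \<iota>: "\<iota>\<^sup>2 = -1"
  shows "ord_at (Pt a) (base_section \<iota> \<alpha>) = - (\<Sum>i\<in>UNIV. if Pt a \<in> branch_points \<iota> i then \<alpha> i else 0)"
    and "ord_at Infty (base_section \<iota> \<alpha>) = 2 * (\<Sum>i\<in>UNIV. \<alpha> i) - \<alpha> Bl2"
proof -
  have o: "ord_at z (base_section \<iota> \<alpha>)
      = (\<Sum>i\<in>UNIV. - \<alpha> i * ord_at z (Fract (branch_poly \<iota> i) 1))" for z
    unfolding base_section_def using branch_poly_nonzero[OF \<iota>]
    by (subst ord_at_prod) (auto simp: ord_at_powi)
  show "ord_at (Pt a) (base_section \<iota> \<alpha>) = - (\<Sum>i\<in>UNIV. if Pt a \<in> branch_points \<iota> i then \<alpha> i else 0)"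
    unfolding o ord_at_branch_poly[OF \<iota>] sum_negf[symmetric] by (intro sum.cong) auto
  show "ord_at Infty (base_section \<iota> \<alpha>) = 2 * (\<Sum>i\<in>UNIV. \<alpha> i) - \<alpha> Bl2"
    unfolding o ord_at_branch_poly[OF \<iota>] sum_block by simp
qed

text \<open>Dividing by \<open>base_section\<close> turns the conditions at the finite points into
  the absence of poles, so the quotient is a polynomial. The condition at \<open>Infty\<close>
  becomes a bound on its degree.\<close>

lemma sections_eq_polys:
  fixes \<iota> :: "'k::{alg_closed_field,field_char_0}"
  assumes \<iota>: "\<iota>\<^sup>2 = -1" and "f \<noteq> 0"
  shows "(\<forall>z. ord_at z f + (\<Sum>i\<in>UNIV. if z \<in> branch_points \<iota> i then \<alpha> i else 0) \<ge> 0)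
    \<longleftrightarrow> (\<exists>g. g \<noteq> 0 \<and> int (degree g) \<le> 2 * (\<Sum>i\<in>UNIV. \<alpha> i) \<and> f = Fract g 1 * base_section \<iota> \<alpha>)"
    (is "?L \<longleftrightarrow> ?R")
proof -
  let ?b = "base_section \<iota> \<alpha>"
  have b: "?b \<noteq> 0" using \<iota> by (rule base_section_nonzero)
  \<comment> \<open>This coefficient cancels the term \<open>- \<alpha> Bl2\<close> in the order of
    \<open>base_section\<close> at \<open>Infty\<close>; hence the degree bound is symmetric in the
    three blocks.\<close>
  have oinf: "(\<Sum>i\<in>UNIV. if Infty \<in> branch_points \<iota> i then \<alpha> i else 0) = \<alpha> Bl2"
    by (simp add: sum_block)
  show ?thesis
  proof
    assume L: ?L
    define g0 where "g0 = f / ?b"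
    have g0: "g0 \<noteq> 0" "f = g0 * ?b" using b assms(2) by (auto simp: g0_def)
    have of: "ord_at z f = ord_at z g0 + ord_at z ?b" for z
      unfolding g0(2) using g0 b by (intro ord_at_mult) auto
    have "ord_at (Pt a) g0 \<ge> 0" for a
      using L[rule_format, of "Pt a"] of[of "Pt a"] ord_at_base_section[OF \<iota>] by simp
    then obtain g where g: "g0 = Fract g 1" using poly_of_ord_nonneg[OF g0(1)] by blast
    have "g \<noteq> 0" using g g0 by auto
    have "ord_at Infty g0 = - int (degree g)" unfolding g using \<open>g \<noteq> 0\<close> by (simp add: ord_at_Fract)
    then have "int (degree g) \<le> 2 * (\<Sum>i\<in>UNIV. \<alpha> i)"
      using L[rule_format, of Infty] of[of Infty] ord_at_base_section[OF \<iota>] oinf by simp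
    then show ?R using \<open>g \<noteq> 0\<close> g g0 by blast
  next
    assume ?R
    then obtain g where g: "g \<noteq> 0" "int (degree g) \<le> 2 * (\<Sum>i\<in>UNIV. \<alpha> i)" "f = Fract g 1 * ?b" by blast
    have of: "ord_at z f = poly_ord z g + ord_at z ?b" for z
      unfolding g(3) using g b by (simp add: ord_at_mult ord_at_Fract) (cases z; simp)
    show ?L
    proof
      fix z
      show "ord_at z f + (\<Sum>i\<in>UNIV. if z \<in> branch_points \<iota> i then \<alpha> i else 0) \<ge> 0"
        using g(2) of[of z] ord_at_base_section[OF \<iota>] oinf by (cases z) simp_all
    qed
  qed
qed


section \<open>Polyhedra in the lattice of one-parameter subgroups\<close>

lemma rat_vec_add: "rat_vec (v + w) = rat_vec v + rat_vec w"
  by (simp add: rat_vec_def vec_eq_iff)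

lemma rat_vec_scale: "rat_vec (c *s v) = of_int c *s rat_vec v"
  by (simp add: rat_vec_def vec_eq_iff)

lemma rat_vec_0 [simp]: "rat_vec 0 = 0"
  by (simp add: rat_vec_def vec_eq_iff)

lemma rat_vec_nth [simp]: "rat_vec v $ k = of_int (v $ k)"
  by (simp add: rat_vec_def)

lemma extend_Q_add: "extend_Q S (v + w) = extend_Q S v + extend_Q S w"
  by (simp add: extend_Q_def vec.scale_left_distrib sum.distrib)

lemma extend_Q_scale: "extend_Q S (c *s v) = c *s extend_Q S v"
  by (simp add: extend_Q_def vec.scale_sum_right)

lemma extend_Q_sum: "extend_Q S (\<Sum>x\<in>A. f x) = (\<Sum>x\<in>A. extend_Q S (f x))"
proof (induction A rule: infinite_finite_induct)
  case empty
  show ?case by (simp add: extend_Q_def)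
qed (simp_all add: extend_Q_add extend_Q_def[of _ 0])

lemma extend_Q_diff: "extend_Q S (v - w) = extend_Q S v - extend_Q S w"
proof -
  have "extend_Q S v = extend_Q S ((v - w) + w)" by simp
  then show ?thesis unfolding extend_Q_add by simp
qed

lemma additive_scale:
  fixes S :: "int^'n \<Rightarrow> int^'m"
  assumes add: "\<And>v w. S (v + w) = S v + S w"
  shows "S (c *s v) = c *s S v"
proof -
  have S0: "S 0 = 0" using add[of 0 0] by simp
  have nat: "S (int n *s v) = int n *s S v" for n
  proof (induction n)
    case (Suc n)
    have *: "int (Suc n) *s x = int n *s x + x" for x :: "int^'z"
      by (simp add: vec_eq_iff algebra_simps)
    show ?case unfolding * add Suc ..
  qed (simp add: S0 vec_eq_iff[symmetric])
  show ?thesis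
  proof (cases "c \<ge> 0")
    case True
    then show ?thesis using nat[of "nat c"] by simp
  next
    case False
    have "S (c *s v) + S ((- c) *s v) = S 0"
      unfolding add[symmetric] by (intro arg_cong[of _ _ S]) (simp add: vec_eq_iff)
    moreover have "S ((- c) *s v) = (- c) *s S v" using nat[of "nat (- c)"] False by simp
    ultimately show ?thesis using S0 by (simp add: vec_eq_iff algebra_simps)
  qed
qed

lemma extend_Q_rat_vec:
  fixes S :: "int^'n \<Rightarrow> int^'n"
  assumes add: "\<And>v w. S (v + w) = S v + S w"
  shows "extend_Q S (rat_vec v) = rat_vec (S v)"
proof -
  have sum: "S (\<Sum>k\<in>A. f k) = (\<Sum>k\<in>A. S (f k))" for A and f :: "'n \<Rightarrow> int^'n"
    using add[of 0 0] by (induction A rule: infinite_finite_induct) (auto simp: add)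
  have rsum: "rat_vec (\<Sum>k\<in>A. f k) = (\<Sum>k\<in>A. rat_vec (f k))" for A and f :: "'n \<Rightarrow> int^'n"
    by (induction A rule: infinite_finite_induct) (auto simp: rat_vec_add)
  have "v = (\<Sum>k\<in>UNIV. (v $ k) *s axis k 1)"
    by (simp add: vec_eq_iff axis_def if_distrib cong: if_cong)
  then have "S v = S (\<Sum>k\<in>UNIV. (v $ k) *s axis k 1)" by simp
  also have "\<dots> = (\<Sum>k\<in>UNIV. (v $ k) *s S (axis k 1))"
    unfolding sum by (intro sum.cong) (auto simp: additive_scale add)
  finally show ?thesis by (simp add: extend_Q_def rsum rat_vec_scale)
qed

lemma subspace_lattice_Q:
  "v \<in> lattice_Q N \<Longrightarrow> w \<in> lattice_Q N \<Longrightarrow> v + w \<in> lattice_Q N"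
  "v \<in> lattice_Q N \<Longrightarrow> w \<in> lattice_Q N \<Longrightarrow> v - w \<in> lattice_Q N"
  "v \<in> lattice_Q N \<Longrightarrow> c *s v \<in> lattice_Q N"
  "0 \<in> lattice_Q N"
  "(\<And>x. x \<in> A \<Longrightarrow> f x \<in> lattice_Q N) \<Longrightarrow> (\<Sum>x\<in>A. f x) \<in> lattice_Q N"
  unfolding lattice_Q_def
  by (auto intro: vec.span_add vec.span_diff vec.span_scale vec.span_zero vec.span_sum)

lemma rat_vec_in_lattice_Q: "v \<in> N \<Longrightarrow> rat_vec v \<in> lattice_Q N"
  by (auto simp: lattice_Q_def intro!: vec.span_base)

lemma dual_Q_add: "u \<in> dual_Q N \<Longrightarrow> v \<in> lattice_Q N \<Longrightarrow> w \<in> lattice_Q N \<Longrightarrow> u (v + w) = u v + u w"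
  and dual_Q_scale: "u \<in> dual_Q N \<Longrightarrow> v \<in> lattice_Q N \<Longrightarrow> u (c *s v) = c * u v"
  by (auto simp: dual_Q_def)

lemma dual_Q_0: "u \<in> dual_Q N \<Longrightarrow> u 0 = 0"
  using dual_Q_scale[of u N 0 0] by (simp add: subspace_lattice_Q)

lemma dual_Q_sum:
  assumes "u \<in> dual_Q N" "\<And>x. x \<in> A \<Longrightarrow> f x \<in> lattice_Q N"
  shows "u (\<Sum>x\<in>A. f x) = (\<Sum>x\<in>A. u (f x))"
  using assms(2)
  by (induction A rule: infinite_finite_induct)
    (auto simp: dual_Q_0[OF assms(1)] dual_Q_add[OF assms(1)] subspace_lattice_Q)

text \<open>Here \<open>h\<close> stands for the halved exponents; halving the equations of the
  trinomial lattice does not change their solutions. The splitting \<open>S\<close> is an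
  endomorphism of the ambient lattice with values in \<open>N\<close> that fixes
  \<open>N\<close>.\<close>

locale block_lattice =
  fixes blk :: "'n::finite \<Rightarrow> block" and h :: "'n \<Rightarrow> nat"
    and N :: "(int^'n) set" and S :: "int^'n \<Rightarrow> int^'n"
  assumes h_pos: "0 < h k"
    and blk_surj: "\<exists>k. blk k = i"
    and N_eq: "N = {v. \<forall>i j. (\<Sum>k | blk k = i. int (h k) * v $ k) = (\<Sum>k | blk k = j. int (h k) * v $ k)}"
    and S_add: "S (v + w) = S v + S w"
    and S_range: "S v \<in> N"
    and S_id: "v \<in> N \<Longrightarrow> S v = v"
begin

lemma h_nonzero [simp]: "h k \<noteq> 0"
  using h_pos[of k] by simp

abbreviation "NQ \<equiv> lattice_Q N"
abbreviation "SQ \<equiv> extend_Q S"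

definition bdeg :: "block \<Rightarrow> rat^'n \<Rightarrow> rat" where
  "bdeg i v = (\<Sum>k | blk k = i. of_nat (h k) * v $ k)"

lemma bdeg_add: "bdeg i (v + w) = bdeg i v + bdeg i w"
  by (simp add: bdeg_def sum.distrib algebra_simps)

lemma bdeg_scale: "bdeg i (c *s v) = c * bdeg i v"
  by (simp add: bdeg_def sum_distrib_left mult_ac)

lemma bdeg_diff: "bdeg i (v - w) = bdeg i v - bdeg i w"
  by (simp add: bdeg_def sum_subtractf algebra_simps)

lemma bdeg_rat_vec: "bdeg i (rat_vec v) = of_int (\<Sum>k | blk k = i. int (h k) * v $ k)"
  by (simp add: bdeg_def)

lemma rat_vec_N_iff: "v \<in> N \<longleftrightarrow> (\<forall>i j. bdeg i (rat_vec v) = bdeg j (rat_vec v))"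
  by (simp only: N_eq bdeg_rat_vec mem_Collect_eq of_int_eq_iff)

text \<open>Clearing denominators makes a rational solution of the block equations integral, so the
  integral solutions span the rational solution space.\<close>

lemma NQ_iff: "v \<in> NQ \<longleftrightarrow> (\<forall>i j. bdeg i v = bdeg j v)"
proof
  assume "v \<in> NQ"
  then show "\<forall>i j. bdeg i v = bdeg j v" unfolding lattice_Q_def
  proof (induction rule: vec.span_induct_alt)
    case base
    show ?case by (simp add: bdeg_def)
  next
    case (step c x y)
    then obtain w where "w \<in> N" "x = rat_vec w" by blast
    then have "bdeg i x = bdeg j x" for i j using rat_vec_N_iff by blast
    then show ?case using step by (metis bdeg_add bdeg_scale)
  qed
next
  assume v: "\<forall>i j. bdeg i v = bdeg j v"
  obtain m where m: "m > 0" "\<forall>k\<in>UNIV. of_nat m * v $ k \<in> \<int>"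
    using common_denominator[of UNIV "\<lambda>k. v $ k"] by auto
  define w :: "int^'n" where "w = (\<chi> k. \<lfloor>of_nat m * v $ k\<rfloor>)"
  have w: "rat_vec w = of_nat m *s v" using m(2) by (simp add: w_def vec_eq_iff)
  then have "w \<in> N" unfolding rat_vec_N_iff using v by (metis bdeg_scale)
  then have "(1 / of_nat m) *s rat_vec w \<in> NQ"
    by (intro subspace_lattice_Q rat_vec_in_lattice_Q)
  moreover have "(1 / of_nat m) *s rat_vec w = v" using m(1) by (simp add: w)
  ultimately show "v \<in> NQ" by simp
qed

lemma SQ_in_NQ: "SQ v \<in> NQ"
  unfolding extend_Q_def by (intro subspace_lattice_Q rat_vec_in_lattice_Q S_range)

lemma SQ_id: "v \<in> NQ \<Longrightarrow> SQ v = v"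
  unfolding lattice_Q_def
proof (induction rule: vec.span_induct_alt)
  case base
  show ?case by (simp add: extend_Q_def)
next
  case (step c x y)
  then show ?case using S_id by (auto simp: extend_Q_add extend_Q_scale extend_Q_rat_vec[OF S_add])
qed

definition \<sigma> :: "(rat^'n) set" where
  "\<sigma> = SQ ` ({v. \<forall>k. 0 \<le> v $ k} \<inter> NQ)"

text \<open>The extension of \<open>S\<close> fixes \<open>NQ\<close>, so the cone does not depend
  on the choice of \<open>S\<close>.\<close>

lemma \<sigma>_eq: "\<sigma> = {v \<in> NQ. \<forall>k. 0 \<le> v $ k}"
proof -
  have "SQ ` ({v. \<forall>k. 0 \<le> v $ k} \<inter> NQ) = (\<lambda>v. v) ` ({v. \<forall>k. 0 \<le> v $ k} \<inter> NQ)"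
    by (intro image_cong) (auto simp: SQ_id)
  then show ?thesis unfolding \<sigma>_def by auto
qed

text \<open>The degree of the \<open>k\<close>-th coordinate function, set to zero outside
  \<open>NQ\<close> to be a member of \<open>dual_Q N\<close>.\<close>

definition coord :: "'n \<Rightarrow> rat^'n \<Rightarrow> rat" where
  "coord k = (\<lambda>v. if v \<in> NQ then v $ k else 0)"

lemma coord_dual_lattice: "coord k \<in> dual_lattice N"
  by (auto simp: coord_def dual_lattice_def dual_Q_def subspace_lattice_Q)

lemma coord_dual_Q: "coord k \<in> dual_Q N"
  using coord_dual_lattice by (simp add: dual_lattice_def)

lemma coord_dual_cone: "coord k \<in> dual_cone N \<sigma>"
  using coord_dual_Q by (auto simp: dual_cone_def coord_def \<sigma>_eq)

lemma polyhedral_cone_\<sigma>: "polyhedral_cone_in N \<sigma>"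
  unfolding polyhedral_cone_in_def
  by (intro exI[of _ "range coord"]) (use coord_dual_Q in \<open>auto simp: \<sigma>_eq coord_def\<close>)

text \<open>The fibre of \<open>(bdeg Bl0, bdeg Bl1, bdeg Bl2)\<close> over the \<open>i\<close>-th unit vector meets the orthant
  in a polyhedron, of which \<open>\<Delta> i\<close> is the translate by \<open>-\<kappa> i\<close>.\<close>

definition vertex :: "'n \<Rightarrow> rat^'n" where
  "vertex k = (1 / of_nat (h k)) *s axis k 1"

definition \<Delta> :: "block \<Rightarrow> (rat^'n) set" where
  "\<Delta> i = minkowski_sum (qconvex_hull {SQ (vertex k) |k. blk k = i}) \<sigma>"

definition \<kappa> :: "block \<Rightarrow> rat^'n" where
  "\<kappa> i = vertex (SOME k. blk k = i) - SQ (vertex (SOME k. blk k = i))"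

lemma bdeg_vertex: "bdeg j (vertex k) = (if blk k = j then 1 else 0)"
proof -
  have "bdeg j (vertex k) = (\<Sum>l | blk l = j. if l = k then 1 else 0)"
    unfolding bdeg_def vertex_def by (intro sum.cong) (auto simp: axis_def)
  then show ?thesis by simp
qed

lemma vertex_nonneg: "0 \<le> vertex k $ l"
  by (simp add: vertex_def axis_def)

text \<open>Two vertices of one block differ by a vector of \<open>NQ\<close>, which
  \<open>SQ\<close> fixes. Hence \<open>vertex k - SQ (vertex k)\<close> depends only on the block,
  and the choice made in \<open>\<kappa>\<close> is immaterial.\<close>

lemma SQ_vertex: "SQ (vertex k) = vertex k - \<kappa> (blk k)"
proof -
  define k0 where "k0 = (SOME l. blk l = blk k)"
  have "blk k0 = blk k" unfolding k0_def by (rule someI[of _ k]) simp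
  then have "vertex k - vertex k0 \<in> NQ" by (simp add: NQ_iff bdeg_diff bdeg_vertex)
  then have "SQ (vertex k - vertex k0) = vertex k - vertex k0" by (rule SQ_id)
  then show ?thesis by (simp add: extend_Q_diff \<kappa>_def k0_def[symmetric] algebra_simps)
qed

lemma \<Delta>_subset: "\<Delta> i \<subseteq> {v \<in> NQ. \<forall>k. 0 \<le> (v + \<kappa> i) $ k}"
proof
  fix v assume "v \<in> \<Delta> i"
  then obtain F c y where F: "finite F" "F \<subseteq> {SQ (vertex k) |k. blk k = i}"
      "\<forall>x\<in>F. 0 \<le> c x" "(\<Sum>x\<in>F. c x) = 1"
    and y: "y \<in> \<sigma>" and v: "v = (\<Sum>x\<in>F. c x *s x) + y"
    unfolding \<Delta>_def minkowski_sum_def qconvex_hull_def by blast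
  have FN: "x \<in> NQ" if "x \<in> F" for x using that F(2) SQ_in_NQ by auto
  have "(\<Sum>x\<in>F. c x *s x) \<in> NQ" by (intro subspace_lattice_Q FN)
  then have "v \<in> NQ" unfolding v using y by (simp add: \<sigma>_eq subspace_lattice_Q)
  moreover have "0 \<le> (v + \<kappa> i) $ k" for k
  proof -
    have "\<kappa> i = (\<Sum>x\<in>F. c x) *s \<kappa> i" using F(4) by simp
    also have "\<dots> = (\<Sum>x\<in>F. c x *s \<kappa> i)" by (rule vec.scale_sum_left)
    finally have "v + \<kappa> i = (\<Sum>x\<in>F. c x *s (x + \<kappa> i)) + y"
      by (simp add: v vec.scale_right_distrib sum.distrib)
    then have "(v + \<kappa> i) $ k = (\<Sum>x\<in>F. c x * (x + \<kappa> i) $ k) + y $ k" by simp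
    moreover have "0 \<le> (x + \<kappa> i) $ k" if "x \<in> F" for x
      using that F(2) SQ_vertex vertex_nonneg by auto
    ultimately show ?thesis using F(3) y by (auto simp: \<sigma>_eq intro!: add_nonneg_nonneg sum_nonneg)
  qed
  ultimately show "v \<in> {v \<in> NQ. \<forall>k. 0 \<le> (v + \<kappa> i) $ k}" by simp
qed

text \<open>Put \<open>x = v + \<kappa> i\<close>. Its block degree is \<open>c + 1\<close> in block
  \<open>i\<close> and \<open>c\<close> in the other two, with \<open>c \<ge> 0\<close>. Dividing
  the part of \<open>x\<close> in block \<open>i\<close> by \<open>c + 1\<close> gives a convex
  combination of the vertices, and the rest of \<open>x\<close> has nonnegative coordinates and
  equal block degrees, so it lies in \<open>\<sigma>\<close>.\<close>

lemma \<Delta>_superset: "{v \<in> NQ. \<forall>k. 0 \<le> (v + \<kappa> i) $ k} \<subseteq> \<Delta> i"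
proof
  fix v assume "v \<in> {v \<in> NQ. \<forall>k. 0 \<le> (v + \<kappa> i) $ k}"
  then have v: "v \<in> NQ" "\<And>k. 0 \<le> (v + \<kappa> i) $ k" by auto
  define x where "x = v + \<kappa> i"
  define B where "B = {k. blk k = i}"
  define k0 where "k0 = (SOME l. blk l = i)"
  have k0: "blk k0 = i" unfolding k0_def using blk_surj by (rule someI_ex)
  define c where "c = bdeg i x - 1"
  have bx: "bdeg j x = (if j = i then 1 else 0) + (bdeg i v - bdeg i (SQ (vertex k0)))" for j
  proof -
    have "bdeg j v = bdeg i v" "bdeg j (SQ (vertex k0)) = bdeg i (SQ (vertex k0))"
      using v(1) SQ_in_NQ NQ_iff by blast+
    then show ?thesis using k0
      by (auto simp: x_def \<kappa>_def k0_def[symmetric] bdeg_add bdeg_diff bdeg_vertex)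
  qed
  obtain j where j: "j \<noteq> i" using block.distinct by metis
  have "0 \<le> bdeg j x" unfolding bdeg_def using v(2) x_def by (intro sum_nonneg) simp
  then have c: "c \<ge> 0" using bx[of j] bx[of i] j by (simp add: c_def)
  have c1: "c + 1 > 0" "c + 1 \<noteq> 0" using c by linarith+
  define f where "f k = SQ (vertex k)" for k
  \<comment> \<open>The coefficients in \<open>qconvex_hull\<close> are indexed by points, so
    distinct vertices must have distinct images under \<open>SQ\<close>.\<close>
  have inj: "inj_on f B"
  proof (rule inj_onI)
    fix k l assume kl: "k \<in> B" "l \<in> B" "f k = f l"
    then have "vertex k $ k = vertex l $ k" by (simp add: f_def SQ_vertex B_def)
    then show "k = l" using h_pos[of k] by (auto simp: vertex_def axis_def split: if_splits)
  qed
  define a where "a k = of_nat (h k) * x $ k / (c + 1)" for k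
  define b where "b p = a (inv_into B f p)" for p
  have bf: "b (f k) = a k" if "k \<in> B" for k using inj that by (simp add: b_def)
  have suma: "(\<Sum>k\<in>B. a k) = 1"
    using c1 by (simp add: a_def sum_divide_distrib[symmetric] B_def bdeg_def[symmetric] c_def)
  define q where "q = (\<Sum>p\<in>f ` B. b p *s p)"
  have q_in: "q \<in> qconvex_hull {SQ (vertex k) |k. blk k = i}"
    unfolding qconvex_hull_def q_def
  proof (intro CollectI exI conjI ballI)
    show "f ` B \<subseteq> {SQ (vertex k) |k. blk k = i}" by (auto simp: f_def B_def)
    show "0 \<le> b p" if "p \<in> f ` B" for p
      using that bf v(2) c1 unfolding a_def x_def[symmetric] by (auto intro!: divide_nonneg_pos)
    show "(\<Sum>p\<in>f ` B. b p) = 1" using suma bf by (simp add: sum.reindex[OF inj])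
  qed (auto simp: B_def)
  have "q = (\<Sum>k\<in>B. a k *s f k)"
    unfolding q_def using bf by (simp add: sum.reindex[OF inj])
  also have "\<dots> = (\<Sum>k\<in>B. a k *s vertex k) - (\<Sum>k\<in>B. a k) *s \<kappa> i"
    by (simp add: f_def SQ_vertex B_def vec.scale_right_diff_distrib sum_subtractf vec.scale_sum_left)
  finally have q: "q = (\<Sum>k\<in>B. a k *s vertex k) - \<kappa> i" by (simp add: suma)
  have qk: "(\<Sum>k\<in>B. a k *s vertex k) $ l = (if l \<in> B then x $ l / (c + 1) else 0)" for l
  proof -
    have "(\<Sum>k\<in>B. a k *s vertex k) $ l = (\<Sum>k\<in>B. if k = l then x $ l / (c + 1) else 0)"
      unfolding sum_component by (intro sum.cong) (auto simp: a_def vertex_def axis_def)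
    then show ?thesis by (simp add: B_def)
  qed
  have "v - q \<in> \<sigma>"
  proof -
    have "q \<in> NQ" unfolding q_def f_def by (intro subspace_lattice_Q) (auto simp: SQ_in_NQ)
    then have "v - q \<in> NQ" using v(1) by (intro subspace_lattice_Q)
    moreover have "0 \<le> (v - q) $ l" for l
    proof -
      have "(v - q) $ l = x $ l - (if l \<in> B then x $ l / (c + 1) else 0)"
        unfolding q vector_minus_component qk by (simp add: x_def)
      also have "\<dots> \<ge> 0"
      proof -
        have "x $ l / (c + 1) \<le> x $ l" using c c1 v(2)[of l]
          by (simp add: x_def[symmetric] divide_le_eq mult_le_cancel_left1 algebra_simps)
        then show ?thesis using v(2)[of l] by (simp add: x_def[symmetric])
      qed
      finally show ?thesis .
    qed
    ultimately show ?thesis by (simp add: \<sigma>_eq)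
  qed
  then have "q + (v - q) \<in> \<Delta> i" unfolding \<Delta>_def minkowski_sum_def using q_in by blast
  then show "v \<in> \<Delta> i" by simp
qed

lemma \<Delta>_eq: "\<Delta> i = {v \<in> NQ. \<forall>k. 0 \<le> (v + \<kappa> i) $ k}"
  using \<Delta>_subset \<Delta>_superset by blast

lemma SQ_vertex_in_\<Delta>: "blk k = i \<Longrightarrow> SQ (vertex k) \<in> \<Delta> i"
  by (auto simp: \<Delta>_eq SQ_in_NQ) (auto simp: SQ_vertex vertex_nonneg)

lemma \<Delta>_nonempty: "\<Delta> i \<noteq> {}"
  using SQ_vertex_in_\<Delta> blk_surj[of i] by blast

lemma polyhedron_\<Delta>: "polyhedron_in N (\<Delta> i)"
  unfolding polyhedron_in_def
proof (intro exI conjI)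
  show "\<Delta> i = {v \<in> NQ. \<forall>(u, c)\<in>(\<lambda>k. (coord k, - \<kappa> i $ k)) ` UNIV. c \<le> u v}"
    by (auto simp: \<Delta>_eq coord_def) (smt (verit) add.commute minus_le_iff neg_le_iff_le le_add_same_cancel1 diff_ge_0_iff_ge diff_minus_eq_add)+
qed (auto simp: coord_dual_Q)

lemma recession_\<Delta>: "recession_cone (\<Delta> i) = \<sigma>"
proof (intro set_eqI iffI)
  fix w assume "w \<in> recession_cone (\<Delta> i)"
  then obtain v where v: "v \<in> \<Delta> i" "\<And>t. t \<ge> 0 \<Longrightarrow> v + t *s w \<in> \<Delta> i"
    unfolding recession_cone_def by blast
  have "v + 1 *s w \<in> NQ" "v \<in> NQ" using v(1) v(2)[of 1] by (auto simp: \<Delta>_eq)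
  then have "(v + 1 *s w) - v \<in> NQ" by (rule subspace_lattice_Q)
  moreover have "0 \<le> w $ k" for k
  proof (rule ccontr)
    assume "\<not> 0 \<le> w $ k"
    then have neg: "w $ k < 0" by simp
    define a where "a = (v + \<kappa> i) $ k"
    have a: "a \<ge> 0" using v(1) by (simp add: \<Delta>_eq a_def)
    \<comment> \<open>For this \<open>t\<close> the \<open>k\<close>-th coordinate of
      \<open>v + t *s w + \<kappa> i\<close> is -1.\<close>
    define t where "t = (a + 1) / (- w $ k)"
    have "t \<ge> 0" unfolding t_def using a neg by (intro divide_nonneg_nonneg) auto
    then have "0 \<le> (v + t *s w + \<kappa> i) $ k" using v(2) by (simp add: \<Delta>_eq)
    also have "\<dots> = a + t * w $ k" by (simp add: a_def)
    also have "\<dots> = -1" using neg by (simp add: t_def)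
    finally show False by simp
  qed
  ultimately show "w \<in> \<sigma>" by (simp add: \<sigma>_eq)
next
  fix w assume w: "w \<in> \<sigma>"
  obtain v where v: "v \<in> \<Delta> i" using \<Delta>_nonempty by blast
  have "v + t *s w \<in> \<Delta> i" if "t \<ge> 0" for t
  proof -
    have "v + t *s w \<in> NQ" using v w by (auto simp: \<Delta>_eq \<sigma>_eq intro!: subspace_lattice_Q)
    moreover have "0 \<le> (v + t *s w + \<kappa> i) $ k" for k
    proof -
      have "0 \<le> (v + \<kappa> i) $ k" "0 \<le> t * w $ k" using v w that by (auto simp: \<Delta>_eq \<sigma>_eq)
      then show ?thesis by simp
    qed
    ultimately show ?thesis by (simp add: \<Delta>_eq)
  qed
  then show "w \<in> recession_cone (\<Delta> i)" unfolding recession_cone_def using v by blast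
qed

section \<open>Minima of linear functionals on the polyhedra\<close>

definition wt :: "(rat^'n \<Rightarrow> rat) \<Rightarrow> 'n \<Rightarrow> rat" where
  "wt u k = u (rat_vec (S (axis k 1)))"

text \<open>The smallest value of \<open>u\<close> on the generating points
  \<open>SQ (vertex k)\<close> of \<open>\<Delta> i\<close>. Being a minimum of finitely many
  numbers it makes sense for every \<open>u\<close>, also where \<open>u\<close> is unbounded below
  on the polyhedron.\<close>

definition \<mu> :: "(rat^'n \<Rightarrow> rat) \<Rightarrow> block \<Rightarrow> rat" where
  "\<mu> u i = Min ((\<lambda>k. wt u k / of_nat (h k)) ` {k. blk k = i})"

lemma \<mu>_le: "blk k = i \<Longrightarrow> \<mu> u i \<le> wt u k / of_nat (h k)"
  unfolding \<mu>_def by (intro Min_le) auto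

lemma \<mu>_attained: "\<exists>k. blk k = i \<and> \<mu> u i = wt u k / of_nat (h k)"
proof -
  have "\<mu> u i \<in> (\<lambda>k. wt u k / of_nat (h k)) ` {k. blk k = i}"
    unfolding \<mu>_def using blk_surj[of i] by (intro Min_in) auto
  then show ?thesis by blast
qed

lemma dual_SQ_vertex:
  assumes "u \<in> dual_Q N"
  shows "u (SQ (vertex k)) = wt u k / of_nat (h k)"
proof -
  have "SQ (axis k 1) = rat_vec (S (axis k 1))"
    using extend_Q_rat_vec[OF S_add, of "axis k 1"] by (simp add: rat_vec_def axis_def if_distrib cong: if_cong)
  moreover have "SQ (vertex k) = (1 / of_nat (h k)) *s SQ (axis k 1)"
    unfolding vertex_def by (rule extend_Q_scale)
  ultimately show ?thesis
    using dual_Q_scale[OF assms rat_vec_in_lattice_Q[OF S_range], of "1 / of_nat (h k)" "axis k 1"]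
    by (simp add: wt_def)
qed

text \<open>Since \<open>u\<close> is nonnegative on the recession cone, its minimum on the
  polyhedron is attained at one of the generating points.\<close>

lemma min_on_\<Delta>:
  assumes u: "u \<in> dual_cone N \<sigma>"
  shows "min_on u (\<Delta> i) = \<mu> u i"
  unfolding min_on_def
proof (rule Least_equality)
  have uQ: "u \<in> dual_Q N" using u by (simp add: dual_cone_def)
  obtain k where k: "blk k = i" "\<mu> u i = wt u k / of_nat (h k)" using \<mu>_attained by blast
  show "\<mu> u i \<in> u ` \<Delta> i"
    using SQ_vertex_in_\<Delta>[OF k(1)] dual_SQ_vertex[OF uQ, of k] k(2) by (metis image_eqI)
  fix q assume "q \<in> u ` \<Delta> i"
  then obtain F c y where F: "finite F" "F \<subseteq> {SQ (vertex k) |k. blk k = i}"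
      "\<forall>x\<in>F. 0 \<le> c x" "(\<Sum>x\<in>F. c x) = 1"
    and y: "y \<in> \<sigma>" and q: "q = u ((\<Sum>x\<in>F. c x *s x) + y)"
    unfolding \<Delta>_def minkowski_sum_def qconvex_hull_def by blast
  have FN: "x \<in> NQ" if "x \<in> F" for x using that F(2) SQ_in_NQ by auto
  have "(\<Sum>x\<in>F. c x *s x) \<in> NQ" by (intro subspace_lattice_Q FN)
  moreover have "u (\<Sum>x\<in>F. c x *s x) = (\<Sum>x\<in>F. c x * u x)"
    using FN by (subst dual_Q_sum[OF uQ]) (auto simp: dual_Q_scale[OF uQ] subspace_lattice_Q)
  ultimately have "u ((\<Sum>x\<in>F. c x *s x) + y) = (\<Sum>x\<in>F. c x * u x) + u y"
    using y by (simp add: dual_Q_add[OF uQ] \<sigma>_eq)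
  moreover have "u y \<ge> 0" using u y by (simp add: dual_cone_def)
  moreover have "(\<Sum>x\<in>F. c x * u x) \<ge> (\<Sum>x\<in>F. c x * \<mu> u i)"
  proof (intro sum_mono mult_left_mono)
    fix x assume "x \<in> F"
    then show "0 \<le> c x" "\<mu> u i \<le> u x" using F dual_SQ_vertex[OF uQ] \<mu>_le by auto
  qed
  moreover have "(\<Sum>x\<in>F. c x * \<mu> u i) = \<mu> u i" by (simp add: sum_distrib_right[symmetric] F(4))
  ultimately show "\<mu> u i \<le> q" using q by linarith
qed

text \<open>Take a minimising vertex in each block. The sum of the three has block degree 1 in every
  block, so it lies in \<open>\<sigma>\<close> and is fixed by \<open>SQ\<close>.\<close>

lemma \<mu>_sum:
  assumes u: "u \<in> dual_Q N"
  shows "\<exists>v\<in>\<sigma>. (\<Sum>k\<in>UNIV. v $ k) > 0 \<and> (\<Sum>i\<in>UNIV. \<mu> u i) = u v"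
proof -
  obtain k where k: "\<And>i. blk (k i) = i" "\<And>i. \<mu> u i = wt u (k i) / of_nat (h (k i))"
    using \<mu>_attained[of _ u] by metis
  define v where "v = (\<Sum>i\<in>UNIV. vertex (k i))"
  have "bdeg j v = (\<Sum>i\<in>UNIV. bdeg j (vertex (k i)))" for j
    by (simp add: v_def bdeg_def sum_distrib_left) (rule sum.swap)
  then have "bdeg j v = 1" for j by (simp add: bdeg_vertex k)
  then have vN: "v \<in> NQ" by (simp add: NQ_iff)
  have nn: "0 \<le> v $ l" for l by (simp add: v_def sum_nonneg vertex_nonneg)
  have "v $ k Bl0 \<ge> vertex (k Bl0) $ k Bl0"
    unfolding v_def sum_component by (rule member_le_sum) (auto simp: vertex_nonneg)
  moreover have "vertex (k Bl0) $ k Bl0 > 0" using h_pos by (simp add: vertex_def axis_def)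
  ultimately have "(\<Sum>k\<in>UNIV. v $ k) > 0" using nn by (intro sum_pos2[of _ "k Bl0"]) auto
  moreover have "(\<Sum>i\<in>UNIV. \<mu> u i) = u v"
  proof -
    have "(\<Sum>i\<in>UNIV. \<mu> u i) = u (\<Sum>i\<in>UNIV. SQ (vertex (k i)))"
      by (subst dual_Q_sum[OF u]) (auto simp: SQ_in_NQ dual_SQ_vertex[OF u] k)
    also have "(\<Sum>i\<in>UNIV. SQ (vertex (k i))) = v"
      unfolding extend_Q_sum[symmetric] v_def[symmetric] using vN by (rule SQ_id)
    finally show ?thesis .
  qed
  ultimately show ?thesis using vN nn by (auto simp: \<sigma>_eq)
qed

lemma \<mu>_sum_nonneg: "u \<in> dual_cone N \<sigma> \<Longrightarrow> (\<Sum>i\<in>UNIV. \<mu> u i) \<ge> 0"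
  using \<mu>_sum[of u] by (auto simp: dual_cone_def)

text \<open>From a relatively interior \<open>u\<close> a small step against a functional
  \<open>u0\<close> that is positive on the nonzero vectors of \<open>\<sigma>\<close> stays in the
  dual cone. So \<open>u\<close> is at least \<open>t * u0\<close> on \<open>\<sigma>\<close>, hence
  positive at the vector found in \<open>\<mu>_sum\<close>.\<close>

lemma \<mu>_sum_pos:
  assumes u: "u \<in> relative_interior (dual_cone N \<sigma>)"
  shows "(\<Sum>i\<in>UNIV. \<mu> u i) > 0"
proof -
  let ?C = "dual_cone N \<sigma>"
  obtain B \<epsilon> where uC: "u \<in> ?C" and B: "finite B" "\<epsilon> > 0"
      "\<And>w. w \<in> qaffine_hull ?C \<Longrightarrow> (\<forall>v\<in>B. \<bar>w v - u v\<bar> < \<epsilon>) \<Longrightarrow> w \<in> ?C"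
    using u unfolding relative_interior_def by blast
  define u0 where "u0 v = (if v \<in> NQ then \<Sum>k\<in>UNIV. v $ k else 0)" for v :: "rat^'n"
  have "u0 = (\<lambda>v. \<Sum>k\<in>UNIV. coord k v)" by (auto simp: u0_def coord_def)
  then have u0: "u0 \<in> ?C"
    using coord_dual_cone by (auto simp: dual_cone_def dual_Q_def sum.distrib sum_distrib_left intro!: sum_nonneg)
  have zero: "(\<lambda>v. 0) \<in> ?C" by (simp add: dual_cone_def dual_Q_def)
  \<comment> \<open>This keeps the step below \<open>\<epsilon>\<close> at every test vector in
    \<open>B\<close>; the summand 1 prevents a zero denominator.\<close>
  define t where "t = \<epsilon> / (1 + (\<Sum>v\<in>B. \<bar>u0 v\<bar>))"
  have pos: "1 + (\<Sum>v\<in>B. \<bar>u0 v\<bar>) > 0" by (simp add: add_pos_nonneg sum_nonneg)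
  then have t: "t > 0" using B(2) by (simp add: t_def)
  define w where "w v = u v - t * u0 v" for v
  have "w \<in> qaffine_hull ?C"
  proof -
    define F where "F = {u, u0, \<lambda>v. 0}"
    \<comment> \<open>The zero functional only serves to make the coefficients add up to 1. Adding
      indicators stays correct if some of the three functionals coincide.\<close>
    define c where "c x = (if x = u then 1 else 0) + (if x = u0 then - t else 0)
      + (if x = (\<lambda>v. 0) then t else 0)" for x :: "rat^'n \<Rightarrow> rat"
    have F: "finite F" "u \<in> F" "u0 \<in> F" "(\<lambda>v. 0) \<in> F" by (auto simp: F_def)
    have c1: "(\<Sum>x\<in>F. c x) = 1" using F by (simp add: c_def sum.distrib)
    have "(\<Sum>x\<in>F. c x * x v) = w v" for v
    proof -
      have "(\<Sum>x\<in>F. c x * x v) = (\<Sum>x\<in>F. if x = u then u v else 0)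
        + (\<Sum>x\<in>F. if x = u0 then - t * u0 v else 0)"
        unfolding sum.distrib[symmetric] by (intro sum.cong) (auto simp: c_def algebra_simps)
      then show ?thesis using F by (simp add: w_def)
    qed
    then have "w = (\<lambda>v. \<Sum>x\<in>F. c x * x v)" by auto
    moreover have "F \<subseteq> ?C" using uC u0 zero by (simp add: F_def)
    ultimately show ?thesis unfolding qaffine_hull_def using F(1) c1 by blast
  qed
  moreover have "\<bar>w v - u v\<bar> < \<epsilon>" if "v \<in> B" for v
  proof -
    have "\<bar>u0 v\<bar> \<le> (\<Sum>v\<in>B. \<bar>u0 v\<bar>)" using B(1) that by (intro member_le_sum) auto
    then have "t * \<bar>u0 v\<bar> < t * (1 + (\<Sum>v\<in>B. \<bar>u0 v\<bar>))" using t by (intro mult_strict_left_mono) auto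
    also have "\<dots> = \<epsilon>" using pos by (simp add: t_def)
    finally show ?thesis using t by (simp add: w_def abs_mult)
  qed
  ultimately have wC: "w \<in> ?C" using B(3) by blast
  obtain v where v: "v \<in> \<sigma>" "(\<Sum>k\<in>UNIV. v $ k) > 0" "(\<Sum>i\<in>UNIV. \<mu> u i) = u v"
    using \<mu>_sum[of u] uC by (auto simp: dual_cone_def)
  have "u v = w v + t * u0 v" by (simp add: w_def)
  moreover have "w v \<ge> 0" using wC v(1) by (simp add: dual_cone_def)
  moreover have "u0 v > 0" using v by (simp add: u0_def \<sigma>_eq)
  ultimately show ?thesis using t v(3) by (simp add: add_nonneg_pos)
qed

end


section \<open>The section algebra and the coordinate ring\<close>

text \<open>The integers that \<open>a\<close> multiplies into the integers form an ideal, so Bezout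
  applies.\<close>

lemma Ints_mult_Gcd:
  fixes a :: rat
  assumes "finite A" "\<And>n. n \<in> A \<Longrightarrow> a * of_nat n \<in> \<int>"
  shows "a * of_nat (Gcd A) \<in> \<int>"
  using assms
proof (induction A rule: finite_induct)
  case (insert n A)
  obtain x y where "x * int n + y * int (Gcd A) = gcd (int n) (int (Gcd A))"
    using bezout_int by blast
  then have "of_nat (gcd n (Gcd A)) = (of_int (x * int n + y * int (Gcd A)) :: rat)"
    by (metis gcd_int_int_eq of_int_of_nat_eq)
  then have "a * of_nat (Gcd (insert n A)) = of_int x * (a * of_nat n) + of_int y * (a * of_nat (Gcd A))"
    by (simp add: algebra_simps)
  moreover have "a * of_nat n \<in> \<int>" "a * of_nat (Gcd A) \<in> \<int>" using insert by auto
  ultimately show ?case by (metis Ints_add Ints_mult Ints_of_int)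
qed simp

lemma poly_mapping_sum_single:
  "F = (\<Sum>u\<in>Poly_Mapping.keys F. Poly_Mapping.single u (Poly_Mapping.lookup F u))"
  by (rule poly_mapping_eqI) (simp add: lookup_sum lookup_single when_def in_keys_iff)

lemma generated_algebra_sum:
  "(\<And>i. i \<in> A \<Longrightarrow> f i \<in> generated_algebra G) \<Longrightarrow> (\<lambda>x. \<Sum>i\<in>A. f i x) \<in> generated_algebra G"
  by (induction A rule: infinite_finite_induct)
    (auto intro: generated_algebra.const generated_algebra.add)

lemma generated_algebra_power:
  "f \<in> generated_algebra G \<Longrightarrow> (\<lambda>x. f x ^ n) \<in> generated_algebra G"
  by (induction n) (auto intro: generated_algebra.const generated_algebra.mult)

lemma generated_algebra_prod:
  "(\<And>i. i \<in> A \<Longrightarrow> f i \<in> generated_algebra G) \<Longrightarrow> (\<lambda>x. \<Prod>i\<in>A. f i x) \<in> generated_algebra G"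
  by (induction A rule: infinite_finite_induct)
    (auto intro: generated_algebra.const generated_algebra.mult)

lemma generated_algebra_cmult:
  "f \<in> generated_algebra G \<Longrightarrow> (\<lambda>x. c * f x) \<in> generated_algebra G"
  using generated_algebra.mult[OF generated_algebra.const] .

lemma powi_sum:
  fixes s :: "'k::field"
  assumes "s \<noteq> 0"
  shows "(\<Prod>i\<in>B. s powi f i) = s powi (\<Sum>i\<in>B. f i)"
  by (induction B rule: infinite_finite_induct) (auto simp: power_int_add assms)

text \<open>In characteristic 0 the number 2 is not a root of unity. Hence the value at
  \<open>s = 2\<close> of a one-parameter subgroup already distinguishes all its weights.\<close>

lemma two_powi_inject:
  fixes a b :: int
  assumes "(2 :: 'k::field_char_0) powi a = 2 powi b"
  shows "a = b"
proof -
  have "c \<le> 0" if "(2 :: 'k) powi c = 1" for c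
  proof (rule ccontr)
    assume "\<not> c \<le> 0"
    then have "(2 :: 'k) ^ nat c = 1" using that by (simp add: power_int_def)
    then have "of_nat (2 ^ nat c) = (of_nat 1 :: 'k)" by simp
    then have "(2 :: nat) ^ nat c = 1" by (simp only: of_nat_eq_iff)
    then show False using \<open>\<not> c \<le> 0\<close> by simp
  qed
  moreover have "(2 :: 'k) powi (a - b) = 1" "(2 :: 'k) powi (b - a) = 1"
    using assms by (simp_all add: power_int_diff)
  ultimately have "a - b \<le> 0" "b - a \<le> 0" by blast+
  then show ?thesis by simp
qed

locale conic_lattice = block_lattice blk h N S
  for blk :: "'n::finite \<Rightarrow> block" and h N S +
  fixes \<iota> :: "'k::{alg_closed_field,field_char_0}"
  assumes \<iota>: "\<iota>\<^sup>2 = -1"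
    and coprime_blocks: "i \<noteq> j \<Longrightarrow> coprime (Gcd (h ` {k. blk k = i})) (Gcd (h ` {k. blk k = j}))"
begin

section \<open>The polyhedral divisor and its properness\<close>

definition \<DD> :: "('n, 'k) pdiv" where
  "\<DD> = [(\<Delta> Bl0, prime_div (Pt 1) + prime_div (Pt (-1))),
        (\<Delta> Bl1, prime_div (Pt \<iota>) + prime_div (Pt (-\<iota>))),
        (\<Delta> Bl2, prime_div (Pt 0) + prime_div Infty)]"

lemma lookup_pdiv_eval:
  assumes "u \<in> dual_cone N \<sigma>"
  shows "Poly_Mapping.lookup (pdiv_eval \<DD> u) z
    = (\<Sum>i\<in>UNIV. if z \<in> branch_points \<iota> i then \<mu> u i else 0)"
proof -
  have "\<iota> \<noteq> 0" using \<iota> by auto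
  have "(1::'k) \<noteq> -1" "\<iota> \<noteq> -\<iota>" using \<open>\<iota> \<noteq> 0\<close> by simp_all
  then show ?thesis
    by (simp add: pdiv_eval_def \<DD>_def sum_block lookup_add prime_div_def lookup_single when_def
        min_on_\<Delta>[OF assms])
qed

lemma degree_pdiv_eval:
  assumes "u \<in> dual_cone N \<sigma>"
  shows "qdiv_degree (pdiv_eval \<DD> u) = 2 * (\<Sum>i\<in>UNIV. \<mu> u i)"
  by (simp add: pdiv_eval_def \<DD>_def qdiv_degree_add qdiv_degree_prime_divs sum_block
      min_on_\<Delta>[OF assms] qdiv_degree_superset[of "{}" 0])

lemma pp_divisor_\<DD>: "pp_divisor N \<sigma> \<DD>"
  unfolding pp_divisor_def
proof (intro conjI ballI)
  show "polyhedral_cone_in N \<sigma>" by (rule polyhedral_cone_\<sigma>)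
  show "case p of (\<Delta>', D) \<Rightarrow> \<Delta>' \<noteq> {} \<and> polyhedron_in N \<Delta>' \<and> recession_cone \<Delta>' = \<sigma>"
    if "p \<in> set \<DD>" for p
    using that by (auto simp: \<DD>_def \<Delta>_nonempty polyhedron_\<Delta> recession_\<Delta>)
next
  fix u assume u: "u \<in> dual_cone N \<sigma>"
  show "q_cartier (pdiv_eval \<DD> u)" by (rule q_cartier_P1)
  show "semiample (pdiv_eval \<DD> u)"
    using u by (intro semiample_if_degree_nonneg) (simp add: degree_pdiv_eval \<mu>_sum_nonneg)
next
  fix u assume u: "u \<in> relative_interior (dual_cone N \<sigma>)"
  then have "u \<in> dual_cone N \<sigma>" by (simp add: relative_interior_def)
  then show "big (pdiv_eval \<DD> u)"
    using u by (intro big_if_degree_pos affine_open_P1_minus_Infty) (simp add: degree_pdiv_eval \<mu>_sum_pos)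
qed

text \<open>Only here the coprimality enters: it makes the lattice spanned by the differences of the three
  vectors of halved exponents (each extended by zero to the other blocks) saturated.\<close>

lemma annihilator_N:
  fixes m :: "'n \<Rightarrow> int"
  assumes m: "\<And>v. v \<in> N \<Longrightarrow> (\<Sum>k\<in>UNIV. m k * v $ k) = 0"
  shows "\<exists>y :: block \<Rightarrow> int. (\<forall>k. m k = y (blk k) * int (h k)) \<and> (\<Sum>i\<in>UNIV. y i) = 0"
proof -
  \<comment> \<open>Over the rationals the relation can be tested on combinations of the vectors
    \<open>vertex k\<close>.\<close>
  have mQ: "(\<Sum>k\<in>UNIV. of_int (m k) * v $ k) = 0" if "v \<in> NQ" for v
    using that unfolding lattice_Q_def
  proof (induction rule: vec.span_induct_alt)
    case (step c x y)
    then obtain w where w: "w \<in> N" "x = rat_vec w" by blast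
    have "(\<Sum>k\<in>UNIV. of_int (m k) * x $ k) = of_int (\<Sum>k\<in>UNIV. m k * w $ k)" by (simp add: w)
    also have "\<dots> = 0" using m w by simp
    finally have x0: "(\<Sum>k\<in>UNIV. of_int (m k) * x $ k) = 0" .
    have "(\<Sum>k\<in>UNIV. of_int (m k) * (c *s x + y) $ k)
        = c * (\<Sum>k\<in>UNIV. of_int (m k) * x $ k) + (\<Sum>k\<in>UNIV. of_int (m k) * y $ k)"
      by (simp add: sum_distrib_left sum.distrib algebra_simps)
    then show ?case using x0 step by simp
  qed simp
  obtain \<rho> where \<rho>: "\<And>i. blk (\<rho> i) = i" using blk_surj by metis
  \<comment> \<open>The coefficient of the block degree form, a priori only rational. Differences of
    vertices in one block show that it depends on the block alone; a sum of three vertices, one from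
    each block, shows that the coefficients add up to zero.\<close>
  define a :: "block \<Rightarrow> rat" where "a i = of_int (m (\<rho> i)) / of_nat (h (\<rho> i))" for i
  have mv: "(\<Sum>k\<in>UNIV. of_int (m k) * vertex l $ k) = of_int (m l) / of_nat (h l)" for l
  proof -
    have "(\<Sum>k\<in>UNIV. of_int (m k) * vertex l $ k)
        = (\<Sum>k\<in>UNIV. if k = l then of_int (m l) / of_nat (h l) else 0)"
      by (intro sum.cong) (auto simp: vertex_def axis_def)
    then show ?thesis by simp
  qed
  have ma: "of_int (m k) = a (blk k) * of_nat (h k)" for k
  proof -
    have "vertex k - vertex (\<rho> (blk k)) \<in> NQ" by (simp add: NQ_iff bdeg_diff bdeg_vertex \<rho>)
    from mQ[OF this] have "of_int (m k) / of_nat (h k) = a (blk k)"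
      using mv by (simp add: a_def right_diff_distrib sum_subtractf)
    then show ?thesis by (simp add: field_simps)
  qed
  have asum: "(\<Sum>i\<in>UNIV. a i) = 0"
  proof -
    have "(\<Sum>i\<in>UNIV. vertex (\<rho> i)) \<in> NQ"
      by (simp add: NQ_iff sum_block bdeg_add bdeg_vertex \<rho>) (metis (full_types) block.exhaust block.distinct)
    from mQ[OF this] show ?thesis
      using mv by (simp add: sum_block a_def distrib_left sum.distrib)
  qed
  define e where "e i = Gcd (h ` {k. blk k = i})" for i
  have ae: "a i * of_nat (e i) \<in> \<int>" for i
    unfolding e_def by (intro Ints_mult_Gcd) (auto simp: ma[symmetric])
  \<comment> \<open>Both \<open>a i * e i\<close> and, as \<open>a i = - a j - a l\<close>, also
    \<open>a i * e j * e l\<close> are integral. The two multipliers are coprime.\<close>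
  have aint: "a i \<in> \<int>" if ij: "i \<noteq> j" "i \<noteq> l" "j \<noteq> l" for i j l
  proof -
    have "a i = - a j - a l" using asum ij
      by (cases i; cases j; cases l) (simp_all add: sum_block)
    then have "a i * of_nat (e j * e l)
        = - (a j * of_nat (e j) * of_nat (e l)) - a l * of_nat (e l) * of_nat (e j)"
      by (simp only:) (simp add: algebra_simps)
    also have "\<dots> \<in> \<int>"
      by (intro Ints_diff Ints_minus Ints_mult[OF ae Ints_of_nat])
    finally have "a i * of_nat (Gcd {e i, e j * e l}) \<in> \<int>"
      using ae by (intro Ints_mult_Gcd) auto
    moreover have "coprime (e i) (e j * e l)"
      using coprime_blocks ij by (simp add: e_def)
    ultimately show ?thesis by simp
  qed
  have aZ: "a i \<in> \<int>" for i
    using aint[of Bl0 Bl1 Bl2] aint[of Bl1 Bl0 Bl2] aint[of Bl2 Bl0 Bl1] by (cases i) auto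
  define y where "y i = \<lfloor>a i\<rfloor>" for i
  have y: "a i = of_int (y i)" for i using aZ[of i] by (auto simp: y_def elim: Ints_cases)
  have "m k = y (blk k) * int (h k)" for k
    using ma[of k] unfolding y by (metis of_int_eq_iff of_int_mult of_int_of_nat_eq)
  moreover have "(\<Sum>i\<in>UNIV. y i) = 0"
    using asum unfolding y by (metis of_int_0_eq_iff of_int_sum)
  ultimately show ?thesis by blast
qed

section \<open>Integral weights and rounded block minima\<close>

abbreviation "MC \<equiv> dual_cone N \<sigma> \<inter> dual_lattice N"

text \<open>On the dual lattice \<open>wt u k\<close> is already an integer and the floor only
  changes the type. In \<open>\<alpha>\<close> below the floor really rounds.\<close>

definition iwt :: "(rat^'n \<Rightarrow> rat) \<Rightarrow> 'n \<Rightarrow> int" where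
  "iwt u k = \<lfloor>wt u k\<rfloor>"

definition \<alpha> :: "(rat^'n \<Rightarrow> rat) \<Rightarrow> block \<Rightarrow> int" where
  "\<alpha> u i = \<lfloor>\<mu> u i\<rfloor>"

definition sdeg :: "(rat^'n \<Rightarrow> rat) \<Rightarrow> int" where
  "sdeg u = (\<Sum>i\<in>UNIV. \<alpha> u i)"

lemma dual_lattice_dual_Q: "u \<in> dual_lattice N \<Longrightarrow> u \<in> dual_Q N"
  by (simp add: dual_lattice_def)

lemma iwt: "u \<in> dual_lattice N \<Longrightarrow> of_int (iwt u k) = wt u k"
  using S_range by (auto simp: iwt_def wt_def dual_lattice_def elim!: Ints_cases)

lemma \<alpha>_le:
  assumes "u \<in> dual_lattice N"
  shows "\<alpha> u (blk k) * int (h k) \<le> iwt u k"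
proof -
  have "of_int (\<alpha> u (blk k)) \<le> wt u k / of_nat (h k)"
    using \<mu>_le[OF refl, of u k] of_int_floor_le[of "\<mu> u (blk k)"] unfolding \<alpha>_def by linarith
  then have "of_int (\<alpha> u (blk k)) * of_nat (h k) \<le> wt u k"
    using h_pos[of k] by (simp add: pos_le_divide_eq)
  then have "of_int (\<alpha> u (blk k) * int (h k)) \<le> (of_int (iwt u k) :: rat)"
    by (simp add: iwt[OF assms])
  then show ?thesis by (simp only: of_int_le_iff)
qed

text \<open>An integer that is at most \<open>wt u k / h k\<close> throughout the block is at most
  the floor of the minimum. This maximality gives superadditivity and, later, nonnegative exponents
  when a coordinate function is written as a section.\<close>

lemma \<alpha>_greatest:
  assumes "u \<in> dual_lattice N" "\<And>k. blk k = i \<Longrightarrow> y * int (h k) \<le> iwt u k"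
  shows "y \<le> \<alpha> u i"
proof -
  obtain k where k: "blk k = i" "\<mu> u i = wt u k / of_nat (h k)" using \<mu>_attained by blast
  have "of_int (y * int (h k)) \<le> (of_int (iwt u k) :: rat)"
    using assms(2)[OF k(1)] by (simp only: of_int_le_iff)
  then have "of_int y \<le> \<mu> u i"
    using h_pos[of k] by (simp add: k(2) pos_le_divide_eq iwt[OF assms(1)])
  then show ?thesis by (simp add: \<alpha>_def le_floor_iff)
qed

lemma dual_lattice_add: "u \<in> dual_lattice N \<Longrightarrow> v \<in> dual_lattice N \<Longrightarrow> u + v \<in> dual_lattice N"
  by (simp add: dual_lattice_def dual_Q_def algebra_simps)

lemma MC_add: "u \<in> MC \<Longrightarrow> v \<in> MC \<Longrightarrow> u + v \<in> MC"
  by (simp add: dual_lattice_def dual_cone_def dual_Q_def algebra_simps)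

lemma MC_0: "0 \<in> MC"
  by (simp add: dual_lattice_def dual_cone_def dual_Q_def)

lemma iwt_add:
  assumes "u \<in> dual_lattice N" "v \<in> dual_lattice N"
  shows "iwt (u + v) k = iwt u k + iwt v k"
proof -
  have "of_int (iwt (u + v) k) = (of_int (iwt u k + iwt v k) :: rat)"
    using assms by (simp add: iwt dual_lattice_add) (simp add: wt_def)
  then show ?thesis by (simp only: of_int_eq_iff)
qed

lemma \<alpha>_superadditive:
  assumes "u \<in> dual_lattice N" "v \<in> dual_lattice N"
  shows "\<alpha> u i + \<alpha> v i \<le> \<alpha> (u + v) i"
proof (rule \<alpha>_greatest)
  fix k assume "blk k = i"
  then show "(\<alpha> u i + \<alpha> v i) * int (h k) \<le> iwt (u + v) k"
    using \<alpha>_le[OF assms(1), of k] \<alpha>_le[OF assms(2), of k] by (simp add: iwt_add assms distrib_right)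
qed (simp add: dual_lattice_add assms)

text \<open>The \<open>iwt u k\<close> are the coordinates of the functional \<open>u\<close>
  composed with \<open>S\<close> on the ambient lattice, and \<open>S\<close> is the identity on
  \<open>N\<close>.\<close>

lemma iwt_pairing:
  assumes "u \<in> dual_lattice N" "v \<in> N"
  shows "of_int (\<Sum>k\<in>UNIV. iwt u k * v $ k) = u (rat_vec v)"
proof -
  have uQ: "u \<in> dual_Q N" using assms(1) by (rule dual_lattice_dual_Q)
  have "u (rat_vec v) = u (SQ (rat_vec v))"
    by (simp add: SQ_id rat_vec_in_lattice_Q assms(2))
  also have "\<dots> = (\<Sum>k\<in>UNIV. rat_vec v $ k * wt u k)"
    unfolding extend_Q_def wt_def
    by (subst dual_Q_sum[OF uQ])
      (auto simp: dual_Q_scale[OF uQ] rat_vec_in_lattice_Q S_range subspace_lattice_Q)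
  finally show ?thesis using assms(1) by (simp add: iwt[symmetric] mult.commute)
qed

lemma dual_lattice_eqI:
  assumes "u \<in> dual_lattice N" "v \<in> dual_lattice N" "\<And>w. w \<in> N \<Longrightarrow> u (rat_vec w) = v (rat_vec w)"
  shows "u = v"
proof
  fix x
  have uQ: "u \<in> dual_Q N" "v \<in> dual_Q N" using assms dual_lattice_dual_Q by auto
  show "u x = v x"
  proof (cases "x \<in> NQ")
    case True
    have "iwt u k = iwt v k" for k using assms(3)[OF S_range] by (simp add: iwt_def wt_def)
    then have wt: "wt u = wt v" using iwt assms(1,2) by (metis ext)
    have *: "u x = (\<Sum>k\<in>UNIV. x $ k * wt u k)" if "u \<in> dual_Q N" for u
    proof -
      have "u x = u (SQ x)" using True by (simp add: SQ_id)
      also have "\<dots> = (\<Sum>k\<in>UNIV. x $ k * wt u k)"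
        unfolding extend_Q_def wt_def
        by (subst dual_Q_sum[OF that])
          (auto simp: dual_Q_scale[OF that] rat_vec_in_lattice_Q S_range subspace_lattice_Q)
      finally show ?thesis .
    qed
    show ?thesis using wt *[OF uQ(1)] *[OF uQ(2)] by simp
  next
    case False
    then show ?thesis using uQ by (simp add: dual_Q_def)
  qed
qed


subsection \<open>Homogeneous components as polynomials\<close>

abbreviation "base u \<equiv> base_section \<iota> (\<alpha> u)"

definition numer :: "(rat^'n \<Rightarrow> rat) \<Rightarrow> 'k ratfun \<Rightarrow> 'k poly" where
  "numer u f = (THE g. f = Fract g 1 * base u)"

text \<open>The rounded degree \<open>sdeg u\<close> can be negative, in which case zero is the only
  section; hence the separate case \<open>g = 0\<close>.\<close>

definition is_section :: "(rat^'n \<Rightarrow> rat) \<Rightarrow> 'k ratfun \<Rightarrow> bool" where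
  "is_section u f \<longleftrightarrow> (\<exists>g. f = Fract g 1 * base u \<and> (g = 0 \<or> int (degree g) \<le> 2 * sdeg u))"

lemma base_nonzero: "base u \<noteq> 0"
  using \<iota> by (rule base_section_nonzero)

lemma numer_eqI: "f = Fract g 1 * base u \<Longrightarrow> numer u f = g"
  unfolding numer_def by (rule the_equality) (auto simp: base_nonzero eq_fract)

text \<open>Passing to \<open>nat (sdeg u)\<close> forgets a negative sign; the last clause records
  that a nonzero numerator excludes it.\<close>

lemma is_sectionE:
  assumes "is_section u f"
  obtains g where "f = Fract g 1 * base u" "numer u f = g" "degree g \<le> 2 * nat (sdeg u)"
    "g \<noteq> 0 \<longrightarrow> 0 \<le> sdeg u"
proof -
  obtain g where g: "f = Fract g 1 * base u" "g = 0 \<or> int (degree g) \<le> 2 * sdeg u"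
    using assms by (auto simp: is_section_def)
  show ?thesis using g by (intro that[of g]) (auto simp: numer_eqI)
qed

lemma is_sectionI:
  "f = Fract g 1 * base u \<Longrightarrow> degree g \<le> 2 * nat (sdeg u) \<Longrightarrow> (g \<noteq> 0 \<Longrightarrow> 0 \<le> sdeg u) \<Longrightarrow> is_section u f"
  unfolding is_section_def by (rule exI[of _ g], cases "g = 0") (auto dest: of_nat_mono[where 'a = int])

lemma is_section_0: "is_section u 0"
  by (rule is_sectionI[of _ 0]) (auto simp: Zero_fract_def)

lemma numer_0 [simp]: "numer u 0 = 0"
  by (rule numer_eqI) simp

lemma is_section_add:
  assumes "is_section u f" "is_section u f'"
  shows "is_section u (f + f')" "numer u (f + f') = numer u f + numer u f'"
proof -
  obtain g where g: "f = Fract g 1 * base u" "numer u f = g" "degree g \<le> 2 * nat (sdeg u)"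
    "g \<noteq> 0 \<longrightarrow> 0 \<le> sdeg u" using assms(1) by (rule is_sectionE)
  obtain g' where g': "f' = Fract g' 1 * base u" "numer u f' = g'" "degree g' \<le> 2 * nat (sdeg u)"
    "g' \<noteq> 0 \<longrightarrow> 0 \<le> sdeg u" using assms(2) by (rule is_sectionE)
  have e: "f + f' = Fract (g + g') 1 * base u"
    unfolding g(1) g'(1) by (simp add: distrib_right[symmetric])
  show "is_section u (f + f')"
    using g g' by (intro is_sectionI[OF e] degree_add_le) auto
  show "numer u (f + f') = numer u f + numer u f'" using numer_eqI[OF e] g g' by simp
qed

lemma is_section_cmult:
  assumes "is_section u f"
  shows "is_section u (Fract [:c:] 1 * f)" "numer u (Fract [:c:] 1 * f) = smult c (numer u f)"
proof -
  obtain g where g: "f = Fract g 1 * base u" "numer u f = g" "degree g \<le> 2 * nat (sdeg u)"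
    "g \<noteq> 0 \<longrightarrow> 0 \<le> sdeg u" using assms(1) by (rule is_sectionE)
  have e: "Fract [:c:] 1 * f = Fract (smult c g) 1 * base u"
    unfolding g(1) mult.assoc[symmetric] by simp
  show "is_section u (Fract [:c:] 1 * f)" using g by (intro is_sectionI[OF e]) auto
  show "numer u (Fract [:c:] 1 * f) = smult c (numer u f)" using numer_eqI[OF e] g by simp
qed

definition branch_monomial :: "(block \<Rightarrow> nat) \<Rightarrow> 'k poly" where
  "branch_monomial \<delta> = (\<Prod>i\<in>UNIV. branch_poly \<iota> i ^ \<delta> i)"

lemma degree_branch_monomial: "degree (branch_monomial \<delta>) \<le> 2 * (\<Sum>i\<in>UNIV. \<delta> i)"
proof -
  have "degree (branch_poly \<iota> i ^ \<delta> i) \<le> 2 * \<delta> i" for i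
    using degree_power_le[of "branch_poly \<iota> i" "\<delta> i"] degree_branch_poly[of \<iota> i]
    by (meson le_trans mult_le_mono1)
  then have "(\<Sum>i\<in>UNIV. degree (branch_poly \<iota> i ^ \<delta> i)) \<le> (\<Sum>i\<in>UNIV. 2 * \<delta> i)" by (intro sum_mono)
  moreover have "degree (branch_monomial \<delta>) \<le> (\<Sum>i\<in>UNIV. degree (branch_poly \<iota> i ^ \<delta> i))"
    unfolding branch_monomial_def using degree_prod_sum_le[of UNIV "\<lambda>i. branch_poly \<iota> i ^ \<delta> i"]
    by (simp add: o_def)
  ultimately show ?thesis by (simp add: sum_distrib_left)
qed

lemma homogenize_branch_monomial:
  "homogenize (2 * (\<Sum>i\<in>UNIV. \<delta> i)) (branch_monomial \<delta>) s t = (\<Prod>i\<in>UNIV. branch_form \<iota> i s t ^ \<delta> i)"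
proof -
  have d: "degree (branch_poly \<iota> i ^ n) \<le> n * 2" for i n
    using degree_power_le[of "branch_poly \<iota> i" n] degree_branch_poly[of \<iota> i]
    by (metis (no_types, lifting) le_trans mult.commute mult_le_mono1)
  have h: "homogenize (n * 2) (branch_poly \<iota> i ^ n) s t = branch_form \<iota> i s t ^ n" for i n
    by (simp add: homogenize_power degree_branch_poly homogenize_branch_poly)
  have e: "2 * (\<Sum>i\<in>UNIV. \<delta> i) = \<delta> Bl0 * 2 + \<delta> Bl1 * 2 + \<delta> Bl2 * 2" by (simp add: sum_block)
  have d2: "degree (branch_poly \<iota> Bl0 ^ \<delta> Bl0 * branch_poly \<iota> Bl1 ^ \<delta> Bl1) \<le> \<delta> Bl0 * 2 + \<delta> Bl1 * 2"
    by (rule order_trans[OF degree_mult_le]) (intro add_mono d)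
  show ?thesis
    unfolding e branch_monomial_def prod_block
    by (simp only: homogenize_mult[OF d2 d] homogenize_mult[OF d d] h)
qed

lemma Fract_mult_1: "Fract (p * q) 1 = Fract p 1 * Fract q 1" for p q :: "'k poly"
  by simp

lemma Fract_prod: "Fract (\<Prod>i\<in>A. f i) 1 = (\<Prod>i\<in>A. Fract (f i) 1)" for f :: "'i \<Rightarrow> 'k poly"
  by (induction A rule: infinite_finite_induct) (simp_all add: Fract_mult_1 One_fract_def del: mult_fract)

lemma Fract_power: "Fract (p ^ n) 1 = Fract p 1 ^ n" for p :: "'k poly"
  by (induction n) (simp_all add: Fract_mult_1 One_fract_def del: mult_fract)

lemma base_shift:
  assumes "\<And>i. \<alpha>' i = \<alpha>0 i + int (\<delta> i)"
  shows "base_section \<iota> \<alpha>0 = Fract (branch_monomial \<delta>) 1 * base_section \<iota> \<alpha>'"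
proof -
  have "Fract (branch_poly \<iota> i) 1 powi (- \<alpha>0 i)
      = Fract (branch_poly \<iota> i) 1 ^ \<delta> i * Fract (branch_poly \<iota> i) 1 powi (- \<alpha>' i)" for i
    using branch_poly_nonzero[OF \<iota>, of i] unfolding assms
    by (simp add: power_int_of_nat[symmetric] power_int_add[symmetric] del: power_int_of_nat)
  then show ?thesis
    unfolding base_section_def branch_monomial_def Fract_prod Fract_power prod.distrib[symmetric] by simp
qed

lemma base_add: "base_section \<iota> (\<lambda>i. \<alpha>0 i + \<alpha>' i) = base_section \<iota> \<alpha>0 * base_section \<iota> \<alpha>'"
  using branch_poly_nonzero[OF \<iota>] unfolding base_section_def prod.distrib[symmetric]
  by (intro prod.cong refl) (simp add: power_int_add[symmetric] add.commute)

text \<open>The amount by which rounding down fails to be additive. Writing a product of sections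
  over \<open>base (u + v)\<close> puts the powers of the branch polynomials with these exponents
  into the numerator; on the other side \<open>mon_mult\<close> splits off the same powers of the
  \<open>A i\<close>.\<close>

definition excess :: "(rat^'n \<Rightarrow> rat) \<Rightarrow> (rat^'n \<Rightarrow> rat) \<Rightarrow> block \<Rightarrow> nat" where
  "excess u v i = nat (\<alpha> (u + v) i - \<alpha> u i - \<alpha> v i)"

lemma excess:
  assumes "u \<in> dual_lattice N" "v \<in> dual_lattice N"
  shows "\<alpha> (u + v) i = \<alpha> u i + \<alpha> v i + int (excess u v i)"
    and "sdeg (u + v) = sdeg u + sdeg v + int (\<Sum>i\<in>UNIV. excess u v i)"
proof -
  show a: "\<alpha> (u + v) i = \<alpha> u i + \<alpha> v i + int (excess u v i)" for i
    using \<alpha>_superadditive[OF assms, of i] by (simp add: excess_def)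
  show "sdeg (u + v) = sdeg u + sdeg v + int (\<Sum>i\<in>UNIV. excess u v i)"
    unfolding sdeg_def a by (simp add: sum.distrib)
qed

lemma nat_sdeg_add:
  assumes "u \<in> dual_lattice N" "v \<in> dual_lattice N" "0 \<le> sdeg u" "0 \<le> sdeg v"
  shows "nat (sdeg (u + v)) = nat (sdeg u) + nat (sdeg v) + (\<Sum>i\<in>UNIV. excess u v i)"
  using assms(3,4) excess(2)[OF assms(1,2)] by linarith

lemma is_section_mult:
  assumes uv: "u \<in> dual_lattice N" "v \<in> dual_lattice N"
    and f: "is_section u f" "is_section v f'"
  shows "is_section (u + v) (f * f')"
    and "numer (u + v) (f * f') = numer u f * numer v f' * branch_monomial (excess u v)"
proof -
  obtain g where g: "f = Fract g 1 * base u" "numer u f = g" "degree g \<le> 2 * nat (sdeg u)"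
    "g \<noteq> 0 \<longrightarrow> 0 \<le> sdeg u" using f(1) by (rule is_sectionE)
  obtain g' where g': "f' = Fract g' 1 * base v" "numer v f' = g'" "degree g' \<le> 2 * nat (sdeg v)"
    "g' \<noteq> 0 \<longrightarrow> 0 \<le> sdeg v" using f(2) by (rule is_sectionE)
  let ?b = "branch_monomial (excess u v)"
  have "base u * base v = Fract ?b 1 * base (u + v)"
    unfolding base_add[symmetric] by (rule base_shift) (simp add: excess uv)
  moreover have "f * f' = Fract g 1 * Fract g' 1 * (base u * base v)"
    unfolding g(1) g'(1) by (simp only: mult_ac)
  ultimately have e: "f * f' = Fract (g * g' * ?b) 1 * base (u + v)"
    by (simp only: Fract_mult_1 mult.assoc)
  show "numer (u + v) (f * f') = numer u f * numer v f' * ?b" using numer_eqI[OF e] g g' by simp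
  show "is_section (u + v) (f * f')"
  proof (rule is_sectionI[OF e])
    show "0 \<le> sdeg (u + v)" if "g * g' * ?b \<noteq> 0"
      using that g(4) g'(4) unfolding excess(2)[OF uv] by (auto intro!: add_nonneg_nonneg sum_nonneg)
    show "degree (g * g' * ?b) \<le> 2 * nat (sdeg (u + v))"
    proof (cases "g = 0 \<or> g' = 0")
      case False
      have "degree (g * g' * ?b) \<le> degree g + degree g' + degree ?b"
        by (meson add_le_mono1 degree_mult_le le_trans)
      also have "\<dots> \<le> 2 * nat (sdeg u) + 2 * nat (sdeg v) + 2 * (\<Sum>i\<in>UNIV. excess u v i)"
        by (intro add_mono g g' degree_branch_monomial)
      also have "\<dots> = 2 * nat (sdeg (u + v))"
        using nat_sdeg_add[OF uv] False g(4) g'(4) by simp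
      finally show ?thesis .
    qed auto
  qed
qed

text \<open>Orders are integers, so the coefficients of the divisor may be rounded down, after which
  \<open>sections_eq_polys\<close> applies.\<close>

lemma div_sections_eq:
  assumes u: "u \<in> MC"
  shows "div_sections (pdiv_eval \<DD> u) = {f. is_section u f}"
proof (intro set_eqI)
  fix f :: "'k ratfun"
  show "f \<in> div_sections (pdiv_eval \<DD> u) \<longleftrightarrow> f \<in> {f. is_section u f}"
  proof (cases "f = 0")
    case True
    then show ?thesis by (simp add: div_sections_def is_section_0)
  next
    case False
    have "(of_int (ord_at z f) + Poly_Mapping.lookup (pdiv_eval \<DD> u) z \<ge> 0) \<longleftrightarrow>
        (ord_at z f + (\<Sum>i\<in>UNIV. if z \<in> branch_points \<iota> i then \<alpha> u i else 0) \<ge> 0)" for z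
    proof (cases "\<exists>i. z \<in> branch_points \<iota> i")
      case True
      then obtain i where i: "z \<in> branch_points \<iota> i" by blast
      \<comment> \<open>Only one block contributes at \<open>z\<close>, so rounding the coefficient
        of the divisor is the same as rounding the minimum of that block.\<close>
      have iff: "z \<in> branch_points \<iota> j \<longleftrightarrow> j = i" for j
        using branch_points_disjoint[OF \<iota>] i by blast
      have "(\<Sum>j\<in>UNIV. if j = i then F j else 0) = F i" for F :: "block \<Rightarrow> 'z::comm_monoid_add"
        by simp
      moreover have "0 \<le> of_int (ord_at z f) + \<mu> u i \<longleftrightarrow> 0 \<le> ord_at z f + \<lfloor>\<mu> u i\<rfloor>"
        by linarith
      ultimately show ?thesis using u by (simp add: lookup_pdiv_eval iff \<alpha>_def)
    next
      case False
      then show ?thesis using u by (simp add: lookup_pdiv_eval)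
    qed
    then have "f \<in> div_sections (pdiv_eval \<DD> u) \<longleftrightarrow>
        (\<forall>z. ord_at z f + (\<Sum>i\<in>UNIV. if z \<in> branch_points \<iota> i then \<alpha> u i else 0) \<ge> 0)"
      using False by (simp add: div_sections_def)
    also have "\<dots> \<longleftrightarrow> (\<exists>g. g \<noteq> 0 \<and> int (degree g) \<le> 2 * sdeg u \<and> f = Fract g 1 * base u)"
      unfolding sdeg_def by (rule sections_eq_polys[OF \<iota> False])
    also have "\<dots> \<longleftrightarrow> is_section u f"
      using False unfolding is_section_def by auto
    finally show ?thesis by simp
  qed
qed

section \<open>Closure properties of the section algebra\<close>

abbreviation "SA \<equiv> section_algebra N \<sigma> \<DD>"

lemma SA_iff: "F \<in> SA \<longleftrightarrow> Poly_Mapping.keys F \<subseteq> MC \<and>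
    (\<forall>u\<in>Poly_Mapping.keys F. is_section u (Poly_Mapping.lookup F u))"
proof -
  have "Poly_Mapping.lookup F u \<in> div_sections (pdiv_eval \<DD> u) \<longleftrightarrow> is_section u (Poly_Mapping.lookup F u)"
    if "Poly_Mapping.keys F \<subseteq> MC" "u \<in> Poly_Mapping.keys F" for u
  proof -
    have "u \<in> MC" using that by blast
    then show ?thesis by (simp only: div_sections_eq mem_Collect_eq)
  qed
  then show ?thesis unfolding section_algebra_def by blast
qed

lemma SA_keys: "F \<in> SA \<Longrightarrow> u \<in> Poly_Mapping.keys F \<Longrightarrow> u \<in> MC"
  by (auto simp: SA_iff)

lemma SA_section: "F \<in> SA \<Longrightarrow> is_section u (Poly_Mapping.lookup F u)"
  by (cases "u \<in> Poly_Mapping.keys F") (auto simp: SA_iff in_keys_iff is_section_0)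

lemma SA_0: "0 \<in> SA"
  by (simp add: SA_iff)

lemma SA_add:
  assumes "F \<in> SA" "G \<in> SA"
  shows "F + G \<in> SA"
  unfolding SA_iff
proof (intro conjI ballI)
  show "Poly_Mapping.keys (F + G) \<subseteq> MC"
    using keys_add[of F G] assms SA_keys by blast
  show "is_section u (Poly_Mapping.lookup (F + G) u)" for u
    unfolding lookup_add using assms by (intro is_section_add SA_section)
qed

lemma SA_sum: "(\<And>i. i \<in> A \<Longrightarrow> F i \<in> SA) \<Longrightarrow> (\<Sum>i\<in>A. F i) \<in> SA"
  by (induction A rule: infinite_finite_induct) (auto simp: SA_0 SA_add)

lemma SA_single: "u \<in> MC \<Longrightarrow> is_section u f \<Longrightarrow> Poly_Mapping.single u f \<in> SA"
  by (auto simp: SA_iff split: if_splits)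

section \<open>The ring homomorphism from sections to functions on the hypersurface\<close>

definition A :: "block \<Rightarrow> 'k^'n \<Rightarrow> 'k" where
  "A i x = (\<Prod>k | blk k = i. (x $ k) ^ h k)"

definition X :: "('k^'n) set" where
  "X = {x. (\<Sum>i\<in>UNIV. (A i x)\<^sup>2) = 0}"

text \<open>The monomial with exponents \<open>iwt u k\<close> after the largest possible powers of
  the \<open>A i\<close> (possibly negative ones) are taken out. By \<open>\<alpha>_le\<close> the
  exponents are nonnegative for \<open>u\<close> in the dual lattice, so \<open>nat\<close>
  truncates nothing.\<close>

definition mon :: "(rat^'n \<Rightarrow> rat) \<Rightarrow> 'k^'n \<Rightarrow> 'k" where
  "mon u x = (\<Prod>k\<in>UNIV. (x $ k) ^ nat (iwt u k - \<alpha> u (blk k) * int (h k)))"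

definition comp :: "(rat^'n \<Rightarrow> rat) \<Rightarrow> 'k ratfun \<Rightarrow> 'k^'n \<Rightarrow> 'k" where
  "comp u f x = mon u x * conic_form \<iota> (nat (sdeg u)) (numer u f) (\<lambda>i. A i x)"

definition \<psi> :: "((rat^'n \<Rightarrow> rat) \<Rightarrow>\<^sub>0 'k ratfun) \<Rightarrow> 'k^'n \<Rightarrow> 'k" where
  "\<psi> F x = (if x \<in> X then \<Sum>u\<in>Poly_Mapping.keys F. comp u (Poly_Mapping.lookup F u) x else 0)"

lemma X_parametrization:
  assumes "x \<in> X"
  obtains s t where "(\<lambda>i. A i x) = (\<lambda>i. branch_form \<iota> i s t)"
  using conic_parametrization[OF _ \<iota>, of "\<lambda>i. A i x"] assms by (auto simp: X_def fun_eq_iff)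

lemma conic_form_add: "conic_form \<iota> d (g + g') a = conic_form \<iota> d g a + conic_form \<iota> d g' a"
  by (simp add: conic_form_def sum.distrib algebra_simps)

lemma conic_form_smult: "conic_form \<iota> d (smult c g) a = c * conic_form \<iota> d g a"
  by (simp add: conic_form_def sum_distrib_left mult.assoc)

lemma comp_0 [simp]: "comp u 0 x = 0"
  by (simp add: comp_def conic_form_def)

lemma comp_add: "is_section u f \<Longrightarrow> is_section u f' \<Longrightarrow> comp u (f + f') x = comp u f x + comp u f' x"
  by (simp add: comp_def is_section_add conic_form_add distrib_left)

lemma comp_cmult: "is_section u f \<Longrightarrow> comp u (Fract [:c:] 1 * f) x = c * comp u f x"
  by (simp add: comp_def is_section_cmult conic_form_smult)

lemma prod_by_block: "(\<Prod>i\<in>UNIV. \<Prod>k | blk k = i. f k) = (\<Prod>k\<in>UNIV. f k)"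
  for f :: "'n \<Rightarrow> 'z::comm_monoid_mult"
  using prod.group[of "UNIV :: 'n set" "UNIV :: block set" blk f] by simp

lemma sum_by_block: "(\<Sum>i\<in>UNIV. \<Sum>k | blk k = i. f k) = (\<Sum>k\<in>UNIV. f k)"
  for f :: "'n \<Rightarrow> 'z::comm_monoid_add"
  using sum.group[of "UNIV :: 'n set" "UNIV :: block set" blk f] by simp

lemma prod_A_power: "(\<Prod>i\<in>UNIV. A i x ^ \<delta> i) = (\<Prod>k\<in>UNIV. (x $ k) ^ (\<delta> (blk k) * h k))"
proof -
  have *: "A i x ^ \<delta> i = (\<Prod>k | blk k = i. (x $ k) ^ (\<delta> (blk k) * h k))" for i
    unfolding A_def prod_power_distrib by (intro prod.cong) (auto simp: power_mult[symmetric] mult.commute)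
  show ?thesis by (simp only: * prod_by_block)
qed

lemma mon_mult:
  assumes "u \<in> dual_lattice N" "v \<in> dual_lattice N"
  shows "mon u x * mon v x = mon (u + v) x * (\<Prod>i\<in>UNIV. A i x ^ excess u v i)"
  unfolding prod_A_power mon_def prod.distrib[symmetric] power_add[symmetric]
proof (intro prod.cong refl arg_cong2[of _ _ _ _ "(^)"])
  fix k
  have "int (nat (iwt u k - \<alpha> u (blk k) * int (h k)) + nat (iwt v k - \<alpha> v (blk k) * int (h k)))
      = int (nat (iwt (u + v) k - \<alpha> (u + v) (blk k) * int (h k)) + excess u v (blk k) * h k)"
    using \<alpha>_le[OF assms(1), of k] \<alpha>_le[OF assms(2), of k] \<alpha>_le[OF dual_lattice_add[OF assms], of k]
    by (simp add: iwt_add[OF assms] excess(1)[OF assms] algebra_simps)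
  then show "nat (iwt u k - \<alpha> u (blk k) * int (h k)) + nat (iwt v k - \<alpha> v (blk k) * int (h k))
      = nat (iwt (u + v) k - \<alpha> (u + v) (blk k) * int (h k)) + excess u v (blk k) * h k"
    by (simp only: of_nat_eq_iff)
qed

text \<open>At a point of \<open>X\<close> the values of the \<open>A i\<close> come from parameters
  \<open>s\<close>, \<open>t\<close>, where \<open>conic_form\<close> becomes homogenisation and
  hence multiplicative. The factor \<open>branch_monomial\<close> in the numerator of the product
  turns into the powers of the \<open>A i\<close> from \<open>mon_mult\<close>.\<close>

lemma comp_mult:
  assumes uv: "u \<in> dual_lattice N" "v \<in> dual_lattice N"
    and f: "is_section u f" "is_section v f'" and x: "x \<in> X"
  shows "comp (u + v) (f * f') x = comp u f x * comp v f' x"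
proof -
  obtain g where g: "f = Fract g 1 * base u" "numer u f = g" "degree g \<le> 2 * nat (sdeg u)"
    "g \<noteq> 0 \<longrightarrow> 0 \<le> sdeg u" using f(1) by (rule is_sectionE)
  obtain g' where g': "f' = Fract g' 1 * base v" "numer v f' = g'" "degree g' \<le> 2 * nat (sdeg v)"
    "g' \<noteq> 0 \<longrightarrow> 0 \<le> sdeg v" using f(2) by (rule is_sectionE)
  obtain s t where st: "(\<lambda>i. A i x) = (\<lambda>i. branch_form \<iota> i s t)" using x by (rule X_parametrization)
  let ?b = "branch_monomial (excess u v)" and ?e = "\<Sum>i\<in>UNIV. excess u v i"
  have "homogenize (2 * nat (sdeg (u + v))) (g * g' * ?b) s t
      = homogenize (2 * nat (sdeg u)) g s t * homogenize (2 * nat (sdeg v)) g' s t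
        * (\<Prod>i\<in>UNIV. branch_form \<iota> i s t ^ excess u v i)"
  \<comment> \<open>With both numerators nonzero the degrees \<open>sdeg u\<close> and
    \<open>sdeg v\<close> are nonnegative; otherwise \<open>nat\<close> need not be
    additive.\<close>
  proof (cases "g = 0 \<or> g' = 0")
    case False
    then have "2 * nat (sdeg (u + v)) = 2 * nat (sdeg u) + 2 * nat (sdeg v) + 2 * ?e"
      using nat_sdeg_add[OF uv] g(4) g'(4) by simp
    moreover have "degree (g * g') \<le> 2 * nat (sdeg u) + 2 * nat (sdeg v)"
      using degree_mult_le[of g g'] g(3) g'(3) by linarith
    ultimately show ?thesis
      by (simp add: homogenize_mult g g' degree_branch_monomial homogenize_branch_monomial)
  qed auto
  moreover have "(\<Prod>i\<in>UNIV. branch_form \<iota> i s t ^ excess u v i) = (\<Prod>i\<in>UNIV. A i x ^ excess u v i)"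
    using fun_cong[OF st] by simp
  ultimately have "comp (u + v) (f * f') x = mon (u + v) x * (\<Prod>i\<in>UNIV. A i x ^ excess u v i)
      * (homogenize (2 * nat (sdeg u)) g s t * homogenize (2 * nat (sdeg v)) g' s t)"
    unfolding comp_def st conic_form_branch_form[OF \<iota>] is_section_mult(2)[OF uv f] g(2) g'(2)
    by (simp only: mult_ac)
  also have "\<dots> = comp u f x * comp v f' x"
    unfolding comp_def st conic_form_branch_form[OF \<iota>] g(2) g'(2) mon_mult[OF uv, symmetric]
    by (simp only: mult_ac)
  finally show ?thesis .
qed

lemma \<psi>_superset:
  assumes "finite B" "Poly_Mapping.keys F \<subseteq> B" "x \<in> X"
  shows "\<psi> F x = (\<Sum>u\<in>B. comp u (Poly_Mapping.lookup F u) x)"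
proof -
  have "\<psi> F x = (\<Sum>u\<in>Poly_Mapping.keys F. comp u (Poly_Mapping.lookup F u) x)"
    using assms(3) by (simp add: \<psi>_def)
  also have "\<dots> = (\<Sum>u\<in>B. comp u (Poly_Mapping.lookup F u) x)"
    using assms(1,2) by (rule sum.mono_neutral_left) (simp add: in_keys_iff)
  finally show ?thesis .
qed

lemma \<psi>_outside: "x \<notin> X \<Longrightarrow> \<psi> F x = 0"
  by (simp add: \<psi>_def)

lemma \<psi>_0: "\<psi> 0 x = 0"
  by (simp add: \<psi>_def)

lemma \<psi>_single: "x \<in> X \<Longrightarrow> \<psi> (Poly_Mapping.single u f) x = comp u f x"
  using \<psi>_superset[of "{u}"] by simp

lemma \<psi>_add:
  assumes "F \<in> SA" "G \<in> SA"
  shows "\<psi> (F + G) x = \<psi> F x + \<psi> G x"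
proof (cases "x \<in> X")
  case True
  let ?B = "Poly_Mapping.keys F \<union> Poly_Mapping.keys G"
  have "\<psi> (F + G) x = (\<Sum>u\<in>?B. comp u (Poly_Mapping.lookup (F + G) u) x)"
    by (intro \<psi>_superset keys_add True) simp
  also have "\<dots> = (\<Sum>u\<in>?B. comp u (Poly_Mapping.lookup F u) x) + (\<Sum>u\<in>?B. comp u (Poly_Mapping.lookup G u) x)"
    using assms by (simp add: lookup_add comp_add SA_section sum.distrib)
  also have "\<dots> = \<psi> F x + \<psi> G x" using True by (simp add: \<psi>_superset[of ?B])
  finally show ?thesis .
qed (simp add: \<psi>_outside)

lemma \<psi>_sum: "(\<And>i. i \<in> B \<Longrightarrow> F i \<in> SA) \<Longrightarrow> \<psi> (\<Sum>i\<in>B. F i) x = (\<Sum>i\<in>B. \<psi> (F i) x)"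
  by (induction B rule: infinite_finite_induct) (auto simp: \<psi>_0 \<psi>_add SA_sum)

lemma SA_mult_expand:
  assumes "F \<in> SA" "G \<in> SA"
  shows "F * G = (\<Sum>(u, v)\<in>Poly_Mapping.keys F \<times> Poly_Mapping.keys G.
      Poly_Mapping.single (u + v) (Poly_Mapping.lookup F u * Poly_Mapping.lookup G v))"
proof -
  have "F * G = (\<Sum>u\<in>Poly_Mapping.keys F. Poly_Mapping.single u (Poly_Mapping.lookup F u))
      * (\<Sum>v\<in>Poly_Mapping.keys G. Poly_Mapping.single v (Poly_Mapping.lookup G v))"
    using poly_mapping_sum_single[of F] poly_mapping_sum_single[of G] by simp
  then show ?thesis by (simp add: sum_product sum.cartesian_product mult_single)
qed

lemma SA_mult_summand:
  assumes "F \<in> SA" "G \<in> SA" "u \<in> Poly_Mapping.keys F" "v \<in> Poly_Mapping.keys G"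
  shows "Poly_Mapping.single (u + v) (Poly_Mapping.lookup F u * Poly_Mapping.lookup G v) \<in> SA"
  using SA_keys[OF assms(1,3)] SA_keys[OF assms(2,4)] assms
  by (intro SA_single MC_add is_section_mult SA_section) auto

lemma SA_mult:
  assumes "F \<in> SA" "G \<in> SA"
  shows "F * G \<in> SA"
  unfolding SA_mult_expand[OF assms] using SA_mult_summand[OF assms] by (intro SA_sum) auto

lemma \<psi>_mult:
  assumes "F \<in> SA" "G \<in> SA"
  shows "\<psi> (F * G) x = \<psi> F x * \<psi> G x"
proof (cases "x \<in> X")
  case True
  have "\<psi> (F * G) x = (\<Sum>(u, v)\<in>Poly_Mapping.keys F \<times> Poly_Mapping.keys G.
      \<psi> (Poly_Mapping.single (u + v) (Poly_Mapping.lookup F u * Poly_Mapping.lookup G v)) x)"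
    unfolding SA_mult_expand[OF assms] using SA_mult_summand[OF assms]
    by (subst \<psi>_sum) (auto simp: case_prod_beta)
  also have "\<dots> = (\<Sum>(u, v)\<in>Poly_Mapping.keys F \<times> Poly_Mapping.keys G.
      comp u (Poly_Mapping.lookup F u) x * comp v (Poly_Mapping.lookup G v) x)"
  proof (intro sum.cong refl, clarify)
    fix u v assume uv: "u \<in> Poly_Mapping.keys F" "v \<in> Poly_Mapping.keys G"
    then show "\<psi> (Poly_Mapping.single (u + v) (Poly_Mapping.lookup F u * Poly_Mapping.lookup G v)) x
        = comp u (Poly_Mapping.lookup F u) x * comp v (Poly_Mapping.lookup G v) x"
      using SA_keys[OF assms(1)] SA_keys[OF assms(2)] True assms
      by (simp add: \<psi>_single comp_mult SA_section)
  qed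
  also have "\<dots> = \<psi> F x * \<psi> G x"
    using True by (simp add: \<psi>_def sum_product sum.cartesian_product)
  finally show ?thesis .
qed (simp add: \<psi>_outside)


subsection \<open>The torus action and bijectivity\<close>

abbreviation "PA \<equiv> generated_algebra {\<lambda>x :: 'k^'n. x $ k |k. True}"

lemma A_PA: "(\<lambda>x. A i x) \<in> PA"
  unfolding A_def
  by (intro generated_algebra_prod generated_algebra_power generated_algebra.gen) auto

lemma comp_PA: "(\<lambda>x. comp u f x) \<in> PA"
proof -
  have lin: "(\<lambda>x. (c * A Bl0 x - \<iota> * A Bl1 x) / 2) \<in> PA" for c
  proof -
    have "(\<lambda>x. (1 / 2) * (c * A Bl0 x + (- \<iota>) * A Bl1 x)) \<in> PA"
      by (intro generated_algebra_cmult generated_algebra.add A_PA)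
    then show ?thesis by (simp add: algebra_simps diff_divide_distrib)
  qed
  have p: "(\<lambda>x. (A Bl0 x - \<iota> * A Bl1 x) / 2) \<in> PA"
    and q: "(\<lambda>x. (- A Bl0 x - \<iota> * A Bl1 x) / 2) \<in> PA"
    using lin[of 1] lin[of "-1"] by simp_all
  have r: "(\<lambda>x. A Bl2 x / 2) \<in> PA"
    using generated_algebra_cmult[OF A_PA, of "1 / 2" Bl2] by simp
  have cm: "(\<lambda>x. conic_monomial \<iota> d k (\<lambda>i. A i x)) \<in> PA" for d k
    unfolding conic_monomial_def
    by (cases "even k"; simp only: if_True if_False not_True_eq_False;
      intro generated_algebra.mult generated_algebra_power p q r)
  show ?thesis
    unfolding comp_def mon_def conic_form_def
    by (intro generated_algebra.mult generated_algebra_prod generated_algebra_power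
        generated_algebra_sum generated_algebra_cmult cm generated_algebra.gen) auto
qed

lemma \<psi>_coordinate_ring: "\<psi> F \<in> coordinate_ring X"
proof -
  have "\<psi> F = (\<lambda>x. if x \<in> X then (\<Sum>u\<in>Poly_Mapping.keys F. comp u (Poly_Mapping.lookup F u) x) else 0)"
    by (simp add: \<psi>_def fun_eq_iff)
  moreover have "(\<lambda>x. \<Sum>u\<in>Poly_Mapping.keys F. comp u (Poly_Mapping.lookup F u) x) \<in> PA"
    by (intro generated_algebra_sum comp_PA)
  ultimately show ?thesis unfolding coordinate_ring_def by auto
qed

text \<open>For \<open>v\<close> in \<open>N\<close> the three block degrees agree; this is the
  common weight with which the one-parameter subgroup \<open>v\<close> scales every
  \<open>A i\<close>.\<close>

definition bd :: "int^'n \<Rightarrow> int" where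
  "bd v = (\<Sum>k | blk k = Bl0. int (h k) * v $ k)"

lemma bd: "v \<in> N \<Longrightarrow> (\<Sum>k | blk k = i. int (h k) * v $ k) = bd v"
  unfolding N_eq bd_def by blast

lemma A_act:
  assumes "v \<in> N" "s \<noteq> 0"
  shows "A i (one_ps_act v s x) = s powi bd v * A i x"
proof -
  have "A i (one_ps_act v s x) = (\<Prod>k | blk k = i. s powi (int (h k) * v $ k)) * A i x"
    unfolding A_def one_ps_act_def prod.distrib[symmetric]
    by (intro prod.cong) (auto simp: power_mult_distrib power_int_power' mult.commute)
  then show ?thesis using assms by (simp add: powi_sum bd)
qed

lemma X_act:
  assumes "v \<in> N" "s \<noteq> 0" "x \<in> X"
  shows "one_ps_act v s x \<in> X"
  using assms(3) by (simp add: X_def A_act[OF assms(1,2)] power_mult_distrib flip: sum_distrib_left)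

text \<open>Taking \<open>\<alpha> u i\<close> powers of \<open>A i\<close> out of each block lowers
  the weight by \<open>sdeg u * bd v\<close>. In \<open>comp_act\<close> the form of degree
  \<open>sdeg u\<close> in the \<open>A i\<close> restores exactly this amount.\<close>

lemma mon_act:
  assumes "u \<in> dual_lattice N" "v \<in> N" "s \<noteq> 0"
  shows "mon u (one_ps_act v s x) = s powi ((\<Sum>k\<in>UNIV. iwt u k * v $ k) - sdeg u * bd v) * mon u x"
proof -
  have "mon u (one_ps_act v s x)
      = (\<Prod>k\<in>UNIV. s powi ((iwt u k - \<alpha> u (blk k) * int (h k)) * v $ k)) * mon u x"
    unfolding mon_def one_ps_act_def prod.distrib[symmetric]
  proof (intro prod.cong refl)
    fix k
    show "(\<chi> k. s powi v $ k * x $ k) $ k ^ nat (iwt u k - \<alpha> u (blk k) * int (h k)) =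
        s powi ((iwt u k - \<alpha> u (blk k) * int (h k)) * v $ k) * x $ k ^ nat (iwt u k - \<alpha> u (blk k) * int (h k))"
      using \<alpha>_le[OF assms(1), of k] by (simp add: power_mult_distrib power_int_power' mult.commute)
  qed
  also have "\<dots> = s powi (\<Sum>k\<in>UNIV. (iwt u k - \<alpha> u (blk k) * int (h k)) * v $ k) * mon u x"
    using assms(3) by (simp add: powi_sum)
  also have "(\<Sum>k\<in>UNIV. (iwt u k - \<alpha> u (blk k) * int (h k)) * v $ k)
      = (\<Sum>k\<in>UNIV. iwt u k * v $ k) - (\<Sum>k\<in>UNIV. \<alpha> u (blk k) * (int (h k) * v $ k))"
    by (simp add: left_diff_distrib sum_subtractf mult.assoc)
  also have "(\<Sum>k\<in>UNIV. \<alpha> u (blk k) * (int (h k) * v $ k))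
      = (\<Sum>i\<in>UNIV. \<Sum>k | blk k = i. \<alpha> u (blk k) * (int (h k) * v $ k))"
    by (simp only: sum_by_block)
  also have "\<dots> = (\<Sum>i\<in>UNIV. \<alpha> u i * bd v)"
  proof (intro sum.cong refl)
    fix i
    have "(\<Sum>k | blk k = i. \<alpha> u (blk k) * (int (h k) * v $ k)) = (\<Sum>k | blk k = i. \<alpha> u i * (int (h k) * v $ k))"
      by (intro sum.cong) auto
    then show "(\<Sum>k | blk k = i. \<alpha> u (blk k) * (int (h k) * v $ k)) = \<alpha> u i * bd v"
      unfolding sum_distrib_left[symmetric] bd[OF assms(2)] .
  qed
  also have "\<dots> = sdeg u * bd v" by (simp add: sdeg_def sum_distrib_right)
  finally show ?thesis .
qed

lemma comp_act:
  assumes u: "u \<in> dual_lattice N" and f: "is_section u f" and v: "v \<in> N" "s \<noteq> 0"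
    and j: "u (rat_vec v) = of_int j"
  shows "comp u f (one_ps_act v s x) = s powi j * comp u f x"
proof -
  obtain g where g: "f = Fract g 1 * base u" "numer u f = g" "degree g \<le> 2 * nat (sdeg u)"
    "g \<noteq> 0 \<longrightarrow> 0 \<le> sdeg u" using f by (rule is_sectionE)
  show ?thesis
  proof (cases "g = 0")
    case True
    then show ?thesis by (simp add: comp_def g(2) conic_form_def)
  next
    case False
    then have "sdeg u \<ge> 0" using g by blast
    then have p: "(s powi bd v) ^ nat (sdeg u) = s powi (sdeg u * bd v)"
      by (simp add: power_int_power' mult.commute)
    have "of_int (\<Sum>k\<in>UNIV. iwt u k * v $ k) = (of_int j :: rat)"
      using iwt_pairing[OF u v(1)] j by simp
    then have w: "(\<Sum>k\<in>UNIV. iwt u k * v $ k) = j" by (simp only: of_int_eq_iff)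
    have "comp u f (one_ps_act v s x) = s powi (j - sdeg u * bd v) * s powi (sdeg u * bd v) * comp u f x"
      unfolding comp_def mon_act[OF u v] w A_act[OF v] conic_form_scale p by (simp only: mult_ac)
    also have "s powi (j - sdeg u * bd v) * s powi (sdeg u * bd v) = s powi j"
      using v(2) by (simp flip: power_int_add)
    finally show ?thesis .
  qed
qed

text \<open>Rescales each component by a scalar that depends on its degree. This expresses the torus
  action on the section side, negation, and the elimination of chosen degrees.\<close>

definition twist :: "((rat^'n \<Rightarrow> rat) \<Rightarrow> 'k) \<Rightarrow> ((rat^'n \<Rightarrow> rat) \<Rightarrow>\<^sub>0 'k ratfun)
    \<Rightarrow> ((rat^'n \<Rightarrow> rat) \<Rightarrow>\<^sub>0 'k ratfun)" where
  "twist c F = Poly_Mapping.mapp (\<lambda>u f. Fract [:c u:] 1 * f) F"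

lemma lookup_twist: "Poly_Mapping.lookup (twist c F) u = Fract [:c u:] 1 * Poly_Mapping.lookup F u"
  by (auto simp: twist_def Poly_Mapping.lookup_mapp when_def in_keys_iff)

lemma keys_twist: "Poly_Mapping.keys (twist c F) = {u \<in> Poly_Mapping.keys F. c u \<noteq> 0}"
  by (auto simp: in_keys_iff lookup_twist)

lemma twist_SA:
  assumes "F \<in> SA"
  shows "twist c F \<in> SA"
  unfolding SA_iff lookup_twist
proof (intro conjI ballI)
  show "Poly_Mapping.keys (twist c F) \<subseteq> MC" using SA_keys[OF assms] by (auto simp: keys_twist)
  show "is_section u (Fract [:c u:] 1 * Poly_Mapping.lookup F u)" for u
    using assms by (intro is_section_cmult SA_section)
qed

lemma \<psi>_twist:
  assumes "F \<in> SA" "x \<in> X"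
  shows "\<psi> (twist c F) x = (\<Sum>u\<in>Poly_Mapping.keys F. c u * comp u (Poly_Mapping.lookup F u) x)"
proof -
  have "\<psi> (twist c F) x = (\<Sum>u\<in>Poly_Mapping.keys F. comp u (Poly_Mapping.lookup (twist c F) u) x)"
    using assms by (intro \<psi>_superset) (auto simp: keys_twist)
  then show ?thesis using assms by (simp add: lookup_twist comp_cmult SA_section)
qed

lemma \<psi>_act:
  assumes F: "F \<in> SA" "x \<in> X" and v: "v \<in> N" "s \<noteq> 0"
  shows "\<psi> F (one_ps_act v s x) = \<psi> (twist (\<lambda>u. s powi \<lfloor>u (rat_vec v)\<rfloor>) F) x"
proof -
  have "comp u (Poly_Mapping.lookup F u) (one_ps_act v s x)
      = s powi \<lfloor>u (rat_vec v)\<rfloor> * comp u (Poly_Mapping.lookup F u) x"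
    if "u \<in> Poly_Mapping.keys F" for u
  proof (rule comp_act)
    show ul: "u \<in> dual_lattice N" using SA_keys[OF F(1) that] by blast
    show "u (rat_vec v) = of_int \<lfloor>u (rat_vec v)\<rfloor>"
      using ul v(1) by (auto simp: dual_lattice_def elim!: Ints_cases)
  qed (use F v SA_section in auto)
  then show ?thesis
    unfolding \<psi>_twist[OF F] using X_act[OF v F(2)] by (simp add: \<psi>_def)
qed

section \<open>Injectivity\<close>

lemma exists_point:
  assumes "\<And>i. a i \<noteq> 0"
  shows "\<exists>x. (\<forall>i. A i x = a i) \<and> (\<forall>k. x $ k \<noteq> 0)"
proof -
  obtain \<rho> where \<rho>: "\<And>i. blk (\<rho> i) = i" using blk_surj by metis
  have "\<exists>y. y ^ h (\<rho> i) = a i" for i using nth_root_exists h_pos by blast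
  then obtain y where y: "\<And>i. y i ^ h (\<rho> i) = a i" by metis
  \<comment> \<open>One variable in each block carries a root of the prescribed value; all others
    are 1.\<close>
  define x :: "'k^'n" where "x = (\<chi> k. if k = \<rho> (blk k) then y (blk k) else 1)"
  have y0: "y i \<noteq> 0" for i using y[of i] assms[of i] h_pos[of "\<rho> i"] by (auto simp: power_0_left)
  have "A i x = a i" for i
  proof -
    have "A i x = (\<Prod>k | blk k = i. if k = \<rho> i then a i else 1)"
      unfolding A_def x_def by (intro prod.cong) (use y[of i] in auto)
    then show ?thesis using \<rho> by simp
  qed
  then show ?thesis using y0 by (intro exI[of _ x]) (simp add: x_def)
qed

lemma section_zero_if_comp_vanishes:
  assumes f: "is_section u f" and van: "\<And>x. x \<in> X \<Longrightarrow> comp u f x = 0"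
  shows "f = 0"
proof -
  obtain g where g: "f = Fract g 1 * base u" "numer u f = g" "degree g \<le> 2 * nat (sdeg u)"
    "g \<noteq> 0 \<longrightarrow> 0 \<le> sdeg u" using f by (rule is_sectionE)
  \<comment> \<open>Over a zero of some branch polynomial there need not be a point with nonzero
    coordinates; the added factor makes the product vanish there in any case.\<close>
  have "poly (g * (\<Prod>i\<in>UNIV. branch_poly \<iota> i)) z = 0" for z
  proof (cases "\<forall>i. poly (branch_poly \<iota> i) z \<noteq> 0")
    case True
    then obtain x where x: "\<And>i. A i x = poly (branch_poly \<iota> i) z" "\<And>k. x $ k \<noteq> 0"
      using exists_point[of "\<lambda>i. poly (branch_poly \<iota> i) z"] by blast
    then have A: "(\<lambda>i. A i x) = (\<lambda>i. branch_form \<iota> i z 1)" by (simp add: branch_form_at_1)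
    have "(\<Sum>i\<in>UNIV. (branch_form \<iota> i z 1)\<^sup>2) = 0"
      using \<iota> by (simp add: sum_block power_mult_distrib) (simp add: power2_eq_square algebra_simps)
    then have "x \<in> X" using fun_cong[OF A] by (simp add: X_def)
    then have "mon u x * poly g z = 0"
      using van[of x] g(3) unfolding comp_def A conic_form_branch_form[OF \<iota>] g(2)
      by (simp add: homogenize_at_1)
    moreover have "mon u x \<noteq> 0" using x(2) by (simp add: mon_def)
    ultimately show ?thesis by simp
  next
    case False
    then show ?thesis by (auto simp: poly_prod)
  qed
  then have "g * (\<Prod>i\<in>UNIV. branch_poly \<iota> i) = 0" using poly_all_0_iff_0 by blast
  then have "g = 0" using branch_poly_nonzero[OF \<iota>] by simp
  then show ?thesis using g(1) by (simp add: Zero_fract_def[symmetric])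
qed

text \<open>Dedekind's argument: a relation between components of different degrees is shortened by
  comparing it with its translate under a one-parameter subgroup that separates two of them.\<close>

lemma \<psi>_kernel:
  assumes "F \<in> SA" "\<And>x. x \<in> X \<Longrightarrow> \<psi> F x = 0"
  shows "F = 0"
  using assms
proof (induction "card (Poly_Mapping.keys F)" arbitrary: F rule: less_induct)
  case (less F)
  show ?case
  proof (rule ccontr)
    assume "F \<noteq> 0"
    then obtain u where u: "u \<in> Poly_Mapping.keys F" by (metis keys_eq_empty ex_in_conv)
    have "Poly_Mapping.keys F \<noteq> {u}"
    proof
      assume k: "Poly_Mapping.keys F = {u}"
      have "comp u (Poly_Mapping.lookup F u) x = 0" if "x \<in> X" for x
        using less(3)[OF that] that by (simp add: \<psi>_def k)
      then have "Poly_Mapping.lookup F u = 0"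
        using SA_section[OF less(2)] by (rule section_zero_if_comp_vanishes[rotated])
      then show False using u by (simp add: in_keys_iff)
    qed
    then obtain u' where u': "u' \<in> Poly_Mapping.keys F" "u' \<noteq> u" using u by blast
    have ul: "u \<in> dual_lattice N" "u' \<in> dual_lattice N" using SA_keys[OF less(2)] u u' by auto
    then obtain v where v: "v \<in> N" "u (rat_vec v) \<noteq> u' (rat_vec v)"
      using dual_lattice_eqI[of u u'] u'(2) by blast
    have "u (rat_vec v) \<in> \<int>" "u' (rat_vec v) \<in> \<int>" using ul v(1) by (auto simp: dual_lattice_def)
    then have fl: "\<lfloor>u (rat_vec v)\<rfloor> \<noteq> \<lfloor>u' (rat_vec v)\<rfloor>" using v(2) by (auto elim!: Ints_cases)
    \<comment> \<open>Twisting by \<open>c\<close> is translation by the value at 2 minus a multiple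
      of the identity. It kills the degree \<open>u\<close>, keeps \<open>u'\<close> and creates no
      new degree.\<close>
    define c :: "(rat^'n \<Rightarrow> rat) \<Rightarrow> 'k" where
      "c w = 2 powi \<lfloor>w (rat_vec v)\<rfloor> - 2 powi \<lfloor>u (rat_vec v)\<rfloor>" for w
    have c: "c u = 0" "c u' \<noteq> 0"
      using two_powi_inject[where 'k = 'k, of "\<lfloor>u' (rat_vec v)\<rfloor>" "\<lfloor>u (rat_vec v)\<rfloor>"] fl
      by (auto simp: c_def)
    have "\<psi> (twist c F) x = 0" if x: "x \<in> X" for x
    proof -
      have "\<psi> (twist c F) x = \<psi> F (one_ps_act v 2 x) - 2 powi \<lfloor>u (rat_vec v)\<rfloor> * \<psi> F x"
        unfolding \<psi>_act[OF less(2) x v(1) zero_neq_numeral[symmetric]] \<psi>_twist[OF less(2) x]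
        using x by (simp add: \<psi>_def c_def left_diff_distrib sum_subtractf sum_distrib_left mult.assoc)
      also have "\<dots> = 0" using less(3)[OF x] less(3)[OF X_act[OF v(1) _ x]] by simp
      finally show ?thesis .
    qed
    moreover have "card (Poly_Mapping.keys (twist c F)) < card (Poly_Mapping.keys F)"
      using u c(1) by (intro psubset_card_mono) (auto simp: keys_twist)
    ultimately have "twist c F = 0" using less(1) twist_SA[OF less(2)] by blast
    then have "Poly_Mapping.keys (twist c F) = {}" by simp
    then show False using u'(1) c(2) by (auto simp: keys_twist)
  qed
qed

lemma \<psi>_inj: "inj_on \<psi> SA"
proof (rule inj_onI)
  fix F G assume FG: "F \<in> SA" "G \<in> SA" "\<psi> F = \<psi> G"
  \<comment> \<open>The negative of \<open>G\<close> is taken as a twist, so that it lies in the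
    section algebra by \<open>twist_SA\<close>.\<close>
  have "F + twist (\<lambda>_. -1) G = 0"
  proof (rule \<psi>_kernel)
    show "F + twist (\<lambda>_. -1) G \<in> SA" using FG by (intro SA_add twist_SA)
    show "\<psi> (F + twist (\<lambda>_. -1) G) x = 0" if x: "x \<in> X" for x
    proof -
      have "\<psi> (twist (\<lambda>_. -1) G) x = - \<psi> G x"
        unfolding \<psi>_twist[OF FG(2) x] using x by (simp add: \<psi>_def sum_negf)
      then show ?thesis using FG by (simp add: \<psi>_add twist_SA)
    qed
  qed
  moreover have "Fract [:-1:] 1 = (-1 :: 'k ratfun)" by (simp add: One_fract_def one_pCons)
  ultimately have "Poly_Mapping.lookup F u - Poly_Mapping.lookup G u = 0" for u
    by (metis (no_types, lifting) add_uminus_conv_diff lookup_add lookup_twist lookup_zero mult_minus1)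
  then show "F = G" by (intro poly_mapping_eqI) simp
qed

section \<open>Surjectivity\<close>

lemma wt_0: "wt 0 k = 0" "iwt 0 k = 0" "\<mu> 0 i = 0" "\<alpha> 0 i = 0" "sdeg 0 = 0" "mon 0 x = 1"
proof -
  show 1: "wt 0 k = 0" for k by (simp add: wt_def)
  show 2: "iwt 0 k = 0" for k by (simp add: iwt_def 1)
  show 3: "\<mu> 0 i = 0" for i using \<mu>_attained[of i 0] by (auto simp: 1)
  show 4: "\<alpha> 0 i = 0" for i by (simp add: \<alpha>_def 3)
  show 5: "sdeg 0 = 0" by (simp add: sdeg_def 4)
  show 6: "mon 0 x = 1" by (simp add: mon_def 2 4)
qed

lemma const_section_SA:
  shows "const_section c \<in> SA" and "x \<in> X \<Longrightarrow> \<psi> (const_section c) x = c"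
proof -
  have e: "Fract [:c:] 1 = Fract [:c:] 1 * base 0"
    by (simp add: base_section_def wt_0)
  have "is_section 0 (Fract [:c:] 1)" by (rule is_sectionI[OF e]) (auto simp: wt_0)
  then show "const_section c \<in> SA" unfolding const_section_def by (intro SA_single MC_0)
  show "\<psi> (const_section c) x = c" if x: "x \<in> X"
    using numer_eqI[OF e] unfolding const_section_def \<psi>_single[OF x] comp_def
    by (simp add: wt_0 conic_form_def conic_monomial_def)
qed

text \<open>The \<open>k\<close>-th unit exponent vector and \<open>iwt (coord k)\<close> restrict
  to the same functional on \<open>N\<close>. By \<open>annihilator_N\<close> they differ by
  \<open>y i\<close> times the exponents of \<open>A i\<close>, with the \<open>y i\<close> adding
  up to zero. So the coordinate equals \<open>mon u\<close> times the product of the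
  \<open>A i ^ \<delta> i\<close> with \<open>\<delta> i = y i + \<alpha> u i\<close>; maximality of
  \<open>\<alpha>\<close> makes these exponents nonnegative, and their sum is
  \<open>sdeg u\<close>.\<close>

lemma coordinate_in_image:
  "\<exists>F\<in>SA. \<forall>x\<in>X. \<psi> F x = x $ k"
proof -
  define u where "u = coord k"
  have ul: "u \<in> dual_lattice N" unfolding u_def by (rule coord_dual_lattice)
  have uMC: "u \<in> MC" using ul coord_dual_cone by (simp add: u_def)
  define m where "m l = (if l = k then 1 else 0) - iwt u l" for l
  have "(\<Sum>l\<in>UNIV. m l * v $ l) = 0" if v: "v \<in> N" for v
  proof -
    have "of_int (\<Sum>l\<in>UNIV. iwt u l * v $ l) = (of_int (v $ k) :: rat)"
      unfolding iwt_pairing[OF ul v] using v by (simp add: u_def coord_def rat_vec_in_lattice_Q)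
    then have "(\<Sum>l\<in>UNIV. iwt u l * v $ l) = v $ k" by (simp only: of_int_eq_iff)
    moreover have "(\<Sum>l\<in>UNIV. (if l = k then 1 else 0) * v $ l) = (\<Sum>l\<in>UNIV. if l = k then v $ l else 0)"
      by (intro sum.cong) auto
    ultimately show ?thesis by (simp add: m_def left_diff_distrib sum_subtractf)
  qed
  from annihilator_N[OF this] obtain y where y: "\<And>l. m l = y (blk l) * int (h l)" "(\<Sum>i\<in>UNIV. y i) = 0"
    by blast
  have ya: "- y i \<le> \<alpha> u i" for i
  proof (rule \<alpha>_greatest[OF ul])
    fix l assume "blk l = i"
    then show "- y i * int (h l) \<le> iwt u l" using y(1)[of l] by (simp add: m_def split: if_splits)
  qed
  define \<delta> where "\<delta> i = nat (y i + \<alpha> u i)" for i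
  have \<delta>: "int (\<delta> i) = y i + \<alpha> u i" for i using ya[of i] by (simp add: \<delta>_def)
  have sdeg: "sdeg u = int (\<Sum>i\<in>UNIV. \<delta> i)"
    using y(2) by (simp add: sdeg_def \<delta> sum.distrib)
  \<comment> \<open>The numerator is chosen so that its homogenisation is the product of the
    \<open>A i ^ \<delta> i\<close> on \<open>X\<close>.\<close>
  define f where "f = Fract (branch_monomial \<delta>) 1 * base u"
  have sec: "is_section u f"
    by (rule is_sectionI[OF f_def]) (simp_all add: sdeg degree_branch_monomial sum_nonneg del: of_nat_sum)
  have num: "numer u f = branch_monomial \<delta>" using f_def by (rule numer_eqI)
  have "comp u f x = x $ k" if x: "x \<in> X" for x
  proof -
    obtain s t where st: "(\<lambda>i. A i x) = (\<lambda>i. branch_form \<iota> i s t)" using x by (rule X_parametrization)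
    have "homogenize (2 * nat (sdeg u)) (branch_monomial \<delta>) s t = (\<Prod>i\<in>UNIV. A i x ^ \<delta> i)"
      unfolding sdeg nat_int homogenize_branch_monomial using fun_cong[OF st] by simp
    then have "comp u f x = mon u x * (\<Prod>i\<in>UNIV. A i x ^ \<delta> i)"
      unfolding comp_def st conic_form_branch_form[OF \<iota>] num by simp
    also have "\<dots> = (\<Prod>l\<in>UNIV. (x $ l) ^ (if l = k then 1 else 0))"
      unfolding prod_A_power mon_def prod.distrib[symmetric] power_add[symmetric]
    proof (intro prod.cong refl arg_cong2[of _ _ _ _ "(^)"])
      fix l
      have "int (nat (iwt u l - \<alpha> u (blk l) * int (h l)) + \<delta> (blk l) * h l) = int (if l = k then 1 else 0)"
        using \<alpha>_le[OF ul, of l] y(1)[of l] by (simp add: \<delta> m_def algebra_simps split: if_splits)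
      then show "nat (iwt u l - \<alpha> u (blk l) * int (h l)) + \<delta> (blk l) * h l = (if l = k then 1 else 0)"
        by (simp only: of_nat_eq_iff)
    qed
    also have "\<dots> = (\<Prod>l\<in>UNIV. if l = k then x $ l else 1)" by (intro prod.cong) auto
    finally show ?thesis by simp
  qed
  then show ?thesis using SA_single[OF uMC sec] \<psi>_single by metis
qed

lemma PA_in_image: "p \<in> PA \<Longrightarrow> \<exists>F\<in>SA. \<forall>x\<in>X. \<psi> F x = p x"
proof (induction rule: generated_algebra.induct)
  case (const c)
  show ?case by (intro bexI[of _ "const_section c"] ballI) (simp_all add: const_section_SA)
next
  case (gen g)
  then show ?case using coordinate_in_image by auto
next
  case (add f g)
  then obtain F G where FG: "F \<in> SA" "\<forall>x\<in>X. \<psi> F x = f x" "G \<in> SA" "\<forall>x\<in>X. \<psi> G x = g x"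
    by blast
  then show ?case by (intro bexI[of _ "F + G"] ballI) (simp_all add: \<psi>_add SA_add)
next
  case (mult f g)
  then obtain F G where FG: "F \<in> SA" "\<forall>x\<in>X. \<psi> F x = f x" "G \<in> SA" "\<forall>x\<in>X. \<psi> G x = g x"
    by blast
  then show ?case by (intro bexI[of _ "F * G"] ballI) (simp_all add: \<psi>_mult SA_mult)
qed

lemma \<psi>_bij: "bij_betw \<psi> SA (coordinate_ring X)"
  unfolding bij_betw_def
proof (intro conjI \<psi>_inj set_eqI iffI)
  fix f assume "f \<in> coordinate_ring X"
  then obtain p where p: "p \<in> PA" "f = (\<lambda>x. if x \<in> X then p x else 0)"
    unfolding coordinate_ring_def by blast
  from PA_in_image[OF p(1)] obtain F where F: "F \<in> SA" "\<forall>x\<in>X. \<psi> F x = p x" by blast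
  then have "f = \<psi> F" using p(2) by (auto simp: \<psi>_outside)
  then show "f \<in> \<psi> ` SA" using F(1) by blast
qed (auto simp: \<psi>_coordinate_ring)

section \<open>Weight spaces and the graded isomorphism\<close>

lemma \<psi>_weight_space:
  assumes m: "m \<in> dual_lattice N" and F: "F \<in> SA"
  shows "\<psi> F \<in> weight_space N X m \<longleftrightarrow> Poly_Mapping.keys F \<subseteq> {m}"
proof
  assume w: "\<psi> F \<in> weight_space N X m"
  show "Poly_Mapping.keys F \<subseteq> {m}"
  proof
    fix u assume u: "u \<in> Poly_Mapping.keys F"
    have ul: "u \<in> dual_lattice N" using SA_keys[OF F u] by blast
    have "u (rat_vec v) = m (rat_vec v)" if v: "v \<in> N" for v
    proof -
      obtain j a where j: "m (rat_vec v) = of_int j" "u (rat_vec v) = of_int a"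
        using m ul v unfolding dual_lattice_def by (metis (no_types, lifting) Ints_cases mem_Collect_eq)
      \<comment> \<open>The factor \<open>c\<close> vanishes only at degrees with the value
        \<open>j\<close> on \<open>v\<close>. Since the twist of \<open>F\<close> is mapped to zero,
        every degree occurring in \<open>F\<close> has this value.\<close>
      define c :: "(rat^'n \<Rightarrow> rat) \<Rightarrow> 'k" where "c w = 2 powi \<lfloor>w (rat_vec v)\<rfloor> - 2 powi j" for w
      have "twist c F = 0"
      proof (rule \<psi>_kernel)
        show "twist c F \<in> SA" using F by (rule twist_SA)
        fix x assume x: "x \<in> X"
        have "\<psi> (twist c F) x = \<psi> F (one_ps_act v 2 x) - 2 powi j * \<psi> F x"
          unfolding \<psi>_act[OF F x v zero_neq_numeral[symmetric]] \<psi>_twist[OF F x]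
          using x by (simp add: \<psi>_def c_def left_diff_distrib sum_subtractf sum_distrib_left mult.assoc)
        also have "\<psi> F (one_ps_act v 2 x) = 2 powi j * \<psi> F x"
          using w v x j(1) zero_neq_numeral unfolding weight_space_def by auto
        finally show "\<psi> (twist c F) x = 0" by simp
      qed
      then have "Poly_Mapping.keys (twist c F) = {}" by simp
      then have "c u = 0" using u by (auto simp: keys_twist)
      then have "(2 :: 'k) powi a = 2 powi j" by (simp add: c_def j(2))
      then have "a = j" by (rule two_powi_inject)
      then show ?thesis using j by simp
    qed
    then show "u \<in> {m}" using dual_lattice_eqI[OF ul m] by blast
  qed
next
  assume k: "Poly_Mapping.keys F \<subseteq> {m}"
  have "\<psi> F (one_ps_act v s x) = s powi j * \<psi> F x"
    if "v \<in> N" "s \<noteq> 0" "m (rat_vec v) = of_int j" "x \<in> X" for v s j x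
    using that m F X_act[OF that(1,2,4)]
    by (simp add: \<psi>_superset[OF _ k] comp_act SA_section)
  then show "\<psi> F \<in> weight_space N X m"
    unfolding weight_space_def using \<psi>_coordinate_ring by blast
qed

lemma corresponds_\<DD>: "corresponds N \<sigma> \<DD> X"
proof -
  \<comment> \<open>The correspondence asks for a map out of the coordinate ring, that is, for the
    inverse of \<open>\<psi>\<close>.\<close>
  define \<phi> where "\<phi> = the_inv_into SA \<psi>"
  have \<phi>: "bij_betw \<phi> (coordinate_ring X) SA"
    unfolding \<phi>_def using \<psi>_bij by (rule bij_betw_the_inv_into)
  have \<phi>\<psi>: "\<phi> (\<psi> F) = F" if "F \<in> SA" for F
    unfolding \<phi>_def using \<psi>_inj that by (rule the_inv_into_f_f)
  have ex: "\<exists>F\<in>SA. f = \<psi> F" if "f \<in> coordinate_ring X" for f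
    using that \<psi>_bij by (auto simp: bij_betw_def)
  show ?thesis
    unfolding corresponds_def
  proof (intro exI[of _ \<phi>] conjI ballI allI)
    show "bij_betw \<phi> (coordinate_ring X) SA" by (rule \<phi>)
  next
    fix f g assume "f \<in> coordinate_ring X" "g \<in> coordinate_ring X"
    then obtain F G where FG: "F \<in> SA" "G \<in> SA" "f = \<psi> F" "g = \<psi> G" using ex by blast
    have "(\<lambda>x. f x + g x) = \<psi> (F + G)" "(\<lambda>x. f x * g x) = \<psi> (F * G)"
      using FG by (auto simp: \<psi>_add \<psi>_mult)
    then show "\<phi> (\<lambda>x. f x + g x) = \<phi> f + \<phi> g" "\<phi> (\<lambda>x. f x * g x) = \<phi> f * \<phi> g"
      using FG by (simp_all add: \<phi>\<psi> SA_add SA_mult)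
  next
    fix c :: 'k
    have "(\<lambda>x. if x \<in> X then c else 0) = \<psi> (const_section c)"
      by (auto simp: const_section_SA \<psi>_outside)
    then show "\<phi> (\<lambda>x. if x \<in> X then c else 0) = const_section c"
      by (simp add: \<phi>\<psi> const_section_SA)
  next
    fix m assume m: "m \<in> dual_lattice N"
    have comp: "section_component N \<sigma> \<DD> m = {F \<in> SA. Poly_Mapping.keys F \<subseteq> {m}}"
      by (simp add: section_component_def)
    show "\<phi> ` weight_space N X m = section_component N \<sigma> \<DD> m"
    proof (intro set_eqI iffI)
      fix F assume "F \<in> \<phi> ` weight_space N X m"
      then obtain f where f: "f \<in> weight_space N X m" "F = \<phi> f" by blast
      then have "f \<in> coordinate_ring X" by (simp add: weight_space_def)
      then obtain G where "G \<in> SA" "f = \<psi> G" using ex by blast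
      then show "F \<in> section_component N \<sigma> \<DD> m"
        using f \<psi>_weight_space[OF m] by (simp add: comp \<phi>\<psi>)
    next
      fix F assume "F \<in> section_component N \<sigma> \<DD> m"
      then have F: "F \<in> SA" "\<psi> F \<in> weight_space N X m" using \<psi>_weight_space[OF m] by (auto simp: comp)
      then show "F \<in> \<phi> ` weight_space N X m" using \<phi>\<psi>[OF F(1)] by (metis imageI)
    qed
  qed
qed

end


section \<open>Trinomial hypersurfaces of type II\<close>

lemma Gcd_even_values:
  fixes l :: "'i \<Rightarrow> nat"
  assumes "\<And>j. even (l j)"
  shows "Gcd (range l) div 2 = Gcd (range (\<lambda>j. l j div 2))"
proof -
  have "range l = (*) 2 ` range (\<lambda>j. l j div 2)"
    using assms by (auto simp: image_image)
  then have "Gcd (range l) = 2 * Gcd (range (\<lambda>j. l j div 2))"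
    by (simp only: Gcd_mult) simp
  then show ?thesis by simp
qed

fun block_of :: "'a + 'b + 'c \<Rightarrow> block" where
  "block_of (Inl j) = Bl0"
| "block_of (Inr (Inl j)) = Bl1"
| "block_of (Inr (Inr j)) = Bl2"

lemma block_of_fibres:
  "{k. block_of k = Bl0} = range Inl"
  "{k. block_of k = Bl1} = range (\<lambda>j. Inr (Inl j))"
  "{k. block_of k = Bl2} = range (\<lambda>j. Inr (Inr j))"
  by (auto elim: block_of.elims)

fun half_exponent :: "('a \<Rightarrow> nat) \<Rightarrow> ('b \<Rightarrow> nat) \<Rightarrow> ('c \<Rightarrow> nat) \<Rightarrow> 'a + 'b + 'c \<Rightarrow> nat" where
  "half_exponent l0 l1 l2 (Inl j) = l0 j div 2"
| "half_exponent l0 l1 l2 (Inr (Inl j)) = l1 j div 2"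
| "half_exponent l0 l1 l2 (Inr (Inr j)) = l2 j div 2"

theorem proposition5p7:
  fixes l0 :: "'a::finite \<Rightarrow> nat" and l1 :: "'b::finite \<Rightarrow> nat" and l2 :: "'c::finite \<Rightarrow> nat"
    and \<iota> :: "'k::{alg_closed_field,field_char_0}"
    and X :: "('k^('a + 'b + 'c)) set"
    and N :: "(int^('a + 'b + 'c)) set"
    and S :: "int^('a + 'b + 'c) \<Rightarrow> int^('a + 'b + 'c)"
    and d0 d1 d2 d :: nat
    and \<DD> :: "('a + 'b + 'c, 'k) pdiv"
    and \<sigma> \<Delta>0 \<Delta>1 \<Delta>2 :: "(rat^('a + 'b + 'c)) set"
  assumes l_pos: "\<forall>j. 0 < l0 j" "\<forall>j. 0 < l1 j" "\<forall>j. 0 < l2 j"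
    and nonlinear:
      "\<not> (CARD('a) = 1 \<and> (\<forall>j. l0 j = 1))"
      "\<not> (CARD('b) = 1 \<and> (\<forall>j. l1 j = 1))"
      "\<not> (CARD('c) = 1 \<and> (\<forall>j. l2 j = 1))"
    and d_i: "d0 = Gcd (range l0)" "d1 = Gcd (range l1)" "d2 = Gcd (range l2)"
    and d: "d = gcd d0 (gcd d1 d2)"
    and type_II: "d = 2"
      "gcd (d0 div d) (d1 div d) = 1"
      "gcd (d0 div d) (d2 div d) = 1"
      "gcd (d1 div d) (d2 div d) = 1"
    and X: "X = trinomial l0 l1 l2"
    and N: "N = trinomial_lattice l0 l1 l2"
    and S_hom: "\<forall>v w. S (v + w) = S v + S w"
    and S_range: "\<forall>v. S v \<in> N"
    and S_F: "\<forall>v\<in>N. S v = v"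
    and \<sigma>: "\<sigma> = extend_Q S ` ({v. \<forall>k. 0 \<le> v $ k} \<inter> lattice_Q N)"
    and \<iota>: "\<iota>\<^sup>2 = -1"
    and \<Delta>0: "\<Delta>0 = minkowski_sum (qconvex_hull
        {extend_Q S ((2 / of_nat (l0 j)) *s axis (Inl j) 1) |j. True}) \<sigma>"
    and \<Delta>1: "\<Delta>1 = minkowski_sum (qconvex_hull
        {extend_Q S ((2 / of_nat (l1 j)) *s axis (Inr (Inl j)) 1) |j. True}) \<sigma>"
    and \<Delta>2: "\<Delta>2 = minkowski_sum (qconvex_hull
        {extend_Q S ((2 / of_nat (l2 j)) *s axis (Inr (Inr j)) 1) |j. True}) \<sigma>"
    and \<DD>: "\<DD> = [(\<Delta>0, prime_div (Pt 1) + prime_div (Pt (-1))),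
                  (\<Delta>1, prime_div (Pt \<iota>) + prime_div (Pt (-\<iota>))),
                  (\<Delta>2, prime_div (Pt 0) + prime_div Infty)]"
  shows "pp_divisor N \<sigma> \<DD> \<and> corresponds N \<sigma> \<DD> X"
proof -
  let ?blk = "block_of :: 'a + 'b + 'c \<Rightarrow> block" and ?h = "half_exponent l0 l1 l2"
  have "2 dvd d0" "2 dvd d1" "2 dvd d2" using d type_II(1) by (metis gcd_dvd1 gcd_dvd2 dvd_trans)+
  then have ev: "even (l0 i)" "even (l1 j)" "even (l2 k)" for i j k
    unfolding d_i by (meson Gcd_dvd dvd_trans rangeI)+
  have pos: "0 < ?h k" for k
  proof (cases k rule: block_of.cases)
    case (1 j)
    then show ?thesis using ev(1)[of j] l_pos(1)[rule_format, of j] by (auto elim!: evenE)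
  next
    case (2 j)
    then show ?thesis using ev(2)[of j] l_pos(2)[rule_format, of j] by (auto elim!: evenE)
  next
    case (3 j)
    then show ?thesis using ev(3)[of j] l_pos(3)[rule_format, of j] by (auto elim!: evenE)
  qed
  have sums: "(\<Sum>k | ?blk k = Bl0. f k) = (\<Sum>j\<in>UNIV. f (Inl j))"
    "(\<Sum>k | ?blk k = Bl1. f k) = (\<Sum>j\<in>UNIV. f (Inr (Inl j)))"
    "(\<Sum>k | ?blk k = Bl2. f k) = (\<Sum>j\<in>UNIV. f (Inr (Inr j)))" for f :: "'a + 'b + 'c \<Rightarrow> int"
    unfolding block_of_fibres by (simp_all add: sum.reindex inj_on_def)
  have prods: "(\<Prod>k | ?blk k = Bl0. f k) = (\<Prod>j\<in>UNIV. f (Inl j))"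
    "(\<Prod>k | ?blk k = Bl1. f k) = (\<Prod>j\<in>UNIV. f (Inr (Inl j)))"
    "(\<Prod>k | ?blk k = Bl2. f k) = (\<Prod>j\<in>UNIV. f (Inr (Inr j)))" for f :: "'a + 'b + 'c \<Rightarrow> 'k"
    unfolding block_of_fibres by (simp_all add: prod.reindex inj_on_def)
  have double: "(\<Sum>j\<in>UNIV. int (l j) * w j) = 2 * (\<Sum>j\<in>UNIV. int (l j div 2) * w j)"
    if "\<And>j. even (l j)" for l :: "'i::finite \<Rightarrow> nat" and w
  proof -
    have "int (l j) * w j = 2 * (int (l j div 2) * w j)" for j
      using that[of j] by (auto elim!: evenE)
    then show ?thesis by (simp only: sum_distrib_left)
  qed
  \<comment> \<open>As \<open>d = 2\<close>, halving the exponents divides the \<open>d_i\<close> by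
    \<open>d\<close>, and the type II conditions become the coprimality of the halved
    blocks.\<close>
  interpret conic_lattice ?blk ?h N S \<iota>
  proof
    show "0 < ?h k" for k by (rule pos)
    show "\<exists>k. ?blk k = i" for i
      by (cases i) (metis block_of.simps)+
    show "N = {v. \<forall>i j. (\<Sum>k | ?blk k = i. int (?h k) * v $ k) = (\<Sum>k | ?blk k = j. int (?h k) * v $ k)}"
      unfolding N set_eq_iff trinomial_lattice_iff mem_Collect_eq all_block sums half_exponent.simps
        double[OF ev(1)] double[OF ev(2)] double[OF ev(3)] by auto
    show "coprime (Gcd (?h ` {k. ?blk k = i})) (Gcd (?h ` {k. ?blk k = j}))" if "i \<noteq> j" for i j
    proof -
      define G where "G i = Gcd (?h ` {k. ?blk k = i})" for i
      have e: "d0 div 2 = G Bl0" "d1 div 2 = G Bl1" "d2 div 2 = G Bl2"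
        unfolding d_i G_def block_of_fibres image_image by (simp_all add: Gcd_even_values ev)
      have c: "coprime (G Bl0) (G Bl1)" "coprime (G Bl0) (G Bl2)" "coprime (G Bl1) (G Bl2)"
        using type_II(2-4) unfolding type_II(1) e coprime_iff_gcd_eq_1 by simp_all
      have "\<forall>i j. i \<noteq> j \<longrightarrow> coprime (G i) (G j)"
        unfolding all_block using c c[THEN coprime_commute[THEN iffD1]] by simp
      then show ?thesis using that unfolding G_def by blast
    qed
  qed (use S_hom S_range S_F \<iota> in auto)
  \<comment> \<open>This identifies the points generating the polyhedra in the theorem with the
    images of the vectors \<open>vertex k\<close>.\<close>
  have half: "2 / of_nat n = (1 / of_nat (n div 2) :: rat)" if "even n" for n
    using that by (auto elim!: evenE)
  have "{extend_Q S (vertex k) |k. ?blk k = Bl0} = {extend_Q S ((2 / of_nat (l0 j)) *s axis (Inl j) 1) |j. True}"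
    "{extend_Q S (vertex k) |k. ?blk k = Bl1} = {extend_Q S ((2 / of_nat (l1 j)) *s axis (Inr (Inl j)) 1) |j. True}"
    "{extend_Q S (vertex k) |k. ?blk k = Bl2} = {extend_Q S ((2 / of_nat (l2 j)) *s axis (Inr (Inr j)) 1) |j. True}"
    unfolding setcompr_eq_image block_of_fibres image_image
    by (simp_all add: vertex_def half ev full_SetCompr_eq)
  then have \<DD>_eq: "\<DD> = conic_lattice.\<DD> ?blk ?h N S \<iota>"
    unfolding \<DD> \<DD>_def \<Delta>0 \<Delta>1 \<Delta>2 \<Delta>_def \<sigma> \<sigma>_def by simp
  have square: "(\<Prod>j\<in>UNIV. y j ^ (l j div 2))\<^sup>2 = (\<Prod>j\<in>UNIV. y j ^ l j)"
    if "\<And>j. even (l j)" for y :: "'i::finite \<Rightarrow> 'k" and l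
    using that by (simp add: prod_power_distrib flip: power_mult)
  have X_eq: "X = conic_lattice.X ?blk ?h"
    unfolding X trinomial_def X_def A_def sum_block prods by (simp add: square ev)
  show ?thesis
    unfolding \<DD>_eq X_eq \<sigma> \<sigma>_def[symmetric] using pp_divisor_\<DD> corresponds_\<DD> by blast
qed

end
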